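(* For every LAC datum $(\mathscr{A},S,I)$ there is a canonical equivalent reduced LAC datum $(\mathscr{A}',I')$; that is, there is a canonical reduced LAC datum $(\mathscr{A}',I')$ such that $\pi_1(M(\mathscr{A},S,I))\cong\pi_1(M(\mathscr{A}',I'))$.
   Context: A LAC datum is a triple $(\mathscr{A},S,I)$ where $\mathscr{A}=\{L_1,\dots,L_k\}$ is an arrangement of lines in $\mathbb{P}^2=\mathbb{CP}^2$ (the empty arrangement is allowed), $S=\{p_1,\dots,p_s\}$ is a finite set of points of $\mathbb{P}^2$, and $I\subset\{1,\dots,k+s\}$. Let $\bar X$ be the blow up of $\mathbb{P}^2$ at the points of $S$, $D_1,\dots,D_k$ the strict transforms of $L_1,\dots,L_k$, and $D_{k+1},\dots,D_{k+s}$ the exceptional divisors over $p_1,\dots,p_s$. The associated surface is $M(\mathscr{A},S,I)=\bar X\setminus\bigcup_{j\notin I}D_j$ (the divisors with index in $I$ are kept and the others are removed). Two LAC data are equivalent if the fundamental groups of their associated surfaces are isomorphic. $\operatorname{Sing}\mathscr{A}$ is the set of points lying on at least two lines of $\mathscr{A}$. A LAC datum is reduced if $S\subset\operatorname{Sing}\mathscr{A}$ and $I=S$, meaning that $I$ is exactly the set of indices of the exceptional divisors over the points of $S$ (only points of $\operatorname{Sing}\mathscr{A}$ are blown up, all exceptional divisors are kept and all strict transforms of lines are removed); it is then written $(\mathscr{A},I)$ with surface $M(\mathscr{A},I)$. The word "canonical" is not given a separate formal definition; the datum $(\mathscr{A}',I')$ is the one produced from $(\mathscr{A},S,I)$ by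 the following reduction procedure: delete from $\mathscr{A}$ every line whose strict transform has index in $I$ (and its index from $I$); discard the points of $S$ lying on no line of the arrangement; discard the points of $S$ whose exceptional divisor does not have index in $I$; then, as long as some remaining point of $S$ lies on exactly one line $L$ of the arrangement, delete both that point and $L$ (again discarding points that lie on no line), until all remaining points are in $\operatorname{Sing}$ of the remaining arrangement or the arrangement is empty. *)

theory Defs
  imports "HOL-Analysis.Analysis" "HOL-Algebra.Group"
begin

section \<open>The complex projective plane\<close>

definition proportional :: "complex^3 \<Rightarrow> complex^3 \<Rightarrow> bool" where
  "proportional v w \<longleftrightarrow> v \<noteq> 0 \<and> w \<noteq> 0 \<and> (\<exists>c. c \<noteq> 0 \<and> w = c *s v)"

lemma part_equivp_proportional: "part_equivp proportional"
proof (rule part_equivpI)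
  have "axis 1 1 = (1::complex) *s (axis 1 1 :: complex^3)"
    by (simp add: vec_eq_iff)
  then have "proportional (axis 1 1) (axis 1 1)"
    unfolding proportional_def by (metis axis_eq_0_iff zero_neq_one)
  then show "\<exists>v. proportional v v" ..
  show "symp proportional"
  proof (rule sympI)
    fix v w assume "proportional v w"
    then obtain c where c: "v \<noteq> 0" "w \<noteq> 0" "c \<noteq> 0" "w = c *s v"
      unfolding proportional_def by blast
    then have "v = inverse c *s w"
      by (simp add: vec_eq_iff)
    then show "proportional w v"
      using c unfolding proportional_def by (metis inverse_nonzero_iff_nonzero)
  qed
  show "transp proportional"
  proof (rule transpI)
    fix u v w assume "proportional u v" "proportional v w"
    then obtain c d where "u \<noteq> 0" "w \<noteq> 0" "c \<noteq> 0" "v = c *s u" "d \<noteq> 0" "w = d *s v"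
      unfolding proportional_def by blast
    moreover from this have "w = (d * c) *s u"
      by (simp add: vec_eq_iff)
    ultimately show "proportional u w"
      unfolding proportional_def by (metis mult_eq_0_iff)
  qed
qed

quotient_type cp2 = "complex^3" / partial: proportional
  by (rule part_equivp_proportional)

instantiation cp2 :: topological_space
begin

definition open_cp2 :: "cp2 set \<Rightarrow> bool" where
  "open_cp2 U \<longleftrightarrow> open {v. v \<noteq> 0 \<and> abs_cp2 v \<in> U}"

instance
proof
  have "{v::complex^3. v \<noteq> 0 \<and> abs_cp2 v \<in> UNIV} = - {0}" by auto
  then show "open (UNIV :: cp2 set)"
    by (simp add: open_cp2_def open_Compl)
next
  fix U V :: "cp2 set"
  assume "open U" "open V"
  moreover have "{v. v \<noteq> 0 \<and> abs_cp2 v \<in> U \<inter> V} =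
      {v. v \<noteq> 0 \<and> abs_cp2 v \<in> U} \<inter> {v. v \<noteq> 0 \<and> abs_cp2 v \<in> V}" by auto
  ultimately show "open (U \<inter> V)"
    by (simp add: open_cp2_def open_Int)
next
  fix K :: "cp2 set set"
  assume "\<forall>U\<in>K. open U"
  moreover have "{v. v \<noteq> 0 \<and> abs_cp2 v \<in> \<Union>K} = (\<Union>U\<in>K. {v. v \<noteq> 0 \<and> abs_cp2 v \<in> U})" by auto
  ultimately show "open (\<Union>K)"
    by (auto simp: open_cp2_def)
qed

end

text \<open>The dual plane is represented by the same type: a = [a1:a2:a3] stands for the line
  with equation a1 x1 + a2 x2 + a3 x3 = 0, and distinct a give distinct lines.\<close>

lift_definition incident :: "cp2 \<Rightarrow> cp2 \<Rightarrow> bool" is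
  "\<lambda>a x. (\<Sum>i\<in>UNIV. a $ i * x $ i) = 0"
proof -
  fix a a' x x' :: "complex^3"
  assume "proportional a a'" "proportional x x'"
  then obtain c d where c: "c \<noteq> 0" "a' = c *s a" and d: "d \<noteq> 0" "x' = d *s x"
    unfolding proportional_def by blast
  have "(\<Sum>i\<in>UNIV. a' $ i * x' $ i) = (c * d) * (\<Sum>i\<in>UNIV. a $ i * x $ i)"
    by (simp add: c d sum_distrib_left algebra_simps)
  then show "((\<Sum>i\<in>UNIV. a $ i * x $ i) = 0) = ((\<Sum>i\<in>UNIV. a' $ i * x' $ i) = 0)"
    using c d by simp
qed

definition line :: "cp2 \<Rightarrow> cp2 set" where
  "line a = {x. incident a x}"

definition Sing :: "cp2 set set \<Rightarrow> cp2 set" where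
  "Sing \<A> = {p. \<exists>L\<in>\<A>. \<exists>L'\<in>\<A>. L \<noteq> L' \<and> p \<in> L \<and> p \<in> L'}"


section \<open>Blow-ups of the projective plane\<close>

text \<open>The blow-up of the plane at p is the incidence variety of all (x, l) with l a line
  through p and x. The blow-up at the points of S is the fibre product over the plane of the
  blow-ups at the points p of S; a point of it is a pair (x, l) with l p a line through p and x
  for every p in S. Outside S, the function l has the fixed value undefined, so that the
  topology (inherited from the product topology on functions) is the one of the product over S.\<close>

type_synonym blowup_point = "cp2 \<times> (cp2 \<Rightarrow> cp2)"

definition blowup :: "cp2 set \<Rightarrow> blowup_point set" where
  "blowup S = {(x, l). l \<in> (\<Pi>\<^sub>E p\<in>S. {a. p \<in> line a \<and> x \<in> line a})}"

definition strict_transform :: "cp2 set \<Rightarrow> cp2 set \<Rightarrow> blowup_point set" where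
  "strict_transform S L = blowup S \<inter> closure {z \<in> blowup S. fst z \<in> L - S}"

definition exceptional :: "cp2 set \<Rightarrow> cp2 \<Rightarrow> blowup_point set" where
  "exceptional S p = {z \<in> blowup S. fst z = p}"


section \<open>LAC data\<close>

text \<open>The index set {1..k+s} of the divisors is replaced by the disjoint union of the
  arrangement and S: Inl L is the index of the strict transform of L, and Inr p that of the
  exceptional divisor over p.\<close>

type_synonym divisor_index = "cp2 set + cp2"

fun divisor :: "cp2 set \<Rightarrow> divisor_index \<Rightarrow> blowup_point set" where
  "divisor S (Inl L) = strict_transform S L"
| "divisor S (Inr p) = exceptional S p"

definition LAC_datum :: "cp2 set set \<Rightarrow> cp2 set \<Rightarrow> divisor_index set \<Rightarrow> bool" where
  "LAC_datum \<A> S I \<longleftrightarrow> finite \<A> \<and> \<A> \<subseteq> range line \<and> finite S \<and> I \<subseteq> \<A> <+> S"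

definition LAC_surface :: "cp2 set set \<Rightarrow> cp2 set \<Rightarrow> divisor_index set \<Rightarrow> blowup_point set" where
  "LAC_surface \<A> S I = blowup S - (\<Union>j \<in> (\<A> <+> S) - I. divisor S j)"

definition reduced_LAC_datum :: "cp2 set set \<Rightarrow> cp2 set \<Rightarrow> divisor_index set \<Rightarrow> bool" where
  "reduced_LAC_datum \<A> S I \<longleftrightarrow> LAC_datum \<A> S I \<and> S \<subseteq> Sing \<A> \<and> I = Inr ` S"


section \<open>Fundamental groups\<close>

definition loops :: "'a::topological_space set \<Rightarrow> 'a \<Rightarrow> (real \<Rightarrow> 'a) set" where
  "loops X x = {p. path p \<and> path_image p \<subseteq> X \<and> pathstart p = x \<and> pathfinish p = x}"

definition loop_homotopy :: "'a::topological_space set \<Rightarrow> 'a \<Rightarrow> ((real \<Rightarrow> 'a) \<times> (real \<Rightarrow> 'a)) set" where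
  "loop_homotopy X x = {(p, q) \<in> loops X x \<times> loops X x. homotopic_paths X p q}"

definition fundamental_group :: "'a::topological_space set \<Rightarrow> 'a \<Rightarrow> (real \<Rightarrow> 'a) set monoid" where
  "fundamental_group X x =
    \<lparr>carrier = loops X x // loop_homotopy X x,
     mult = (\<lambda>P Q. \<Union>p\<in>P. \<Union>q\<in>Q. loop_homotopy X x `` {p +++ q}),
     one = loop_homotopy X x `` {\<lambda>_. x}\<rparr>"

lemma equiv_loop_homotopy: "equiv (loops X x) (loop_homotopy X x)"
proof (rule equivI)
  show "loop_homotopy X x \<subseteq> loops X x \<times> loops X x"
    by (auto simp: loop_homotopy_def)
  show "refl_on (loops X x) (loop_homotopy X x)"
    by (rule refl_onI) (auto simp: loop_homotopy_def loops_def)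
  show "sym (loop_homotopy X x)"
    by (rule symI) (auto simp: loop_homotopy_def homotopic_paths_sym)
  show "trans (loop_homotopy X x)"
    by (rule transI) (auto simp: loop_homotopy_def intro: homotopic_paths_trans)
qed

lemma join_loops: "p \<in> loops X x \<Longrightarrow> q \<in> loops X x \<Longrightarrow> p +++ q \<in> loops X x"
  by (auto simp: loops_def path_join_imp path_image_join)

lemma const_loops: "x \<in> X \<Longrightarrow> (\<lambda>_. x) \<in> loops X x"
  by (auto simp: loops_def path_def path_image_def pathstart_def pathfinish_def)

lemma reverse_loops: "p \<in> loops X x \<Longrightarrow> reversepath p \<in> loops X x"
  by (auto simp: loops_def)

lemma loop_class_eq:
  assumes "p \<in> loops X x" "q \<in> loops X x" "homotopic_paths X p q"
  shows "loop_homotopy X x `` {p} = loop_homotopy X x `` {q}"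
  using equiv_loop_homotopy assms by (intro equiv_class_eq) (auto simp: loop_homotopy_def)

lemma mult_fundamental_group:
  assumes "p \<in> loops X x" "q \<in> loops X x"
  shows "loop_homotopy X x `` {p} \<otimes>\<^bsub>fundamental_group X x\<^esub> loop_homotopy X x `` {q} =
    loop_homotopy X x `` {p +++ q}"
proof -
  let ?c = "\<lambda>p. loop_homotopy X x `` {p}"
  have *: "?c (p' +++ q') = ?c (p +++ q)" if "p' \<in> ?c p" "q' \<in> ?c q" for p' q'
    using that
    by (intro loop_class_eq join_loops homotopic_paths_join)
       (auto simp: loop_homotopy_def loops_def homotopic_paths_sym)
  have "p \<in> ?c p" "q \<in> ?c q"
    using assms by (auto simp: loop_homotopy_def loops_def)
  then have ne: "?c p \<noteq> {}" "?c q \<noteq> {}"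
    by blast+
  have "(\<Union>p'\<in>?c p. \<Union>q'\<in>?c q. ?c (p' +++ q')) = (\<Union>p'\<in>?c p. \<Union>q'\<in>?c q. ?c (p +++ q))"
    by (intro SUP_cong refl *)
  also have "\<dots> = ?c (p +++ q)"
    using ne by (simp only: UN_constant if_False)
  finally show ?thesis
    by (simp only: fundamental_group_def monoid.simps)
qed

lemma homotopic_paths_const_join:
  assumes "path p" "path_image p \<subseteq> X" "pathstart p = x"
  shows "homotopic_paths X ((\<lambda>_. x) +++ p) p"
proof -
  have cont: "continuous_on {0..1} (\<lambda>t::real. max 0 (2 * t - 1))"
    by (intro continuous_intros)
  have eq: "((\<lambda>_. x) +++ p) t = p (max 0 (2 * t - 1))" if "t \<in> {0..1}" for t
    using assms(3) by (cases "2 * t = 1") (auto simp: joinpaths_def pathstart_def max_def)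
  show ?thesis
    by (rule homotopic_paths_sym, rule homotopic_paths_reparametrize[OF assms(1,2) cont])
       (auto simp: eq)
qed

lemma homotopic_paths_reversepath_join:
  assumes "path p" "path_image p \<subseteq> X" "pathfinish p = x"
  shows "homotopic_paths X (reversepath p +++ p) (\<lambda>_. x)"
proof -
  have p: "continuous_on {0..1} p" and im: "\<And>t. t \<in> {0..1} \<Longrightarrow> p t \<in> X"
    using assms by (auto simp: path_def path_image_def)
  let ?f = "\<lambda>y::real \<times> real. 1 - (1 - fst y) * min (2 * snd y) (2 - 2 * snd y)"
  have f: "?f y \<in> {0..1}" if "y \<in> {0..1} \<times> {0..1}" for y
  proof -
    have "0 \<le> min (2 * snd y) (2 - 2 * snd y)" "min (2 * snd y) (2 - 2 * snd y) \<le> 1"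
      using that by (auto simp: min_def)
    moreover have "0 \<le> 1 - fst y" "1 - fst y \<le> 1"
      using that by auto
    ultimately show ?thesis
      using mult_le_one[of "1 - fst y" "min (2 * snd y) (2 - 2 * snd y)"]
        mult_nonneg_nonneg[of "1 - fst y" "min (2 * snd y) (2 - 2 * snd y)"]
      by simp
  qed
  have "continuous_on ({0..1} \<times> {0..1}) (\<lambda>y. p (?f y))"
    by (rule continuous_on_compose2[OF p]) (use f in \<open>auto intro!: continuous_intros\<close>)
  moreover have "p (?f (0, t)) = (reversepath p +++ p) t" for t
    by (auto simp: joinpaths_def reversepath_def min_def)
  moreover have "p (?f (1, t)) = x" "p (?f (s, 0)) = x" "p (?f (s, 1)) = x" for s t
    using assms(3) by (auto simp: pathfinish_def)
  ultimately show ?thesis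
    unfolding homotopic_paths using im f assms(3)
    by (intro exI[of _ "\<lambda>y. p (?f y)"])
       (auto simp: Pi_iff pathstart_def pathfinish_def joinpaths_def reversepath_def)
qed

lemma group_fundamental_group:
  assumes x: "x \<in> X"
  shows "group (fundamental_group X x)"
proof -
  let ?G = "fundamental_group X x"
  let ?c = "\<lambda>p. loop_homotopy X x `` {p}"
  have car: "carrier ?G = ?c ` loops X x"
    by (auto simp: fundamental_group_def quotient_def)
  have one: "\<one>\<^bsub>?G\<^esub> = ?c (\<lambda>_. x)"
    by (simp add: fundamental_group_def)
  show ?thesis
  proof (rule groupI, unfold car one)
    fix P Q assume "P \<in> ?c ` loops X x" "Q \<in> ?c ` loops X x"
    then show "P \<otimes>\<^bsub>?G\<^esub> Q \<in> ?c ` loops X x"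
      by (auto simp: mult_fundamental_group join_loops)
  next
    show "?c (\<lambda>_. x) \<in> ?c ` loops X x"
      using const_loops[OF x] by blast
  next
    fix P Q R assume "P \<in> ?c ` loops X x" "Q \<in> ?c ` loops X x" "R \<in> ?c ` loops X x"
    then obtain p q r where *: "p \<in> loops X x" "q \<in> loops X x" "r \<in> loops X x"
      "P = ?c p" "Q = ?c q" "R = ?c r" by auto
    have "homotopic_paths X ((p +++ q) +++ r) (p +++ (q +++ r))"
      using * by (intro homotopic_paths_sym[OF homotopic_paths_assoc]) (auto simp: loops_def)
    then show "P \<otimes>\<^bsub>?G\<^esub> Q \<otimes>\<^bsub>?G\<^esub> R = P \<otimes>\<^bsub>?G\<^esub> (Q \<otimes>\<^bsub>?G\<^esub> R)"
      using * by (simp add: mult_fundamental_group join_loops loop_class_eq)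
  next
    fix P assume "P \<in> ?c ` loops X x"
    then obtain p where p: "p \<in> loops X x" "P = ?c p" by auto
    have "homotopic_paths X ((\<lambda>_. x) +++ p) p"
      using p homotopic_paths_const_join[of p X x] by (auto simp: loops_def)
    then show "?c (\<lambda>_. x) \<otimes>\<^bsub>?G\<^esub> P = P"
      using p const_loops[OF x] by (simp add: mult_fundamental_group join_loops loop_class_eq)
    have "homotopic_paths X (reversepath p +++ p) (\<lambda>_. x)"
      using p homotopic_paths_reversepath_join[of p X x] by (auto simp: loops_def)
    then have "?c (reversepath p) \<otimes>\<^bsub>?G\<^esub> P = ?c (\<lambda>_. x)"
      using p const_loops[OF x] by (simp add: mult_fundamental_group join_loops reverse_loops loop_class_eq)
    then show "\<exists>Q\<in>?c ` loops X x. Q \<otimes>\<^bsub>?G\<^esub> P = ?c (\<lambda>_. x)"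
      using reverse_loops[OF p(1)] by blast
  qed
qed

text \<open>LAC surfaces are non-empty and path-connected, so that the isomorphism type of the
  fundamental group does not depend on the base point; the isomorphism is required for every
  choice of base points.\<close>

definition isomorphic_fundamental_groups ::
  "'a::topological_space set \<Rightarrow> 'b::topological_space set \<Rightarrow> bool" where
  "isomorphic_fundamental_groups X Y \<longleftrightarrow> X \<noteq> {} \<and> Y \<noteq> {} \<and>
    (\<forall>x\<in>X. \<forall>y\<in>Y. fundamental_group X x \<cong> fundamental_group Y y)"

definition LAC_equivalent ::
  "cp2 set set \<Rightarrow> cp2 set \<Rightarrow> divisor_index set \<Rightarrow> cp2 set set \<Rightarrow> cp2 set \<Rightarrow> divisor_index set \<Rightarrow> bool" where
  "LAC_equivalent \<A> S I \<A>' S' I' \<longleftrightarrow>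
    isomorphic_fundamental_groups (LAC_surface \<A> S I) (LAC_surface \<A>' S' I')"


section \<open>The reduction procedure\<close>

definition discard_free :: "cp2 set set \<Rightarrow> cp2 set \<Rightarrow> cp2 set" where
  "discard_free \<A> S = {p \<in> S. \<exists>L\<in>\<A>. p \<in> L}"

definition initial_lines :: "cp2 set set \<Rightarrow> divisor_index set \<Rightarrow> cp2 set set" where
  "initial_lines \<A> I = {L \<in> \<A>. Inl L \<notin> I}"

definition initial_points :: "cp2 set set \<Rightarrow> cp2 set \<Rightarrow> divisor_index set \<Rightarrow> cp2 set" where
  "initial_points \<A> S I = {p \<in> discard_free (initial_lines \<A> I) S. Inr p \<in> I}"

inductive reduction_step :: "cp2 set set \<times> cp2 set \<Rightarrow> cp2 set set \<times> cp2 set \<Rightarrow> bool" where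
  "p \<in> S \<Longrightarrow> {M \<in> \<A>. p \<in> M} = {L} \<Longrightarrow>
    reduction_step (\<A>, S) (\<A> - {L}, discard_free (\<A> - {L}) (S - {p}))"

text \<open>The pair (A', P) is the final state of some run of the procedure on (A, S, I); a run may
  treat the points lying on exactly one line in any order. P is the set of points that
  are still blown up, so the resulting datum is (A', P, Inr ` P).\<close>

definition reduces_to ::
  "cp2 set set \<Rightarrow> cp2 set \<Rightarrow> divisor_index set \<Rightarrow> cp2 set set \<Rightarrow> cp2 set \<Rightarrow> bool" where
  "reduces_to \<A> S I \<A>' P \<longleftrightarrow>
    reduction_step\<^sup>*\<^sup>* (initial_lines \<A> I, initial_points \<A> S I) (\<A>', P) \<and>
    (\<nexists>D. reduction_step (\<A>', P) D)"

end

theory Submission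
  imports Defs "HOL-Library.Confluence"
begin

text \<open>By van Kampen's theorem, adding a connected smooth divisor to a surface kills exactly the
  conjugates of a meridian of that divisor. If a blown-up point \<open>p\<close> lies on exactly one line \<open>L\<close>,
  then a meridian of the exceptional divisor over \<open>p\<close> is, outside the lines, also a meridian of \<open>L\<close>.
  Hence keeping the exceptional divisor over \<open>p\<close> has the same effect on the fundamental group as
  putting \<open>L\<close> back and not blowing up \<open>p\<close>. Points on no line only trade a point for a sphere, and
  a removed exceptional divisor over a point of a line does not change the surface at all.

  No presentations of groups are needed. Let \<open>X\<close> and \<open>Y\<close> both contain the complement \<open>U\<close> of a divisor.
  If every point of \<open>X\<close> has a neighbourhood \<open>V\<close> such that the loops in \<open>V \<inter> U\<close> are null-homotopic in \<open>Y\<close>,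
  then a fine grid on a homotopy in \<open>X\<close> can be pushed into \<open>U\<close>, so paths in \<open>U\<close> that are homotopic in \<open>X\<close>
  are homotopic in \<open>Y\<close>; with the symmetric condition the fundamental groups are isomorphic. The
  condition only has to be checked in charts at \<open>p\<close>, and is transported along \<open>L\<close>.\<close>


section \<open>Homotopies in arbitrary spaces\<close>

text \<open>The comparison map between two surfaces is a homeomorphism of divisor complements only:
  blowing up at \<open>p\<close> is not defined over \<open>p\<close>, so a homotopy cannot simply
  be composed with it. This is why the conditions concern small loops. In one direction they hold
  because blowing down extends continuously over \<open>p\<close>, so loops near the exceptional
  curve land in a small bidisc. In the other direction a loop around \<open>L\<close> near
  \<open>p\<close> becomes contractible because the blow-up has a chart at \<open>p\<close> with
  every direction except that of \<open>L\<close>; there the bidisc minus \<open>L\<close> sits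
  inside a star-shaped domain of the surface. That the exceptional curve is kept and that no other
  line meets \<open>p\<close> enters here.

  Points of the blow-up have a function as a component and no norm; contractions and general
  position are done in C^2 or in the parameter square and carried over by charts.

  Canonicity is a rewriting statement: each step deletes a line, so the procedure stops, and
  different steps commute, so the final state does not depend on the order. It is reduced because
  each remaining point lies on some line, but not on exactly one.\<close>

text \<open>HOL-Analysis phrases the groupoid laws with linear paths, hence only for normed spaces. They are
  transferred from convex parameter domains.\<close>

lemma homotopic_paths_image_convex:
  fixes D :: "'c::real_normed_vector set"
  assumes "convex D" "continuous_on D h" "h ` D \<subseteq> S"
    and "path a" "path_image a \<subseteq> D" "path b" "path_image b \<subseteq> D"
    and "pathstart b = pathstart a" "pathfinish b = pathfinish a"
  shows "homotopic_paths S (h \<circ> a) (h \<circ> b)"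
proof (rule homotopic_paths_continuous_image)
  show "homotopic_paths D a b"
    using assms convex_imp_simply_connected[OF assms(1)]
      unfolding simply_connected_eq_homotopic_paths by blast
qed (use assms in auto)

lemma path_join_linepath_Icc:
  fixes u v w a b :: real
  assumes "u \<in> {a..b}" "v \<in> {a..b}" "w \<in> {a..b}"
  shows "path (linepath u v +++ linepath v w)" "path_image (linepath u v +++ linepath v w) \<subseteq> {a..b}"
    "path_image (linepath u v) \<subseteq> {a..b}"
proof -
  have "path_image (linepath x y) \<subseteq> {a..b}" if "x \<in> {a..b}" "y \<in> {a..b}" for x y
    using that unfolding path_image_linepath by (rule closed_segment_subset) (rule convex_real_interval)
  then show "path_image (linepath u v +++ linepath v w) \<subseteq> {a..b}" "path_image (linepath u v) \<subseteq> {a..b}"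
    using assms by (simp_all add: path_image_join)
qed auto

lemma homotopic_paths_join_const:
  assumes "path p" "path_image p \<subseteq> S" "pathfinish p = x"
  shows "homotopic_paths S (p +++ (\<lambda>_. x)) p"
proof -
  have "homotopic_paths S (p \<circ> (linepath 0 1 +++ linepath 1 1)) (p \<circ> linepath 0 1)"
    using assms(1,2) path_join_linepath_Icc[of 0 0 1 1 1]
    by (intro homotopic_paths_image_convex[of "{0..1}"]) (auto simp: path_def path_image_def[of p])
  moreover have "p \<circ> (linepath 0 1 +++ linepath 1 1) = p +++ (\<lambda>_. x)" "p \<circ> linepath 0 1 = p"
    using assms(3) by (auto simp: joinpaths_def linepath_def pathfinish_def algebra_simps)
  ultimately show ?thesis by simp
qed

lemma homotopic_paths_join_reversepath:
  assumes "path p" "path_image p \<subseteq> S" "pathstart p = x"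
  shows "homotopic_paths S (p +++ reversepath p) (\<lambda>_. x)"
  using homotopic_paths_reversepath_join[of "reversepath p" S x] assms by simp

lemma path_segment:
  assumes "path p" "u \<in> {0..1}" "v \<in> {0..1}"
  shows "path (p \<circ> linepath u v)" "path_image (p \<circ> linepath u v) \<subseteq> path_image p"
proof -
  have "path_image (linepath u v) \<subseteq> {0..1}"
    using assms path_join_linepath_Icc(3)[of u 0 1 v v] by simp
  then show "path (p \<circ> linepath u v)" "path_image (p \<circ> linepath u v) \<subseteq> path_image p"
    using assms(1) by (auto simp: path_image_compose path_image_def[of p] path_def[of p]
        intro!: path_continuous_image intro: continuous_on_subset)
qed

lemma homotopic_paths_join_segments:
  assumes "path p" "path_image p \<subseteq> S" "u \<in> {0..1}" "v \<in> {0..1}" "w \<in> {0..1}"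
  shows "homotopic_paths S ((p \<circ> linepath u v) +++ (p \<circ> linepath v w)) (p \<circ> linepath u w)"
  unfolding path_compose_join[symmetric]
  using assms path_join_linepath_Icc[of u 0 1 v w] path_join_linepath_Icc[of u 0 1 w w]
  by (intro homotopic_paths_image_convex[of "{0..1}"]) (auto simp: path_def path_image_def[of p])

text \<open>In the square of the free homotopy the edge \<open>v\<close>, which carries
  \<open>p\<close>, is homotopic to the detour along the other three edges. Two of those carry the
  same path run in opposite directions, because every stage of the homotopy is a loop, and the third
  carries the constant.\<close>

lemma homotopic_loops_const_imp_homotopic_paths_const:
  assumes "homotopic_loops S p (\<lambda>_. a)" "pathstart p = x"
  shows "homotopic_paths S p (\<lambda>_. x)"
proof -
  let ?A = "{0..1::real} \<times> {0..1::real}"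
  obtain h where h: "continuous_on ?A h" "h \<in> ?A \<rightarrow> S"
    "\<And>t. t \<in> {0..1} \<Longrightarrow> h (0, t) = p t" "\<And>t. t \<in> {0..1} \<Longrightarrow> h (1, t) = a"
    "\<And>s. s \<in> {0..1} \<Longrightarrow> h (s, 1) = h (s, 0)"
    using assms(1) by (auto simp: homotopic_loops pathstart_def pathfinish_def)
  define l r u v where lruv: "l = (\<lambda>s::real. (s, 0::real))" "r = (\<lambda>s::real. (s, 1::real))"
    "u = (\<lambda>t. (1::real, t::real))" "v = (\<lambda>t. (0::real, t::real))"
  have paths: "path l" "path r" "path u" "path v"
    unfolding lruv path_def by (intro continuous_intros)+
  have ends: "pathstart l = (0,0)" "pathfinish l = (1,0)" "pathstart r = (0,1)" "pathfinish r = (1,1)"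
    "pathstart u = (1,0)" "pathfinish u = (1,1)" "pathstart v = (0,0)" "pathfinish v = (0,1)"
    by (simp_all add: pathstart_def pathfinish_def lruv)
  have im: "path_image l \<subseteq> ?A" "path_image r \<subseteq> ?A" "path_image u \<subseteq> ?A" "path_image v \<subseteq> ?A"
    by (auto simp: path_image_def lruv)
  let ?c = "l +++ (u +++ reversepath r)"
  have c: "path ?c" "path_image ?c \<subseteq> ?A" "pathstart ?c = pathstart v" "pathfinish ?c = pathfinish v"
    using paths im by (simp_all add: ends path_image_join)
  have "homotopic_paths S (h \<circ> v) (h \<circ> ?c)"
    using h(2) by (intro homotopic_paths_image_convex[OF _ h(1) _ paths(4) im(4) c]) (auto simp:
      convex_Times)
  moreover have "homotopic_paths S p (h \<circ> v)"
    using homotopic_loops_imp_path[OF assms(1)] homotopic_loops_imp_subset[OF assms(1)] h(3)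
    by (intro homotopic_paths_eq) (auto simp: lruv)
  moreover have "homotopic_paths S (h \<circ> ?c) (\<lambda>_. x)"
  proof -
    let ?L = "h \<circ> l"
    have hS: "path (h \<circ> g)" "path_image (h \<circ> g) \<subseteq> S" if "path g" "path_image g \<subseteq> ?A" for g
      using that h(1,2) by (auto intro!: path_continuous_image intro: continuous_on_subset simp:
        path_image_compose)
    have L: "path ?L" "path_image ?L \<subseteq> S" "pathstart ?L = x" "pathfinish ?L = a"
      using hS[OF paths(1) im(1)] h(3)[of 0] h(4)[of 0] assms(2)
      by (simp_all add: pathstart_compose pathfinish_compose ends pathstart_def[of p])
    have "homotopic_paths S ?L ?L"
      using L by simp
    moreover have "homotopic_paths S (h \<circ> u) (\<lambda>_. a)"
      using hS[OF paths(3) im(3)] h(4) by (intro homotopic_paths_eq) (auto simp: lruv)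
    moreover have "homotopic_paths S (reversepath (h \<circ> r)) (reversepath ?L)"
      unfolding homotopic_paths_reversepath
      using hS[OF paths(2) im(2)] h(5) by (intro homotopic_paths_eq) (auto simp: lruv)
    ultimately have "homotopic_paths S (?L +++ ((h \<circ> u) +++ reversepath (h \<circ> r))) (?L +++ ((\<lambda>_. a)
        +++ reversepath ?L))"
      using h(4)[of 0] by (intro homotopic_paths_join) (simp_all add: pathstart_compose
        pathfinish_compose ends)
    then have "homotopic_paths S (h \<circ> ?c) (?L +++ ((\<lambda>_. a) +++ reversepath ?L))"
      by (simp only: path_compose_join path_compose_reversepath)
    also have "homotopic_paths S \<dots> (?L +++ reversepath ?L)"
      using L \<open>homotopic_paths S ?L ?L\<close> by (intro homotopic_paths_join homotopic_paths_const_join) (simp_all add: pathstart_def[of "\<lambda>_. a"])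
    also have "homotopic_paths S \<dots> (\<lambda>_. x)"
      using L(1-3) by (rule homotopic_paths_join_reversepath)
    finally show ?thesis .
  qed
  ultimately show ?thesis
    using homotopic_paths_trans by metis
qed

text \<open>Insert \<open>reversepath q +++ q\<close> after \<open>p\<close> and regroup.\<close>

lemma homotopic_paths_if_loop_null:
  assumes "homotopic_paths S (p +++ reversepath q) (\<lambda>_. x)"
    and p: "path p" "path_image p \<subseteq> S" and q: "path q" "path_image q \<subseteq> S"
    and "pathstart q = pathstart p" "pathfinish q = pathfinish p"
  shows "homotopic_paths S p q"
proof -
  have "pathstart (p +++ reversepath q) = pathstart (\<lambda>_::real. x)"
    using assms(1) by (rule homotopic_paths_imp_pathstart)
  then have x: "x = pathstart q"
    using assms by (simp add: pathstart_def[of "\<lambda>_. x"])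
  have "homotopic_paths S p (p +++ (\<lambda>_. pathfinish p))"
    using p by (intro homotopic_paths_sym[OF homotopic_paths_join_const]) auto
  also have "homotopic_paths S \<dots> (p +++ (reversepath q +++ q))"
    using assms by (intro homotopic_paths_join homotopic_paths_sym[OF homotopic_paths_reversepath_join])
      (auto simp: pathstart_def)
  also have "homotopic_paths S \<dots> ((p +++ reversepath q) +++ q)"
    using assms by (intro homotopic_paths_assoc) auto
  also have "homotopic_paths S \<dots> ((\<lambda>_. x) +++ q)"
    using assms by (intro homotopic_paths_join) auto
  also have "homotopic_paths S \<dots> q"
    using assms x by (intro homotopic_paths_const_join) auto
  finally show ?thesis .
qed


section \<open>A van Kampen argument\<close>

text \<open>The homotopy is free: the constant loop may sit anywhere in \<open>Y\<close>, and so the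
  property survives moving a loop away from its base point, as in the transport along a
  line.\<close>

definition loops_vanish ::
    "'b::topological_space set \<Rightarrow> ('a::topological_space \<Rightarrow> 'b) \<Rightarrow> 'a set \<Rightarrow> bool" where
  "loops_vanish Y f W \<longleftrightarrow> (\<forall>p. path p \<longrightarrow> path_image p \<subseteq> W \<longrightarrow> pathfinish p = pathstart p \<longrightarrow>
    (\<exists>a. homotopic_loops Y (f \<circ> p) (\<lambda>_. a)))"

lemma loops_vanish_subset: "loops_vanish Y f W \<Longrightarrow> W' \<subseteq> W \<Longrightarrow> loops_vanish Y f W'"
  unfolding loops_vanish_def by blast

text \<open>The lift \<open>q\<close> is any loop in \<open>D\<close> whose image under
  \<open>g\<close> is that of \<open>p\<close> under \<open>f\<close>; no inverse of
  \<open>g\<close> enters, and \<open>g\<close> may map onto a larger part of \<open>Y\<close> than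
  \<open>f\<close> reaches. The chart that contains a part of the exceptional curve is used in this
  way.\<close>

lemma loops_vanish_simply_connected:
  fixes D :: "'c::real_normed_vector set"
  assumes D: "simply_connected D" and g: "continuous_on D g" "g ` D \<subseteq> Y"
    and lift: "\<And>p. path p \<Longrightarrow> path_image p \<subseteq> W \<Longrightarrow> pathfinish p = pathstart p \<Longrightarrow>
      \<exists>q. path q \<and> path_image q \<subseteq> D \<and> pathfinish q = pathstart q \<and> (\<forall>t\<in>{0..1}. f (p t) = g (q t))"
  shows "loops_vanish Y f W"
  unfolding loops_vanish_def
proof (intro allI impI)
  fix p assume p: "path p" "path_image p \<subseteq> W" "pathfinish p = pathstart p"
  obtain q where q: "path q" "path_image q \<subseteq> D" "pathfinish q = pathstart q"
    "\<forall>t\<in>{0..1}. f (p t) = g (q t)"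
    using lift[OF p] by blast
  have "pathstart q \<in> D"
    using q(2) pathstart_in_path_image by blast
  then have "homotopic_loops D q (linepath (pathstart q) (pathstart q))"
    using D q simply_connected_eq_contractible_loop_any by blast
  moreover have "linepath (pathstart q) (pathstart q) = (\<lambda>_. pathstart q)"
    by (auto simp: linepath_def algebra_simps)
  ultimately have "homotopic_loops D q (\<lambda>_. pathstart q)"
    by simp
  then have 1: "homotopic_loops Y (g \<circ> q) (g \<circ> (\<lambda>_. pathstart q))"
    by (rule homotopic_loops_continuous_image) (use g in auto)
  have "homotopic_loops Y (f \<circ> p) (g \<circ> q)"
  proof (rule homotopic_loops_sym, rule homotopic_loops_eq)
    show "path (g \<circ> q)"
      using 1 homotopic_loops_imp_path by blast
    show "path_image (g \<circ> q) \<subseteq> Y"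
      using 1 homotopic_loops_imp_subset by blast
    show "pathfinish (g \<circ> q) = pathstart (g \<circ> q)"
      using 1 homotopic_loops_imp_loop by blast
  qed (use q(4) in auto)
  then have "homotopic_loops Y (f \<circ> p) (g \<circ> (\<lambda>_. pathstart q))"
    using 1 by (rule homotopic_loops_trans)
  then have "homotopic_loops Y (f \<circ> p) (\<lambda>_. g (pathstart q))"
    by (simp add: o_def)
  then show "\<exists>a. homotopic_loops Y (f \<circ> p) (\<lambda>_. a)" ..
qed

text \<open>Two such paths differ by a loop in \<open>W\<close>. Vanishing gives a free homotopy,
  which is upgraded to one with fixed end points.\<close>

lemma loops_vanish_homotopic_paths:
  assumes "loops_vanish Y f W" "continuous_on W f" "f ` W \<subseteq> Y"
    and p: "path p" "path_image p \<subseteq> W" and q: "path q" "path_image q \<subseteq> W"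
    and "pathstart q = pathstart p" "pathfinish q = pathfinish p"
  shows "homotopic_paths Y (f \<circ> p) (f \<circ> q)"
proof (rule homotopic_paths_if_loop_null)
  let ?r = "p +++ reversepath q"
  have "path ?r" "path_image ?r \<subseteq> W" "pathfinish ?r = pathstart ?r"
    using assms by (auto simp: path_image_join)
  then obtain a where "homotopic_loops Y (f \<circ> ?r) (\<lambda>_. a)"
    using assms(1) unfolding loops_vanish_def by blast
  then show "homotopic_paths Y ((f \<circ> p) +++ reversepath (f \<circ> q)) (\<lambda>_. pathstart (f \<circ> p))"
    by (intro homotopic_loops_const_imp_homotopic_paths_const)
      (auto simp: path_compose_join path_compose_reversepath)
qed (use assms in \<open>auto intro!: path_continuous_image intro: continuous_on_subset
      simp: path_image_compose pathstart_compose pathfinish_compose image_subset_iff subset_iff\<close>)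

text \<open>\<open>U\<close> is to be thought of as the complement of a divisor in the manifold \<open>X\<close>: it is locally
  connected even near the points of the divisor.\<close>

definition tame_pair :: "'a::topological_space set \<Rightarrow> 'a set \<Rightarrow> bool" where
  "tame_pair X U \<longleftrightarrow> U \<subseteq> X \<and> (\<forall>z\<in>X. \<forall>N. open N \<longrightarrow> z \<in> N \<longrightarrow>
    (\<exists>V. open V \<and> z \<in> V \<and> V \<subseteq> N \<and> path_connected (V \<inter> X) \<and> loops_vanish X id (V \<inter> X) \<and>
      path_connected (V \<inter> U) \<and> V \<inter> U \<noteq> {}))"

lemma tame_pairD:
  assumes "tame_pair X U" "z \<in> X" "open N" "z \<in> N"
  shows "\<exists>V. open V \<and> z \<in> V \<and> V \<subseteq> N \<and> path_connected (V \<inter> X) \<and> loops_vanish X id (V \<inter> X) \<and>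
    path_connected (V \<inter> U) \<and> V \<inter> U \<noteq> {}"
  using assms unfolding tame_pair_def by blast

text \<open>Call two parameters related if all admissible points of \<open>U\<close> near their
  images are joined inside \<open>O'\<close>. This relation is locally constant along
  \<open>T\<close>, since overlaps of admissible neighbourhoods still contain points of
  \<open>U\<close>. Connectedness of \<open>T\<close> does the rest.\<close>

lemma tame_pair_path_component:
  fixes \<sigma> :: "'b::topological_space \<Rightarrow> 'a::topological_space"
  assumes XU: "tame_pair X U" and O: "open O'" and T: "connected T" "continuous_on T \<sigma>" "\<sigma> ` T \<subseteq> X \<inter> O'"
    and s: "s \<in> T" "open W" "\<sigma> s \<in> W" "W \<subseteq> O'" "path_connected (W \<inter> U)" "w \<in> W \<inter> U"
    and t: "t \<in> T" "open W'" "\<sigma> t \<in> W'" "W' \<subseteq> O'" "path_connected (W' \<inter> U)" "w' \<in> W' \<inter> U"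
  shows "path_component (O' \<inter> U) w w'"
proof -
  \<comment> \<open>\<open>J r\<close> collects the points of \<open>U\<close> that count as near
    \<open>\<sigma> r\<close>: those in a neighbourhood of \<open>\<sigma> r\<close> with
    path-connected trace on \<open>U\<close>.\<close>
  define J where "J r = {w. \<exists>W. open W \<and> \<sigma> r \<in> W \<and> W \<subseteq> O' \<and> path_connected (W \<inter> U) \<and> w \<in> W \<inter> U}" for r
  define R where "R r r' \<longleftrightarrow> (\<forall>w\<in>J r. \<forall>w'\<in>J r'. path_component (O' \<inter> U) w w')" for r r'
  have pc: "path_component (O' \<inter> U) u v"
    if "path_connected (W \<inter> U)" "W \<subseteq> O'" "u \<in> W \<inter> U" "v \<in> W \<inter> U" for W u v
    using that unfolding path_connected_component by (meson Int_mono order_refl path_component_of_subset)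
  have tame: "\<exists>V. open V \<and> \<sigma> r \<in> V \<and> V \<subseteq> N \<and> path_connected (V \<inter> U) \<and> V \<inter> U \<noteq> {}"
    if "r \<in> T" "open N" "\<sigma> r \<in> N" for r N
  proof -
    have "\<sigma> r \<in> X" using that T(3) by blast
    then show ?thesis
      using tame_pairD[OF XU _ that(2,3)] by metis
  qed
  have T_O: "\<sigma> r \<in> O'" if "r \<in> T" for r
    using that T(3) by blast
  have ne: "\<exists>w. w \<in> J r" if "r \<in> T" for r
    using tame[OF that O T_O[OF that]] unfolding J_def by blast
  have "R s t"
  proof (rule connected_equivalence_relation[OF T(1) s(1) t(1)])
    show "R y x" if "R x y" for x y
      using that path_component_sym unfolding R_def by blast
    show "R x z" if "R x y" "R y z" "x \<in> T" "y \<in> T" "z \<in> T" for x y z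
      using that ne[of y] path_component_trans unfolding R_def by meson
    fix a assume a: "a \<in> T"
    obtain W0 where W0: "open W0" "\<sigma> a \<in> W0" "W0 \<subseteq> O'" "path_connected (W0 \<inter> U)"
      using tame[OF a O T_O[OF a]] by blast
    define T0 where "T0 = T \<inter> \<sigma> -` W0"
    have "openin (top_of_set T) T0"
      unfolding T0_def using T(2) W0(1) by (rule continuous_openin_preimage_gen)
    moreover have "R a r" if "r \<in> T0" for r
      unfolding R_def
    proof (intro ballI)
      fix u v assume "u \<in> J a" "v \<in> J r"
      then obtain W1 W2 where W1: "open W1" "\<sigma> a \<in> W1" "W1 \<subseteq> O'" "path_connected (W1 \<inter> U)" "u \<in> W1 \<inter> U"
        and W2: "open W2" "\<sigma> r \<in> W2" "W2 \<subseteq> O'" "path_connected (W2 \<inter> U)" "v \<in> W2 \<inter> U"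
        unfolding J_def by blast
      \<comment> \<open>\<open>U\<close> is dense at points of \<open>X\<close>, so the overlaps
        meet \<open>U\<close>; their points link \<open>u\<close> to \<open>v\<close> through the
        traces of \<open>W1\<close>, \<open>W0\<close> and \<open>W2\<close>.\<close>
      have "\<exists>x. x \<in> (W0 \<inter> W1) \<inter> U"
        using tame[of a "W0 \<inter> W1"] W0 W1 a by blast
      moreover have "\<exists>x. x \<in> (W0 \<inter> W2) \<inter> U"
        using tame[of r "W0 \<inter> W2"] W0 W2 that unfolding T0_def by blast
      ultimately obtain x y where "x \<in> (W0 \<inter> W1) \<inter> U" "y \<in> (W0 \<inter> W2) \<inter> U"
        by blast
      then have "path_component (O' \<inter> U) u x" "path_component (O' \<inter> U) x y" "path_component (O' \<inter> U) y v"
        using pc[OF W1(4,3)] pc[OF W0(4,3)] pc[OF W2(4,3)] W1(5) W2(5) by auto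
      then show "path_component (O' \<inter> U) u v"
        using path_component_trans by metis
    qed
    ultimately show "\<exists>T0. openin (top_of_set T) T0 \<and> a \<in> T0 \<and> (\<forall>x\<in>T0. R a x)"
      using a W0 unfolding T0_def by blast
  qed
  moreover have "w \<in> J s" "w' \<in> J t"
    using s t unfolding J_def by blast+
  ultimately show ?thesis
    unfolding R_def by blast
qed

text \<open>The Lebesgue number is taken in the parameter square, which is compact and metric
  whatever the target space is.\<close>

lemma Lebesgue_grid:
  fixes h :: "real \<times> real \<Rightarrow> 'a::topological_space"
  assumes h: "continuous_on ({0..1} \<times> {0..1}) h"
    and P: "\<And>z. z \<in> h ` ({0..1} \<times> {0..1}) \<Longrightarrow> \<exists>V. open V \<and> z \<in> V \<and> P V"
  shows "\<exists>N::nat. N > 0 \<and> (\<forall>i<N. \<forall>j<N. \<exists>V. open V \<and> P V \<and> h ` ({i/N..Suc i/N} \<times> {j/N..Suc j/N}) \<subseteq> V)"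
proof -
  let ?S = "{0..1::real} \<times> {0..1::real}"
  define C where "C = {A. open A \<and> (\<exists>V. open V \<and> P V \<and> (\<forall>y\<in>A \<inter> ?S. h y \<in> V))}"
  have cov: "\<exists>A\<in>C. y \<in> A" if "y \<in> ?S" for y
  proof -
    have "h y \<in> h ` ?S" using that by (rule imageI)
    then obtain V where V: "open V" "h y \<in> V" "P V"
      using P by meson
    obtain A where A: "open A" "A \<inter> ?S = h -` V \<inter> ?S"
      using h V(1) unfolding continuous_on_open_invariant by meson
    then have "\<forall>x\<in>A \<inter> ?S. h x \<in> V"
      by (simp only: A(2)) simp
    then have "A \<in> C"
      using A(1) V(1,3) unfolding C_def mem_Collect_eq by meson
    moreover have "y \<in> A"
      using A(2) V(2) that by auto
    ultimately show ?thesis ..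
  qed
  have C: "compact ?S" "C \<noteq> {}" "?S \<subseteq> \<Union>C" "\<And>B. B \<in> C \<Longrightarrow> open B"
  proof -
    show "compact ?S"
      by (intro compact_Times compact_Icc)
    have "(0,0) \<in> ?S" by simp
    from cov[OF this] show "C \<noteq> {}" by auto
    show "?S \<subseteq> \<Union>C"
    proof
      fix y assume "y \<in> ?S"
      from cov[OF this] show "y \<in> \<Union>C" by blast
    qed
    show "open B" if "B \<in> C" for B using that by (simp add: C_def)
  qed
  obtain \<delta> where \<delta>: "\<delta> > 0" "\<And>T. T \<subseteq> ?S \<Longrightarrow> diameter T < \<delta> \<Longrightarrow> \<exists>B\<in>C. T \<subseteq> B"
    using Lebesgue_number_lemma[OF C] by metis
  \<comment> \<open>A cell of side 1/N has diameter at most 2/N by the triangle inequality, hence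
    the constant 2.\<close>
  obtain N :: nat where "2 / \<delta> < N"
    using reals_Archimedean2 by auto
  then have "0 < real N" "2 < \<delta> * N"
    using \<delta>(1) order_less_trans[of 0 "2 / \<delta>" "real N"] by (simp_all add: field_simps)
  then have N: "N > 0" "2 / N < \<delta>"
    by (simp_all add: divide_less_eq)
  have "\<exists>V. open V \<and> P V \<and> h ` ({i/N..Suc i/N} \<times> {j/N..Suc j/N}) \<subseteq> V" if ij: "i < N" "j < N" for i j
  proof -
    let ?Q = "{i/N..Suc i/N} \<times> {j/N..Suc j/N}"
    have "Suc i / N \<le> 1" "Suc j / N \<le> 1"
      using ij by (simp_all add: divide_le_eq)
    moreover have "0 \<le> i / N" "0 \<le> j / N" by simp_all
    ultimately have sub: "?Q \<subseteq> ?S"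
      by (intro Sigma_mono iffD2[OF atLeastatMost_subset_iff] disjI2 conjI)
    have "diameter ?Q \<le> 2 / N"
    proof (rule diameter_le)
      show "?Q \<noteq> {} \<or> 0 \<le> 2 / real N" by simp
      fix x y assume xy: "x \<in> ?Q" "y \<in> ?Q"
      have len: "Suc k / N - k / N = 1 / N" for k
        by (simp add: diff_divide_distrib[symmetric])
      have "norm (x - y) \<le> norm (fst (x - y)) + norm (snd (x - y))"
        by (metis norm_Pair_le surjective_pairing)
      also have "\<dots> \<le> 1 / N + 1 / N"
        using xy len[of i] len[of j] by (intro add_mono) (auto simp: abs_le_iff)
      finally show "norm (x - y) \<le> 2 / real N" by simp
    qed
    then have "diameter ?Q < \<delta>"
      using N(2) by linarith
    with sub obtain B where "B \<in> C" "?Q \<subseteq> B"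
      using \<delta>(2) by metis
    then show "\<exists>V. open V \<and> P V \<and> h ` ?Q \<subseteq> V"
    proof -
      obtain V where V: "open V" "P V" "\<forall>y\<in>B \<inter> ?S. h y \<in> V"
        using \<open>B \<in> C\<close> unfolding C_def mem_Collect_eq by meson
      have "h ` ?Q \<subseteq> V"
      proof (rule image_subsetI)
        fix y assume "y \<in> ?Q"
        then show "h y \<in> V"
          using V(3) sub \<open>?Q \<subseteq> B\<close> by (meson IntI subsetD)
      qed
      then show ?thesis using V by meson
    qed
  qed
  with N(1) show ?thesis
    by blast
qed

text \<open>Everything is compared in \<open>Y\<close> after \<open>f\<close>, and only along paths
  in \<open>U\<close>. The boundary of a grid square pushed into \<open>U\<close> lies in one
  \<open>V j i\<close>, so after \<open>f\<close> its two halves can be exchanged; passing over all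
  squares of a row turns \<open>Q j\<close> into \<open>Q (Suc j)\<close>. The side edges are
  harmless because the homotopy fixes the end points.\<close>

lemma transfer_homotopic_paths:
  fixes X U :: "'a::topological_space set" and Y :: "'b::topological_space set"
  assumes XU: "tame_pair X U" and f: "continuous_on U f" "f ` U \<subseteq> Y"
    and van: "\<And>z. z \<in> X \<Longrightarrow> \<exists>V. open V \<and> z \<in> V \<and> loops_vanish Y f (V \<inter> U)"
    and p: "path p" "path_image p \<subseteq> U" and q: "path q" "path_image q \<subseteq> U"
    and pq: "homotopic_paths X p q"
  shows "homotopic_paths Y (f \<circ> p) (f \<circ> q)"
proof -
  let ?S = "{0..1::real} \<times> {0..1::real}"
  obtain h where h: "continuous_on ?S h" "h \<in> ?S \<rightarrow> X" and
    hp: "\<And>t. t \<in> {0..1} \<Longrightarrow> h (0, t) = p t" and hq: "\<And>t. t \<in> {0..1} \<Longrightarrow> h (1, t) = q t" and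
    h0: "\<And>s. s \<in> {0..1} \<Longrightarrow> h (s, 0) = p 0" and h1: "\<And>s. s \<in> {0..1} \<Longrightarrow> h (s, 1) = p 1"
    using pq unfolding homotopic_paths pathstart_def pathfinish_def o_def by metis
  have "\<exists>V. open V \<and> z \<in> V \<and> loops_vanish Y f (V \<inter> U)" if "z \<in> h ` ?S" for z
    using van h(2) that by blast
  from Lebesgue_grid[OF h(1), of "\<lambda>V. loops_vanish Y f (V \<inter> U)", OF this]
  obtain N :: nat where N: "N > 0" and
    "\<forall>i<N. \<forall>j<N. \<exists>V. open V \<and> loops_vanish Y f (V \<inter> U) \<and> h ` ({i/N..Suc i/N} \<times> {j/N..Suc j/N}) \<subseteq> V"
    by blast
  then obtain V where V: "\<And>i j. i < N \<Longrightarrow> j < N \<Longrightarrow> open (V i j)"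
    "\<And>i j. i < N \<Longrightarrow> j < N \<Longrightarrow> loops_vanish Y f (V i j \<inter> U)"
    "\<And>i j. i < N \<Longrightarrow> j < N \<Longrightarrow> h ` ({i/N..Suc i/N} \<times> {j/N..Suc j/N}) \<subseteq> V i j"
    by metis
  have frac: "i / N \<in> {0..1}" if "i \<le> N" for i :: nat
    using that N by simp
  \<comment> \<open>For k at most N these are the grid intervals that contain k/N: those of index k
    and k - 1, except that k = 0 and k = N have only one.\<close>
  define near where "near k = {k'. k' < N \<and> k' \<le> k \<and> k \<le> Suc k'}" for k
  have near_fin: "finite (near k)" for k
    unfolding near_def by simp
  have near_frac: "k / N \<in> {k'/N..Suc k'/N}" if "k' \<in> near k" for k k'
    using that N unfolding near_def by (auto simp: divide_right_mono)
  have near_lt: "k' < N" if "k' \<in> near k" for k k'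
    using that unfolding near_def by simp
  have near_self: "k \<in> near k" "k \<in> near (Suc k)" if "k < N" for k
    using that unfolding near_def by auto
  have hV: "h (s, t) \<in> V i j" if "i < N" "j < N" "s \<in> {i/N..Suc i/N}" "t \<in> {j/N..Suc j/N}" for s t i j
    using V(3)[OF that(1,2)] that(3,4) by auto
  \<comment> \<open>Up to four cells meet at a vertex; the pushed vertex has to lie in the sets
    \<open>V\<close> of all of them.\<close>
  define B where "B j i = (\<Inter>k\<in>near j \<times> near i. case k of (j', i') \<Rightarrow> V j' i')" for j i
  have B: "open (B j i)" for j i
    unfolding B_def using near_fin near_lt V(1) by (intro open_INT) auto
  have hB: "h (j / N, i / N) \<in> B j i" if "j \<le> N" "i \<le> N" for j i
    unfolding B_def using hV near_lt near_frac by auto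
  \<comment> \<open>The grid is pushed into \<open>U\<close>: \<open>w j i\<close> is a point of \<open>U\<close> near \<open>h (j/N, i/N)\<close>, the paths \<open>e j i\<close> and \<open>c j i\<close>
    replace the edges, and \<open>Q j\<close> is the row of height \<open>j/N\<close>.\<close>
  define vertex where "vertex j i W w \<longleftrightarrow> open W \<and> h (j/N, i/N) \<in> W \<and> W \<subseteq> B j i \<and>
    path_connected (W \<inter> U) \<and> w \<in> W \<inter> U \<and> (h (j/N, i/N) \<in> U \<longrightarrow> w = h (j/N, i/N))" for j i W w
  have "\<exists>W w. vertex j i W w" if ji: "j \<le> N" "i \<le> N" for j i
  proof -
    have "h (j/N, i/N) \<in> X"
      using h(2) frac ji by blast
    from tame_pairD[OF XU this B hB[OF ji]]
    obtain W where "open W" "h (j/N, i/N) \<in> W" "W \<subseteq> B j i" "path_connected (W \<inter> U)" "W \<inter> U \<noteq> {}"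
      by metis
    then show ?thesis unfolding vertex_def by blast
  qed
  then obtain W w where "\<And>i j. j \<le> N \<Longrightarrow> i \<le> N \<Longrightarrow> vertex j i (W j i) (w j i)"
    by metis
  then have W: "\<And>i j. j \<le> N \<Longrightarrow> i \<le> N \<Longrightarrow> open (W j i)"
    "\<And>i j. j \<le> N \<Longrightarrow> i \<le> N \<Longrightarrow> h (j/N, i/N) \<in> W j i"
    "\<And>i j. j \<le> N \<Longrightarrow> i \<le> N \<Longrightarrow> W j i \<subseteq> B j i"
    "\<And>i j. j \<le> N \<Longrightarrow> i \<le> N \<Longrightarrow> path_connected (W j i \<inter> U)"
    and w: "\<And>i j. j \<le> N \<Longrightarrow> i \<le> N \<Longrightarrow> w j i \<in> W j i \<inter> U"
    "\<And>i j. j \<le> N \<Longrightarrow> i \<le> N \<Longrightarrow> h (j/N, i/N) \<in> U \<Longrightarrow> w j i = h (j/N, i/N)"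
    unfolding vertex_def by blast+
  have edge: "path_component (O' \<inter> U) (w j i) (w j' i')"
    if "open O'" "connected T" "T \<subseteq> ?S" "h ` T \<subseteq> O'" "B j i \<subseteq> O'" "B j' i' \<subseteq> O'" "j \<le> N" "i \<le> N"
        "j' \<le> N" "i' \<le> N"
      "(j/N, i/N) \<in> T" "(j'/N, i'/N) \<in> T" for O' T j i j' i'
  proof (rule tame_pair_path_component[OF XU that(1,2), of h "(j/N, i/N)" "W j i" _ "(j'/N, i'/N)"
      "W j' i'"])
    show "continuous_on T h"
      using h(1) that(3) by (rule continuous_on_subset)
    show "h ` T \<subseteq> X \<inter> O'"
      using h(2) that(3,4) by blast
    show "W j i \<subseteq> O'" "W j' i' \<subseteq> O'"
      using W(3)[OF that(7,8)] W(3)[OF that(9,10)] that(5,6) by (meson order_trans)+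
  qed (use W(1,2,4)[OF that(7,8)] W(1,2,4)[OF that(9,10)] w(1)[OF that(7,8)] w(1)[OF that(9,10)]
      that(11,12) in simp_all)
  have Icc: "{i/N..Suc i/N} \<subseteq> {0..1}" if "i < N" for i
    using frac[of i] frac[of "Suc i"] that unfolding atLeastatMost_subset_iff by simp
  \<comment> \<open>A pushed edge must lie in the sets of all cells next to it, since an inner edge
    serves in two squares.\<close>
  define hedge where "hedge j i e \<longleftrightarrow> path e \<and> path_image e \<subseteq> (\<Inter>k\<in>near j. V k i) \<inter> U \<and>
    pathstart e = w j i \<and> pathfinish e = w j (Suc i)" for j i e
  have "\<exists>e. hedge j i e" if ji: "j \<le> N" "i < N" for j i
  proof -
    have "path_component ((\<Inter>k\<in>near j. V k i) \<inter> U) (w j i) (w j (Suc i))"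
    proof (rule edge[of _ "{j/N} \<times> {i/N..Suc i/N}"])
      show "open (\<Inter>k\<in>near j. V k i)"
        using near_fin near_lt V(1) ji by (intro open_INT) auto
      show "B j i \<subseteq> (\<Inter>k\<in>near j. V k i)" "B j (Suc i) \<subseteq> (\<Inter>k\<in>near j. V k i)"
        unfolding B_def using near_self[OF ji(2)] by auto
      show "{j/N} \<times> {i/N..Suc i/N} \<subseteq> ?S"
        using frac[OF ji(1)] Icc[OF ji(2)] by blast
      show "h ` ({j/N} \<times> {i/N..Suc i/N}) \<subseteq> (\<Inter>k\<in>near j. V k i)"
        using hV near_lt near_frac ji(2) by blast
    qed (use ji in \<open>auto simp: connected_Times divide_right_mono\<close>)
    then show ?thesis
      unfolding path_component_def hedge_def by auto
  qed
  then obtain e where "\<And>j i. j \<le> N \<Longrightarrow> i < N \<Longrightarrow> hedge j i (e j i)"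
    by metis
  then have e: "\<And>j i. j \<le> N \<Longrightarrow> i < N \<Longrightarrow> path (e j i)"
    "\<And>j i. j \<le> N \<Longrightarrow> i < N \<Longrightarrow> path_image (e j i) \<subseteq> (\<Inter>k\<in>near j. V k i) \<inter> U"
    "\<And>j i. j \<le> N \<Longrightarrow> i < N \<Longrightarrow> pathstart (e j i) = w j i"
    "\<And>j i. j \<le> N \<Longrightarrow> i < N \<Longrightarrow> pathfinish (e j i) = w j (Suc i)"
    unfolding hedge_def by blast+
  define vedge where "vedge j i e \<longleftrightarrow> path e \<and> path_image e \<subseteq> (\<Inter>k\<in>near i. V j k) \<inter> U \<and>
    pathstart e = w j i \<and> pathfinish e = w (Suc j) i" for j i e
  have "\<exists>e. vedge j i e" if ji: "j < N" "i \<le> N" for j i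
  proof -
    have "path_component ((\<Inter>k\<in>near i. V j k) \<inter> U) (w j i) (w (Suc j) i)"
    proof (rule edge[of _ "{j/N..Suc j/N} \<times> {i/N}"])
      show "open (\<Inter>k\<in>near i. V j k)"
        using near_fin near_lt V(1) ji by (intro open_INT) auto
      show "B j i \<subseteq> (\<Inter>k\<in>near i. V j k)" "B (Suc j) i \<subseteq> (\<Inter>k\<in>near i. V j k)"
        unfolding B_def using near_self[OF ji(1)] by auto
      show "{j/N..Suc j/N} \<times> {i/N} \<subseteq> ?S"
        using frac[OF ji(2)] Icc[OF ji(1)] by blast
      show "h ` ({j/N..Suc j/N} \<times> {i/N}) \<subseteq> (\<Inter>k\<in>near i. V j k)"
        using hV near_lt near_frac ji(1) by blast
    qed (use ji in \<open>auto simp: connected_Times divide_right_mono\<close>)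
    then show ?thesis
      unfolding path_component_def vedge_def by auto
  qed
  then obtain c where "\<And>j i. j < N \<Longrightarrow> i \<le> N \<Longrightarrow> vedge j i (c j i)"
    by metis
  then have c: "\<And>j i. j < N \<Longrightarrow> i \<le> N \<Longrightarrow> path (c j i)"
    "\<And>j i. j < N \<Longrightarrow> i \<le> N \<Longrightarrow> path_image (c j i) \<subseteq> (\<Inter>k\<in>near i. V j k) \<inter> U"
    "\<And>j i. j < N \<Longrightarrow> i \<le> N \<Longrightarrow> pathstart (c j i) = w j i"
    "\<And>j i. j < N \<Longrightarrow> i \<le> N \<Longrightarrow> pathfinish (c j i) = w (Suc j) i"
    unfolding vedge_def by blast+

  \<comment> \<open>\<open>H\<close> is homotopy after \<open>f\<close>. It has two sources:
    homotopies inside \<open>U\<close> (\<open>H_U\<close>), and exchanging paths with the same ends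
    inside one \<open>V j i\<close> (\<open>H_V\<close>).\<close>
  define H where "H a b \<longleftrightarrow> homotopic_paths Y (f \<circ> a) (f \<circ> b)" for a b :: "real \<Rightarrow> 'a"
  have H_trans [trans]: "H a b \<Longrightarrow> H b d \<Longrightarrow> H a d" for a b d
    unfolding H_def by (rule homotopic_paths_trans)
  have H_sym: "H a b \<Longrightarrow> H b a" for a b
    unfolding H_def by (rule homotopic_paths_sym)
  have H_join: "H a a' \<Longrightarrow> H b b' \<Longrightarrow> pathfinish a = pathstart b \<Longrightarrow> H (a +++ b) (a' +++ b')" for a a' b b'
    unfolding H_def path_compose_join
    by (rule homotopic_paths_join) (simp_all add: pathfinish_compose pathstart_compose)
  have H_U: "H a b" if "homotopic_paths U a b" for a b
    unfolding H_def by (rule homotopic_paths_continuous_image[OF that]) (use f in auto)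
  have H_V: "H a b" if "j < N" "i < N" "path a" "path_image a \<subseteq> V j i \<inter> U" "path b"
      "path_image b \<subseteq> V j i \<inter> U"
    "pathstart b = pathstart a" "pathfinish b = pathfinish a" for a b i j
    unfolding H_def
    by (rule loops_vanish_homotopic_paths[OF V(2)[OF that(1,2)]]) (use f that in \<open>auto intro: continuous_on_subset\<close>)
  have eU: "path_image (e j i) \<subseteq> U" "H (e j i) (e j i)" if "j \<le> N" "i < N" for j i
  proof -
    show "path_image (e j i) \<subseteq> U" using e(2)[OF that] by blast
    then show "H (e j i) (e j i)" using e(1)[OF that] by (intro H_U) simp
  qed
  have cU: "path_image (c j i) \<subseteq> U" "H (c j i) (c j i)" if "j < N" "i \<le> N" for j i
  proof -
    show "path_image (c j i) \<subseteq> U" using c(2)[OF that] by blast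
    then show "H (c j i) (c j i)" using c(1)[OF that] by (intro H_U) simp
  qed
  have square: "H (e j i +++ c j (Suc i)) (c j i +++ e (Suc j) i)" if "j < N" "i < N" for j i
  proof -
    have "path_image (e j i) \<subseteq> V j i \<inter> U" "path_image (e (Suc j) i) \<subseteq> V j i \<inter> U"
      "path_image (c j i) \<subseteq> V j i \<inter> U" "path_image (c j (Suc i)) \<subseteq> V j i \<inter> U"
      using that near_self[of i] near_self[of j] e(2)[of j i] e(2)[of "Suc j" i] c(2)[of j i]
        c(2)[of j "Suc i"] by auto
    then show ?thesis
      using that e c by (intro H_V[of j i]) (simp_all add: path_image_join)
  qed

  define Q where "Q j = rec_nat (\<lambda>_. w j 0) (\<lambda>i q. q +++ e j i)" for j
  have Q_0: "Q j 0 = (\<lambda>_. w j 0)" and Q_Suc: "Q j (Suc i) = Q j i +++ e j i" for j i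
    by (simp_all add: Q_def)
  have Q: "path (Q j i) \<and> path_image (Q j i) \<subseteq> U \<and> pathstart (Q j i) = w j 0 \<and>
      pathfinish (Q j i) = w j i"
    if "j \<le> N" "i \<le> N" for j i
    using that(2)
  proof (induction i)
    case 0
    then show ?case
      using w(1)[of j 0] that(1) by (simp add: Q_0 path_def path_image_def pathstart_def pathfinish_def)
  next
    case (Suc i)
    then show ?case
      using e[of j i] eU[of j i] that(1) by (simp add: Q_Suc path_image_join)
  qed
  have HQ: "H (Q j i) (Q j i)" if "j \<le> N" "i \<le> N" for j i
    using Q[OF that] by (intro H_U) simp

  \<comment> \<open>On the first and last rows the homotopy already runs in \<open>U\<close>: the
    vertices there were not moved, and each edge can be exchanged for the original segment within
    one cell set.\<close>
  have boundary: "H (Q j N) r" if j: "j \<le> N" and r: "path r" "path_image r \<subseteq> U"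
    and hr: "\<And>t. t \<in> {0..1} \<Longrightarrow> h (j/N, t) = r t" for j r
  proof -
    have rU: "r t \<in> U" if "t \<in> {0..1}" for t
      using r(2) that unfolding path_image_def by blast
    have wr: "w j i = r (i/N)" if "i \<le> N" for i
      using w(2)[OF j that] hr[OF frac[OF that]] rU[OF frac[OF that]] by simp
    have sub: "path (r \<circ> linepath a b)" "path_image (r \<circ> linepath a b) \<subseteq> U"
        if "a \<in> {0..1}" "b \<in> {0..1}" for a b
      using path_segment[OF r(1) that] r(2) by auto
    have "H (Q j i) (r \<circ> linepath 0 (i/N))" if "i \<le> N" for i
      using that
    proof (induction i)
      case 0
      have *: "r \<circ> linepath 0 (real 0/N) = Q j 0"
        using wr[of 0] by (auto simp: Q_0 linepath_def)
      show ?case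
        unfolding * by (rule HQ[OF j le0])
    next
      case (Suc i)
      then have i: "i < N" "i \<le> N" by auto
      \<comment> \<open>A row of cells bordering height j/N; for j = N it can only be the row of
        index N - 1.\<close>
      obtain k where k: "k \<in> near j"
        using j N near_self[of "j"] near_self[of "j - 1"] by (cases "j < N") auto
      have seg: "path_image (r \<circ> linepath (i/N) (Suc i/N)) \<subseteq> V k i"
      proof -
        have "path_image (r \<circ> linepath (i/N) (Suc i/N)) = r ` {i/N..Suc i/N}"
          by (simp add: path_image_compose closed_segment_eq_real_ivl divide_right_mono)
        moreover have "\<forall>t\<in>{i/N..Suc i/N}. r t \<in> V k i"
        proof
          fix t assume t: "t \<in> {i/N..Suc i/N}"
          have "t \<in> {0..1}"
            using t frac[OF i(2)] frac[OF Suc.prems] unfolding atLeastAtMost_iff by linarith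
          then show "r t \<in> V k i"
            using hV[OF near_lt[OF k] i(1) near_frac[OF k] t] hr by simp
        qed
        ultimately show ?thesis by (simp only: image_subset_iff)
      qed
      have "H (e j i) (r \<circ> linepath (i/N) (Suc i/N))"
      proof (rule H_V[OF near_lt[OF k] i(1)])
        show "path_image (e j i) \<subseteq> V k i \<inter> U"
          using e(2)[OF j i(1)] k by auto
        show "path_image (r \<circ> linepath (i/N) (Suc i/N)) \<subseteq> V k i \<inter> U"
          using seg sub(2)[OF frac[OF i(2)] frac[OF Suc.prems]] by (rule Int_greatest)
        show "path (r \<circ> linepath (i/N) (Suc i/N))"
          using sub(1)[OF frac[OF i(2)] frac[OF Suc.prems]] .
      qed (use e j i wr[OF i(2)] wr[OF Suc.prems] in \<open>auto simp: pathstart_compose pathfinish_compose\<close>)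
      then have "H (Q j (Suc i)) ((r \<circ> linepath 0 (i/N)) +++ (r \<circ> linepath (i/N) (Suc i/N)))"
        unfolding Q_Suc using Q[OF j i(2)] e(3)[OF j i(1)] by (intro H_join[OF Suc.IH[OF i(2)]]) simp_all
      also have "H \<dots> (r \<circ> linepath 0 (Suc i/N))"
        using r frac[OF i(2)] frac[OF Suc.prems] by (intro H_U homotopic_paths_join_segments) auto
      finally show ?case .
    qed
    moreover have "homotopic_paths U (r \<circ> linepath 0 (N/N)) r"
      using r N by (intro homotopic_paths_sym[OF homotopic_paths_eq]) (auto simp: linepath_def)
    ultimately show ?thesis
      using H_trans[OF _ H_U] N order_refl by metis
  qed

  have row: "H (Q j i +++ c j i) (Q (Suc j) i)" if "j < N" "i \<le> N" for j i
    using that(2)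
  proof (induction i)
    case 0
    \<comment> \<open>All vertices on the left side equal \<open>p 0\<close>, so
      \<open>c j 0\<close> is a loop in a single cell set and disappears under
      \<open>f\<close>.\<close>
    have w0: "w k 0 = p 0" if "k \<le> N" for k
    proof -
      have "p 0 \<in> U" using p(2) unfolding path_image_def by auto
      then show ?thesis
        using w(2)[OF that, of 0] h0[OF frac[OF that]] by simp
    qed
    have j: "j \<le> N" "Suc j \<le> N" using that(1) by auto
    have "path_image (c j 0) \<subseteq> V j 0 \<inter> U"
      using c(2)[OF that(1), of 0] near_self[OF N] by blast
    moreover from this have "w j 0 \<in> V j 0 \<inter> U"
      using c(3)[OF that(1), of 0] pathstart_in_path_image by auto
    moreover have "path_image (\<lambda>_. w j 0) = {w j 0}" "path (\<lambda>_. w j 0)"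
      by (auto simp: path_image_def path_def)
    ultimately show ?case
      unfolding Q_0 using c[OF that(1), of 0] w0[OF j(1)] w0[OF j(2)] N that(1)
      by (intro H_V[of j 0]) (simp_all add: path_image_join pathstart_def[of "\<lambda>_. _"]
        pathfinish_def[of "\<lambda>_. _"])
  next
    case (Suc i)
    then have ji: "j \<le> N" "i < N" "i \<le> N" "Suc j \<le> N" using that(1) by auto
    have "H (Q j (Suc i) +++ c j (Suc i)) (Q j i +++ (e j i +++ c j (Suc i)))"
      unfolding Q_Suc using Q[OF ji(1,3)] e[OF ji(1,2)] eU[OF ji(1,2)] c[OF that(1) Suc.prems]
          cU[OF that(1) Suc.prems]
      by (intro H_U homotopic_paths_sym[OF homotopic_paths_assoc]) simp_all
    also have "H \<dots> (Q j i +++ (c j i +++ e (Suc j) i))"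
      using Q[OF ji(1,3)] e(3)[OF ji(1,2)]
        by (intro H_join[OF HQ[OF ji(1,3)] square[OF that(1) ji(2)]]) simp_all
    also have "H \<dots> ((Q j i +++ c j i) +++ e (Suc j) i)"
      using Q[OF ji(1,3)] e[OF ji(4,2)] eU[OF ji(4,2)] c[OF that(1) ji(3)] cU[OF that(1) ji(3)]
      by (intro H_U homotopic_paths_assoc) simp_all
    also have "H \<dots> (Q (Suc j) (Suc i))"
      unfolding Q_Suc using Suc.IH[OF ji(3)] eU(2)[OF ji(4,2)] c(4)[OF that(1) ji(3)]
          e(3)[OF ji(4,2)] by (intro H_join) simp_all
    finally show ?case .
  qed
  have step: "H (Q j N) (Q (Suc j) N)" if j: "j < N" for j
  proof -
    have j': "j \<le> N" "Suc j \<le> N" using j by auto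
    have w1: "w k N = p 1" if "k \<le> N" for k
    proof -
      have "p 1 \<in> U" using p(2) unfolding path_image_def by auto
      then show ?thesis
        using w(2)[OF that, of N] h1[OF frac[OF that]] N by simp
    qed
    obtain M where M: "N = Suc M" using N gr0_implies_Suc by blast
    have im: "path_image (c j N) \<subseteq> V j M \<inter> U"
      using c(2)[OF j order_refl] near_self[of M] M by auto
    then have "w j N \<in> V j M \<inter> U"
      using c(3)[OF j order_refl] pathstart_in_path_image[of "c j N"] by auto
    moreover have "path_image (\<lambda>_. w j N) = {w j N}" "path (\<lambda>_. w j N)"
      by (auto simp: path_image_def path_def)
    ultimately have "H (\<lambda>_. w j N) (c j N)"
      using c[OF j order_refl] im w1[OF j'(1)] w1[OF j'(2)] M j
      by (intro H_V[of j M]) (simp_all add: pathstart_def[of "\<lambda>_. _"] pathfinish_def[of "\<lambda>_. _"])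
    from H_join[OF HQ[OF j'(1) order_refl] this]
    have "H (Q j N +++ (\<lambda>_. w j N)) (Q j N +++ c j N)"
      using Q[OF j'(1) order_refl] by (simp add: pathstart_def[of "\<lambda>_. _"])
    moreover have "H (Q j N) (Q j N +++ (\<lambda>_. w j N))"
      using Q[OF j'(1) order_refl] by (intro H_sym[OF H_U] homotopic_paths_join_const) simp_all
    ultimately have "H (Q j N) (Q j N +++ c j N)"
      using H_trans by metis
    then show ?thesis
      using row[OF j order_refl] by (rule H_trans)
  qed
  have "H (Q 0 N) (Q j N)" if "j \<le> N" for j
    using that
  proof (induction j)
    case 0
    show ?case by (rule HQ) simp_all
  next
    case (Suc j)
    then have "H (Q 0 N) (Q j N)" "H (Q j N) (Q (Suc j) N)"
      using step[of j] by simp_all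
    then show ?case by (rule H_trans)
  qed
  from this[of N] have "H (Q 0 N) (Q N N)" by simp
  moreover have "H (Q 0 N) p"
    using p hp by (intro boundary) simp_all
  moreover have "H (Q N N) q"
    using q hq N by (intro boundary) simp_all
  ultimately have "H p q"
    using H_sym H_trans by metis
  then show ?thesis
    by (simp only: H_def)
qed

text \<open>One-dimensional version of the grid, showing that the fundamental group of
  \<open>U\<close> maps onto that of \<open>X\<close>. The division points are joined to points of
  \<open>U\<close> by short paths \<open>d i\<close>, and each segment of \<open>p\<close> is
  replaced by \<open>d i\<close>, a path in \<open>U\<close>, and the reverse of
  \<open>d (Suc i)\<close>.\<close>

lemma homotopic_into_subset:
  fixes X U :: "'a::topological_space set"
  assumes XU: "tame_pair X U" and p: "path p" "path_image p \<subseteq> X" "pathstart p \<in> U" "pathfinish p \<in> U"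
  shows "\<exists>q. path q \<and> path_image q \<subseteq> U \<and> homotopic_paths X p q"
proof -
  have UX: "U \<subseteq> X" using XU unfolding tame_pair_def by simp
  have pX: "p t \<in> X" if "t \<in> {0..1}" for t
    using p(2) that unfolding path_image_def by blast
  define small where "small V \<longleftrightarrow> path_connected (V \<inter> U) \<and> loops_vanish X id (V \<inter> X)" for V
  \<comment> \<open>Composing with \<open>snd\<close> makes the path a map on the square, so that
    the grid lemma applies; only the cells with first index 0 are used.\<close>
  have "continuous_on ({0..1} \<times> {0..1}) (p \<circ> snd)"
    using p(1) unfolding path_def by (intro continuous_on_compose continuous_intros) auto
  moreover have "\<exists>V. open V \<and> z \<in> V \<and> small V" if "z \<in> (p \<circ> snd) ` ({0..1::real} \<times> {0..1})" for z
  proof -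
    have "z \<in> X" using that pX by auto
    from tame_pairD[OF XU this open_UNIV UNIV_I] show ?thesis
      unfolding small_def by metis
  qed
  ultimately obtain N :: nat where N: "N > 0" and
    "\<forall>i<N. \<forall>j<N. \<exists>V. open V \<and> small V \<and> (p \<circ> snd) ` ({i/N..Suc i/N} \<times> {j/N..Suc j/N}) \<subseteq> V"
    using Lebesgue_grid[of "p \<circ> snd" small] by blast
  then have "\<exists>V. open V \<and> small V \<and> (p \<circ> snd) ` ({0/N..Suc 0/N} \<times> {i/N..Suc i/N}) \<subseteq> V" if "i < N" for i
    using that by (metis of_nat_0)
  then obtain V where V: "\<And>i. i < N \<Longrightarrow> open (V i)" "\<And>i. i < N \<Longrightarrow> small (V i)" and
    *: "\<And>i. i < N \<Longrightarrow> (p \<circ> snd) ` ({0/N..Suc 0/N} \<times> {i/N..Suc i/N}) \<subseteq> V i"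
    by metis
  have frac: "i / N \<in> {0..1}" if "i \<le> N" for i :: nat
    using that N by simp
  have hV: "p t \<in> V i" if "i < N" "t \<in> {i/N..Suc i/N}" for t i
  proof -
    have "(0, t) \<in> {0/N..Suc 0/N} \<times> {i/N..Suc i/N}" using that by simp
    then show ?thesis using *[OF that(1)] by (metis comp_apply image_subset_iff snd_conv)
  qed
  define near where "near k = {k'. k' < N \<and> k' \<le> k \<and> k \<le> Suc k'}" for k
  define B where "B i = (\<Inter>k\<in>near i. V k)" for i
  have B: "open (B i)" for i
    unfolding B_def near_def using V(1) by (intro open_INT) auto
  have pB: "p (i/N) \<in> B i" for i
    unfolding B_def near_def using hV N by (auto simp: divide_right_mono)
  have BV: "B i \<subseteq> V i" "B (Suc i) \<subseteq> V i" if "i < N" for i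
    using that unfolding B_def near_def by auto
  \<comment> \<open>If the division point is in \<open>U\<close> already, as at both ends of
    \<open>p\<close>, then \<open>d\<close> returns to it, so that the end points of
    \<open>p\<close> stay fixed.\<close>
  define vertex where "vertex i d \<longleftrightarrow> path d \<and> path_image d \<subseteq> B i \<inter> X \<and> pathstart d = p (i/N) \<and>
    pathfinish d \<in> U \<and> (p (i/N) \<in> U \<longrightarrow> pathfinish d = p (i/N))" for i d
  have "\<exists>d. vertex i d" if "i \<le> N" for i
  proof (cases "p (i/N) \<in> U")
    case True
    then have "vertex i (\<lambda>_. p (i/N))"
      unfolding vertex_def using pB UX
          by (auto simp: path_def path_image_def pathstart_def pathfinish_def)
    then show ?thesis by blast
  next
    case False
    from tame_pairD[OF XU pX[OF frac[OF that]] B pB]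
    obtain W where W: "p (i/N) \<in> W" "W \<subseteq> B i" "path_connected (W \<inter> X)" "W \<inter> U \<noteq> {}"
      by metis
    then obtain w where "w \<in> W" "w \<in> U" by blast
    then have "path_component (W \<inter> X) (p (i/N)) w"
      using W(1,3) UX pX[OF frac[OF that]] unfolding path_connected_component by (metis IntI subsetD)
    then obtain d where "path d" "path_image d \<subseteq> W \<inter> X" "pathstart d = p (i/N)" "pathfinish d = w"
      unfolding path_component_def by metis
    then have "vertex i d"
      unfolding vertex_def using False \<open>w \<in> U\<close> W(2) by auto
    then show ?thesis by blast
  qed
  then obtain d where "\<And>i. i \<le> N \<Longrightarrow> vertex i (d i)"
    by metis
  then have d: "\<And>i. i \<le> N \<Longrightarrow> path (d i)" "\<And>i. i \<le> N \<Longrightarrow> path_image (d i) \<subseteq> B i \<inter> X"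
    "\<And>i. i \<le> N \<Longrightarrow> pathstart (d i) = p (i/N)" "\<And>i. i \<le> N \<Longrightarrow> pathfinish (d i) \<in> U"
    "\<And>i. i \<le> N \<Longrightarrow> p (i/N) \<in> U \<Longrightarrow> pathfinish (d i) = p (i/N)"
    unfolding vertex_def by blast+
  define w where "w i = pathfinish (d i)" for i
  have wB: "w i \<in> B i" if "i \<le> N" for i
    using d(2)[OF that] pathfinish_in_path_image[of "d i"] unfolding w_def by blast
  define edge where "edge i e \<longleftrightarrow> path e \<and> path_image e \<subseteq> V i \<inter> U \<and> pathstart e = w i \<and>
      pathfinish e = w (Suc i)" for i e
  have "\<exists>e. edge i e" if "i < N" for i
  proof -
    have "i \<le> N" "Suc i \<le> N" using that by auto
    then have "w i \<in> V i \<inter> U" "w (Suc i) \<in> V i \<inter> U"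
      using wB BV[OF that] d(4) unfolding w_def by blast+
    then have "path_component (V i \<inter> U) (w i) (w (Suc i))"
      using V(2)[OF that] unfolding small_def path_connected_component by metis
    then show ?thesis
      unfolding path_component_def edge_def by metis
  qed
  then obtain e where "\<And>i. i < N \<Longrightarrow> edge i (e i)"
    by metis
  then have e: "\<And>i. i < N \<Longrightarrow> path (e i)" "\<And>i. i < N \<Longrightarrow> path_image (e i) \<subseteq> V i \<inter> U"
    "\<And>i. i < N \<Longrightarrow> pathstart (e i) = w i" "\<And>i. i < N \<Longrightarrow> pathfinish (e i) = w (Suc i)"
    unfolding edge_def by blast+
  have H_V: "homotopic_paths X a b"
      if "i < N" "path a" "path_image a \<subseteq> V i \<inter> X" "path b" "path_image b \<subseteq> V i \<inter> X"
    "pathstart b = pathstart a" "pathfinish b = pathfinish a" for a b i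
  proof -
    have "homotopic_paths X (id \<circ> a) (id \<circ> b)"
      using V(2)[OF that(1)] that unfolding small_def
      by (intro loops_vanish_homotopic_paths[of X id "V i \<inter> X"]) auto
    then show ?thesis by simp
  qed
  define Q where "Q = rec_nat (\<lambda>_. w 0) (\<lambda>i q. q +++ e i)"
  have Q_0: "Q 0 = (\<lambda>_. w 0)" and Q_Suc: "Q (Suc i) = Q i +++ e i" for i
    by (simp_all add: Q_def)
  have Q: "path (Q i) \<and> path_image (Q i) \<subseteq> U \<and> pathstart (Q i) = w 0 \<and> pathfinish (Q i) = w i"
      if "i \<le> N" for i
    using that
  proof (induction i)
    case 0
    then show ?case
      using d(4)[of 0] unfolding w_def
        by (simp add: Q_0 path_def path_image_def pathstart_def pathfinish_def w_def)
  next
    case (Suc i)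
    then show ?case
      using e[of i] by (simp add: Q_Suc path_image_join)
  qed
  have p01: "p 0 \<in> U" "p 1 \<in> U" using p(3,4) unfolding pathstart_def pathfinish_def by simp_all
  let ?s = "\<lambda>i. p \<circ> linepath 0 (i/N)"
  have s: "path (?s i)" "path_image (?s i) \<subseteq> X" "pathstart (?s i) = p 0"
      "pathfinish (?s i) = p (i/N)" if "i \<le> N" for i :: nat
    using path_segment[OF p(1), of 0 "i/N"] frac[OF that] p(2)
      by (auto simp: pathstart_compose pathfinish_compose)
  have dX: "path_image (d i) \<subseteq> X" if "i \<le> N" for i using d(2)[OF that] by simp
  have "homotopic_paths X (?s i +++ d i) (Q i)" if "i \<le> N" for i
    using that
  proof (induction i)
    case 0
    have "?s 0 = (\<lambda>_. p 0)"
      by (auto simp: linepath_def)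
    moreover have "path_image (d 0) \<subseteq> V 0 \<inter> X"
      using d(2)[of 0] BV(1)[OF N] by auto
    moreover have "p 0 \<in> V 0 \<inter> X"
      using hV[OF N, of 0] pX[of 0] N by simp
    moreover have "w 0 = p 0"
      using d(5)[of 0] p01 unfolding w_def by simp
    moreover have "path_image (\<lambda>_. p 0) = {p 0}" "path (\<lambda>_. p 0)"
      by (auto simp: path_image_def path_def)
    ultimately show ?case
      unfolding Q_0 using d(1,3)[of 0] N unfolding w_def
      by (intro H_V[OF N]) (simp_all add: path_image_join pathstart_def[of "\<lambda>_. _"]
        pathfinish_def[of "\<lambda>_. _"])
  next
    case (Suc i)
    then have i: "i \<le> N" "i < N" by auto
    let ?g = "p \<circ> linepath (i/N) (Suc i/N)"
    have g: "path ?g" "path_image ?g \<subseteq> X" "pathstart ?g = p (i/N)" "pathfinish ?g = p (Suc i/N)"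
      using path_segment[OF p(1), of "i/N" "Suc i/N"] frac[OF i(1)] frac[OF Suc.prems] p(2)
      by (auto simp: pathstart_compose pathfinish_compose)
    have gV: "path_image ?g \<subseteq> V i"
    proof -
      have "path_image ?g = p ` {i/N..Suc i/N}"
        by (simp add: path_image_compose closed_segment_eq_real_ivl divide_right_mono)
      then show ?thesis using hV[OF i(2)] by auto
    qed
    have "homotopic_paths X (?s i +++ ?g) (?s (Suc i))"
      using p(1,2) frac[OF i(1)] frac[OF Suc.prems] by (intro homotopic_paths_join_segments) auto
    moreover have "homotopic_paths X (d (Suc i)) (d (Suc i))"
      using d(1)[OF Suc.prems] dX[OF Suc.prems] by simp
    ultimately have "homotopic_paths X ((?s i +++ ?g) +++ d (Suc i)) (?s (Suc i) +++ d (Suc i))"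
      using g d(3)[OF Suc.prems] by (intro homotopic_paths_join) simp_all
    then have 1: "homotopic_paths X (?s (Suc i) +++ d (Suc i)) ((?s i +++ ?g) +++ d (Suc i))"
      by (rule homotopic_paths_sym)
    have 2: "homotopic_paths X ((?s i +++ ?g) +++ d (Suc i)) (?s i +++ (?g +++ d (Suc i)))"
      using s[OF i(1)] g d(1,3)[OF Suc.prems] dX[OF Suc.prems]
      by (intro homotopic_paths_sym[OF homotopic_paths_assoc]) simp_all
    have "path_image (d i) \<subseteq> V i \<inter> X" "path_image (d (Suc i)) \<subseteq> V i \<inter> X" "path_image (e i) \<subseteq> V i \<inter> X"
      using d(2)[OF i(1)] d(2)[OF Suc.prems] BV[OF i(2)] e(2)[OF i(2)] UX by auto
    then have sq: "homotopic_paths X (?g +++ d (Suc i)) (d i +++ e i)"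
      using g gV d(1,3)[OF i(1)] d(1,3)[OF Suc.prems] e(1,3,4)[OF i(2)] unfolding w_def
      by (intro H_V[OF i(2)]) (simp_all add: path_image_join)
    have 3: "homotopic_paths X (?s i +++ (?g +++ d (Suc i))) (?s i +++ (d i +++ e i))"
      using s[OF i(1)] g by (intro homotopic_paths_join[OF _ sq]) simp_all
    have eX: "path_image (e i) \<subseteq> X" using e(2)[OF i(2)] UX by auto
    have 4: "homotopic_paths X (?s i +++ (d i +++ e i)) ((?s i +++ d i) +++ e i)"
      using s[OF i(1)] d(1,3)[OF i(1)] dX[OF i(1)] e(1,3)[OF i(2)] eX unfolding w_def
      by (intro homotopic_paths_assoc) simp_all
    have "homotopic_paths X ((?s i +++ d i) +++ e i) (Q i +++ e i)"
      using e(1,3)[OF i(2)] eX unfolding w_def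
        by (intro homotopic_paths_join[OF Suc.IH[OF i(1)]]) simp_all
    with 1 2 3 4 show ?case
      unfolding Q_Suc by (meson homotopic_paths_trans)
  qed
  from this[OF order_refl] have "homotopic_paths X (?s N +++ d N) (Q N)" .
  moreover have "homotopic_paths X (?s N +++ d N) p"
  proof -
    have sN: "homotopic_paths X (?s N) p"
      using p N by (intro homotopic_paths_sym[OF homotopic_paths_eq]) (auto simp: linepath_def)
    obtain M where M: "N = Suc M" using N gr0_implies_Suc by blast
    have M': "M < N" using M by simp
    have "path_image (d N) \<subseteq> V M \<inter> X"
      using d(2)[of N] BV(2)[OF M'] M by auto
    moreover have "p 1 \<in> V M \<inter> X"
      using hV[OF M', of 1] pX[of 1] M by (simp add: field_simps)
    moreover have "path_image (\<lambda>_. p 1) = {p 1}" "path (\<lambda>_. p 1)"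
      by (auto simp: path_image_def path_def)
    ultimately have "homotopic_paths X (d N) (\<lambda>_. p 1)"
      using d(1,3,5)[of N] p01 N
      by (intro H_V[OF M']) (simp_all add: pathstart_def[of "\<lambda>_. _"] pathfinish_def[of "\<lambda>_. _"])
    then have "homotopic_paths X (?s N +++ d N) (p +++ (\<lambda>_. p 1))"
      using s(4)[of N] d(3)[of N] by (intro homotopic_paths_join[OF sN]) simp_all
    also have "homotopic_paths X \<dots> p"
      using p by (intro homotopic_paths_join_const) (simp_all add: pathfinish_def)
    finally show ?thesis .
  qed
  ultimately have "homotopic_paths X p (Q N)"
    using homotopic_paths_sym homotopic_paths_trans by metis
  then show ?thesis
    using Q[of N] by blast
qed


section \<open>Isomorphisms of fundamental groups\<close>

lemma loop_class_eq_iff: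
  assumes "p \<in> loops X x" "q \<in> loops X x"
  shows "loop_homotopy X x `` {p} = loop_homotopy X x `` {q} \<longleftrightarrow> homotopic_paths X p q"
  using eq_equiv_class_iff[OF equiv_loop_homotopy assms] assms by (simp add: loop_homotopy_def)

text \<open>\<open>\<Phi>\<close> acts on loops and respects concatenation only up to homotopy, as
  happens when loops are pushed into a subset by choice; the passage to classes is made once and for
  all here.\<close>

lemma fundamental_group_isoI:
  assumes \<Phi>: "\<And>p. p \<in> loops X x \<Longrightarrow> \<Phi> p \<in> loops Y y"
    and hom: "\<And>p q. p \<in> loops X x \<Longrightarrow> q \<in> loops X x \<Longrightarrow>
      homotopic_paths X p q \<longleftrightarrow> homotopic_paths Y (\<Phi> p) (\<Phi> q)"
    and join: "\<And>p q. p \<in> loops X x \<Longrightarrow> q \<in> loops X x \<Longrightarrow>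
      homotopic_paths Y (\<Phi> (p +++ q)) (\<Phi> p +++ \<Phi> q)"
    and surj: "\<And>q. q \<in> loops Y y \<Longrightarrow> \<exists>p\<in>loops X x. homotopic_paths Y (\<Phi> p) q"
  shows "fundamental_group X x \<cong> fundamental_group Y y"
proof -
  let ?c = "\<lambda>p. loop_homotopy X x `` {p}" and ?d = "\<lambda>q. loop_homotopy Y y `` {q}"
  \<comment> \<open>A representative is chosen by \<open>SOME\<close>; by \<open>hom\<close> the
    choice does not affect the class of its image.\<close>
  define F where "F P = ?d (\<Phi> (SOME p. p \<in> loops X x \<and> P = ?c p))" for P
  have F: "F (?c p) = ?d (\<Phi> p)" if p: "p \<in> loops X x" for p
  proof -
    define p' where "p' = (SOME p'. p' \<in> loops X x \<and> ?c p = ?c p')"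
    have "p' \<in> loops X x \<and> ?c p = ?c p'"
      unfolding p'_def by (rule someI[of _ p]) (use p in simp)
    then have "homotopic_paths Y (\<Phi> p) (\<Phi> p')"
      using p hom loop_class_eq_iff by metis
    then have "?d (\<Phi> p) = ?d (\<Phi> p')"
      using p \<open>p' \<in> loops X x \<and> ?c p = ?c p'\<close> \<Phi> by (intro loop_class_eq) auto
    then show ?thesis
      unfolding F_def p'_def by simp
  qed
  have carX: "carrier (fundamental_group X x) = ?c ` loops X x"
    and carY: "carrier (fundamental_group Y y) = ?d ` loops Y y"
    by (auto simp: fundamental_group_def quotient_def)
  have "F \<in> iso (fundamental_group X x) (fundamental_group Y y)"
    unfolding iso_def hom_def mem_Collect_eq
  proof (intro conjI ballI funcsetI)
    fix P assume "P \<in> carrier (fundamental_group X x)"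
    then show "F P \<in> carrier (fundamental_group Y y)"
      unfolding carX carY using F \<Phi> by auto
  next
    fix P Q assume "P \<in> carrier (fundamental_group X x)" "Q \<in> carrier (fundamental_group X x)"
    then obtain p q where pq: "p \<in> loops X x" "q \<in> loops X x" "P = ?c p" "Q = ?c q"
      unfolding carX by auto
    have "?d (\<Phi> (p +++ q)) = ?d (\<Phi> p +++ \<Phi> q)"
      using pq join \<Phi> by (intro loop_class_eq join_loops) (auto simp: join_loops)
    then show "F (P \<otimes>\<^bsub>fundamental_group X x\<^esub> Q) = F P \<otimes>\<^bsub>fundamental_group Y y\<^esub> F Q"
      using pq \<Phi> by (simp add: mult_fundamental_group F join_loops)
  next
    show "bij_betw F (carrier (fundamental_group X x)) (carrier (fundamental_group Y y))"
      unfolding bij_betw_def carX carY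
    proof
      show "inj_on F (?c ` loops X x)"
      proof (intro inj_onI)
        fix P Q assume "P \<in> ?c ` loops X x" "Q \<in> ?c ` loops X x" "F P = F Q"
        then obtain p q where pq: "p \<in> loops X x" "q \<in> loops X x" "P = ?c p" "Q = ?c q"
            "?d (\<Phi> p) = ?d (\<Phi> q)"
          using F by auto
        then show "P = Q"
          using hom \<Phi> by (simp only: loop_class_eq_iff)
      qed
      have "?d q \<in> F ` ?c ` loops X x" if "q \<in> loops Y y" for q
      proof -
        obtain p where p: "p \<in> loops X x" "homotopic_paths Y (\<Phi> p) q"
          using surj \<open>q \<in> loops Y y\<close> by blast
        then have "?d q = F (?c p)"
          using F \<Phi> that loop_class_eq_iff by metis
        then show ?thesis
          using p(1) by blast
      qed
      then show "F ` ?c ` loops X x = ?d ` loops Y y"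
        using F \<Phi> by auto
    qed
  qed
  then show ?thesis
    unfolding is_iso_def by blast
qed

text \<open>Applied to a path and to its reverse, this gives both identities that make the change of
  base point bijective.\<close>

lemma homotopic_paths_conjugate:
  assumes c: "path c" "path_image c \<subseteq> X" "pathfinish c = pathstart p"
    and p: "path p" "path_image p \<subseteq> X" "pathfinish p = pathstart p"
  shows "homotopic_paths X (reversepath c +++ ((c +++ (p +++ reversepath c)) +++ c)) p"
proof -
  let ?r = "reversepath c"
  have cc: "homotopic_paths X c c" and pp: "homotopic_paths X p p" and rr: "homotopic_paths X ?r ?r"
    using c p by simp_all
  have l: "homotopic_paths X (?r +++ c) (\<lambda>_. pathstart p)"
    using c by (intro homotopic_paths_reversepath_join)
  have "homotopic_paths X (?r +++ ((c +++ (p +++ ?r)) +++ c)) (?r +++ (c +++ ((p +++ ?r) +++ c)))"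
    using c p by (intro homotopic_paths_join[OF rr] homotopic_paths_sym[OF homotopic_paths_assoc])
      (simp_all add: path_image_join)
  also have "homotopic_paths X \<dots> ((?r +++ c) +++ ((p +++ ?r) +++ c))"
    using c p by (intro homotopic_paths_assoc) (simp_all add: path_image_join)
  also have "homotopic_paths X \<dots> ((\<lambda>_. pathstart p) +++ (p +++ (?r +++ c)))"
    using c p by (intro homotopic_paths_join[OF l] homotopic_paths_sym[OF homotopic_paths_assoc])
      (simp_all add: path_image_join)
  also have "homotopic_paths X \<dots> (p +++ (?r +++ c))"
    using c p by (intro homotopic_paths_const_join) (simp_all add: path_image_join)
  also have "homotopic_paths X \<dots> (p +++ (\<lambda>_. pathstart p))"
    using c p by (intro homotopic_paths_join[OF pp l]) simp_all
  also have "homotopic_paths X \<dots> p"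
    using p by (intro homotopic_paths_join_const)
  finally show ?thesis .
qed

lemma fundamental_group_basepoint:
  assumes X: "path_connected X" and x: "x \<in> X" and y: "y \<in> X"
  shows "fundamental_group X x \<cong> fundamental_group X y"
proof -
  obtain c where c: "path c" "path_image c \<subseteq> X" "pathstart c = x" "pathfinish c = y"
    using assms unfolding path_connected_def by metis
  let ?r = "reversepath c"
  define \<Phi> where "\<Phi> p = ?r +++ (p +++ c)" for p
  define \<Psi> where "\<Psi> q = c +++ (q +++ ?r)" for q
  have \<Phi>: "\<Phi> p \<in> loops X y" if "p \<in> loops X x" for p
    using that c unfolding loops_def \<Phi>_def by (simp add: path_image_join)
  have \<Psi>: "\<Psi> q \<in> loops X x" if "q \<in> loops X y" for q
    using that c unfolding loops_def \<Psi>_def by (simp add: path_image_join)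
  have rr: "homotopic_paths X ?r ?r" and cc: "homotopic_paths X c c"
    using c by simp_all
  have \<Phi>_cong: "homotopic_paths X (\<Phi> p) (\<Phi> q)"
    if "p \<in> loops X x" "q \<in> loops X x" "homotopic_paths X p q" for p q
    using that c unfolding loops_def \<Phi>_def
    by (intro homotopic_paths_join[OF rr] homotopic_paths_join[OF that(3) cc]) simp_all
  have \<Psi>_cong: "homotopic_paths X (\<Psi> p) (\<Psi> q)"
    if "p \<in> loops X y" "q \<in> loops X y" "homotopic_paths X p q" for p q
    using that c unfolding loops_def \<Psi>_def
    by (intro homotopic_paths_join[OF cc] homotopic_paths_join[OF that(3) rr]) simp_all
  have \<Phi>\<Psi>: "homotopic_paths X (\<Phi> (\<Psi> q)) q" if "q \<in> loops X y" for q
    using that c unfolding loops_def \<Phi>_def \<Psi>_def by (intro homotopic_paths_conjugate) simp_all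
  have \<Psi>\<Phi>: "homotopic_paths X (\<Psi> (\<Phi> p)) p" if "p \<in> loops X x" for p
    using that c homotopic_paths_conjugate[of ?r X p] unfolding loops_def \<Phi>_def \<Psi>_def by simp
  show ?thesis
  proof (rule fundamental_group_isoI[of _ _ \<Phi>])
    fix p q assume p: "p \<in> loops X x" and q: "q \<in> loops X x"
    show "homotopic_paths X p q \<longleftrightarrow> homotopic_paths X (\<Phi> p) (\<Phi> q)"
    proof
      assume "homotopic_paths X (\<Phi> p) (\<Phi> q)"
      from \<Psi>_cong[OF \<Phi>[OF p] \<Phi>[OF q] this] show "homotopic_paths X p q"
        using \<Psi>\<Phi>[OF p] \<Psi>\<Phi>[OF q] homotopic_paths_sym homotopic_paths_trans by metis
    qed (rule \<Phi>_cong[OF p q])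
    have p': "path p" "path_image p \<subseteq> X" "pathstart p = x" "pathfinish p = x"
      and q': "path q" "path_image q \<subseteq> X" "pathstart q = x" "pathfinish q = x"
      using p q unfolding loops_def by auto
    have pp: "homotopic_paths X p p" and qcqc: "homotopic_paths X (q +++ c) (q +++ c)"
      using p' q' c by (simp_all add: path_image_join)
    have l: "homotopic_paths X (c +++ ?r) (\<lambda>_. x)"
      using c by (intro homotopic_paths_join_reversepath)
    have "homotopic_paths X (\<Phi> p +++ \<Phi> q) (?r +++ ((p +++ c) +++ (?r +++ (q +++ c))))"
      unfolding \<Phi>_def using c p' q'
      by (intro homotopic_paths_sym[OF homotopic_paths_assoc]) (simp_all add: path_image_join)
    also have "homotopic_paths X \<dots> (?r +++ (p +++ (c +++ (?r +++ (q +++ c)))))"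
      using c p' q' by (intro homotopic_paths_join[OF rr] homotopic_paths_sym[OF homotopic_paths_assoc])
        (simp_all add: path_image_join)
    also have "homotopic_paths X \<dots> (?r +++ (p +++ ((c +++ ?r) +++ (q +++ c))))"
      using c p' q' by (intro homotopic_paths_join[OF rr] homotopic_paths_join[OF pp]
        homotopic_paths_assoc)
        (simp_all add: path_image_join)
    also have "homotopic_paths X \<dots> (?r +++ (p +++ ((\<lambda>_. x) +++ (q +++ c))))"
      using c p' q' by (intro homotopic_paths_join[OF rr] homotopic_paths_join[OF pp]
        homotopic_paths_join[OF l qcqc])
        (simp_all add: path_image_join)
    also have "homotopic_paths X \<dots> (?r +++ (p +++ (q +++ c)))"
      using c p' q' by (intro homotopic_paths_join[OF rr] homotopic_paths_join[OF pp]
        homotopic_paths_const_join)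
        (simp_all add: path_image_join pathstart_join[of "\<lambda>_. x"] pathstart_def[of "\<lambda>_. x"])
    also have "homotopic_paths X \<dots> (\<Phi> (p +++ q))"
      unfolding \<Phi>_def using c p' q' by (intro homotopic_paths_join[OF rr] homotopic_paths_assoc)
        (simp_all add: path_image_join)
    finally show "homotopic_paths X (\<Phi> (p +++ q)) (\<Phi> p +++ \<Phi> q)"
      by (rule homotopic_paths_sym)
  qed (use \<Phi> \<Psi> \<Phi>\<Psi> in blast)+
qed

text \<open>Both groups are quotients of the fundamental group of \<open>U\<close>: every loop can
  be pushed into the complement, and the two vanishing conditions make the same loops die in
  \<open>X\<close> and in \<open>Y\<close>. On loops the isomorphism pushes into \<open>U\<close>
  and then applies \<open>f\<close>. Path-connectedness then gives all other base points.\<close>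

theorem isomorphic_fundamental_groupsI:
  fixes X U :: "'a::topological_space set" and Y U' :: "'b::topological_space set"
  assumes X: "tame_pair X U" "path_connected X" and Y: "tame_pair Y U'" "path_connected Y"
    and fg: "homeomorphism U U' f g" and ne: "U \<noteq> {}"
    and XY: "\<And>z. z \<in> X \<Longrightarrow> \<exists>V. open V \<and> z \<in> V \<and> loops_vanish Y f (V \<inter> U)"
    and YX: "\<And>z. z \<in> Y \<Longrightarrow> \<exists>V. open V \<and> z \<in> V \<and> loops_vanish X g (V \<inter> U')"
  shows "isomorphic_fundamental_groups X Y"
proof -
  obtain u where u: "u \<in> U" using ne by blast
  have UX: "U \<subseteq> X" "U' \<subseteq> Y"
    using X Y unfolding tame_pair_def by simp_all
  have f: "continuous_on U f" "f ` U = U'" "\<And>x. x \<in> U \<Longrightarrow> g (f x) = x"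
    and g: "continuous_on U' g" "g ` U' = U" "\<And>y. y \<in> U' \<Longrightarrow> f (g y) = y"
    using fg unfolding homeomorphism_def by auto
  have fY: "f ` U \<subseteq> Y" and gX: "g ` U' \<subseteq> X" using UX f(2) g(2) by auto
  have uX: "u \<in> X" and fu: "f u \<in> U'" and fuY: "f u \<in> Y" using u UX f by auto
  have loop_f: "f \<circ> p \<in> loops U' (f u)" if "p \<in> loops U u" for p
    using that f unfolding loops_def
    by (auto simp: pathstart_compose pathfinish_compose path_image_compose
        intro!: path_continuous_image intro: continuous_on_subset)
  have loop_g: "g \<circ> q \<in> loops U u" if "q \<in> loops U' (f u)" for q
    using that g f(3)[OF u] unfolding loops_def
    by (auto simp: pathstart_compose pathfinish_compose path_image_compose
        intro!: path_continuous_image intro: continuous_on_subset)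
  have loops_mono: "p \<in> loops T a"
      if "p \<in> loops S a" "S \<subseteq> T" for p :: "real \<Rightarrow> 'c::topological_space" and S T a
    using that unfolding loops_def by auto
  have fXY: "homotopic_paths Y (f \<circ> p) (f \<circ> q)"
    if "p \<in> loops U u" "q \<in> loops U u" "homotopic_paths X p q" for p q
    using that unfolding loops_def by (intro transfer_homotopic_paths[OF X(1) f(1) fY XY]) auto
  have gYX: "homotopic_paths X (g \<circ> p) (g \<circ> q)"
    if "p \<in> loops U' (f u)" "q \<in> loops U' (f u)" "homotopic_paths Y p q" for p q
    using that unfolding loops_def by (intro transfer_homotopic_paths[OF Y(1) g(1) gX YX]) auto
  have gf: "homotopic_paths X (g \<circ> (f \<circ> p)) p" if "p \<in> loops U u" for p
    using that f(3) UX(1) unfolding loops_def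
    by (intro homotopic_paths_sym[OF homotopic_paths_eq]) (auto simp: path_image_def image_subset_iff)
  have fg': "homotopic_paths Y (f \<circ> (g \<circ> q)) q" if "q \<in> loops U' (f u)" for q
    using that g(3) UX(2) unfolding loops_def
    by (intro homotopic_paths_sym[OF homotopic_paths_eq]) (auto simp: path_image_def image_subset_iff)
  have "\<exists>q. q \<in> loops U u \<and> homotopic_paths X p q" if p: "p \<in> loops X u" for p
  proof -
    have "\<exists>q. path q \<and> path_image q \<subseteq> U \<and> homotopic_paths X p q"
      using p u unfolding loops_def by (intro homotopic_into_subset[OF X(1)]) auto
    then show ?thesis
      using p homotopic_paths_imp_pathstart homotopic_paths_imp_pathfinish unfolding loops_def
        by fastforce
  qed
  then obtain r where r: "\<And>p. p \<in> loops X u \<Longrightarrow> r p \<in> loops U u"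
    "\<And>p. p \<in> loops X u \<Longrightarrow> homotopic_paths X p (r p)"
    by metis
  have iso: "fundamental_group X u \<cong> fundamental_group Y (f u)"
  proof (rule fundamental_group_isoI[of _ _ "\<lambda>p. f \<circ> r p"])
    show "f \<circ> r p \<in> loops Y (f u)" if "p \<in> loops X u" for p
      using loops_mono[OF loop_f[OF r(1)[OF that]] UX(2)] .
    fix p q assume p: "p \<in> loops X u" and q: "q \<in> loops X u"
    show "homotopic_paths X p q \<longleftrightarrow> homotopic_paths Y (f \<circ> r p) (f \<circ> r q)"
    proof
      assume "homotopic_paths X p q"
      then have "homotopic_paths X (r p) (r q)"
        using r(2)[OF p] r(2)[OF q] homotopic_paths_sym homotopic_paths_trans by metis
      then show "homotopic_paths Y (f \<circ> r p) (f \<circ> r q)"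
        using r(1) p q by (intro fXY)
    next
      assume "homotopic_paths Y (f \<circ> r p) (f \<circ> r q)"
      then have "homotopic_paths X (g \<circ> (f \<circ> r p)) (g \<circ> (f \<circ> r q))"
        by (intro gYX loop_f r(1) p q)
      then show "homotopic_paths X p q"
        using r(2)[OF p] r(2)[OF q] gf[OF r(1)[OF p]] gf[OF r(1)[OF q]] homotopic_paths_sym
          homotopic_paths_trans
        by metis
    qed
    have pq: "p +++ q \<in> loops X u"
      using p q by (rule join_loops)
    have "homotopic_paths X (p +++ q) (r p +++ r q)"
      using p q r(2) unfolding loops_def by (intro homotopic_paths_join) auto
    then have "homotopic_paths X (r (p +++ q)) (r p +++ r q)"
      using r(2)[OF pq] homotopic_paths_sym homotopic_paths_trans by metis
    then have "homotopic_paths Y (f \<circ> r (p +++ q)) (f \<circ> (r p +++ r q))"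
      using r(1) p q pq by (intro fXY join_loops)
    then show "homotopic_paths Y (f \<circ> r (p +++ q)) ((f \<circ> r p) +++ (f \<circ> r q))"
      by (simp only: path_compose_join)
  next
    fix q assume q: "q \<in> loops Y (f u)"
    have "\<exists>q'. path q' \<and> path_image q' \<subseteq> U' \<and> homotopic_paths Y q q'"
      using q fu unfolding loops_def by (intro homotopic_into_subset[OF Y(1)]) auto
    then obtain q' where *: "path q'" "path_image q' \<subseteq> U'" "homotopic_paths Y q q'"
      by blast
    have q': "q' \<in> loops U' (f u)" "homotopic_paths Y q q'"
      using q * homotopic_paths_imp_pathstart[OF *(3)] homotopic_paths_imp_pathfinish[OF *(3)]
      unfolding loops_def by simp_all
    let ?p = "g \<circ> q'"
    have p: "?p \<in> loops X u"
      using loops_mono[OF loop_g[OF q'(1)] UX(1)] .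
    have "homotopic_paths Y (f \<circ> r ?p) (f \<circ> ?p)"
      by (rule fXY[OF r(1)[OF p] loop_g[OF q'(1)] homotopic_paths_sym[OF r(2)[OF p]]])
    then have "homotopic_paths Y (f \<circ> r ?p) q"
      using fg'[OF q'(1)] q'(2) homotopic_paths_sym homotopic_paths_trans by metis
    then show "\<exists>p\<in>loops X u. homotopic_paths Y (f \<circ> r p) q"
      using p by blast
  qed
  have "fundamental_group X x \<cong> fundamental_group Y y" if "x \<in> X" "y \<in> Y" for x y
    using fundamental_group_basepoint[OF X(2) that(1) uX] iso fundamental_group_basepoint[OF Y(2)
      fuY that(2)]
      iso_trans by metis
  then show ?thesis
    unfolding isomorphic_fundamental_groups_def using uX fuY by blast
qed


section \<open>The projective plane in coordinates\<close>

text \<open>Bilinear, without complex conjugation, as in \<open>incident\<close>; covectors and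
  vectors share a type because the plane and its dual do.\<close>

definition pairing :: "complex^3 \<Rightarrow> complex^3 \<Rightarrow> complex" where
  "pairing a v = a$1 * v$1 + a$2 * v$2 + a$3 * v$3"

text \<open>On classes of vectors this is the join of two points and, dually, the meet of two
  lines.\<close>

definition cross :: "complex^3 \<Rightarrow> complex^3 \<Rightarrow> complex^3" where
  "cross a b = vector [a$2 * b$3 - a$3 * b$2, a$3 * b$1 - a$1 * b$3, a$1 * b$2 - a$2 * b$1]"

lemma cross_components [simp]:
  "cross a b $ 1 = a$2 * b$3 - a$3 * b$2" "cross a b $ 2 = a$3 * b$1 - a$1 * b$3"
  "cross a b $ 3 = a$1 * b$2 - a$2 * b$1"
  by (simp_all add: cross_def)

lemmas vec3_eq_iff = vec_eq_iff[where 'b=3, unfolded forall_3]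

lemma pairing_simps:
  "pairing (a + b) v = pairing a v + pairing b v" "pairing (c *s a) v = c * pairing a v"
  "pairing (a - b) v = pairing a v - pairing b v"
  "pairing a (v + w) = pairing a v + pairing a w" "pairing a (c *s v) = c * pairing a v"
  "pairing a (v - w) = pairing a v - pairing a w"
  by (simp_all add: pairing_def algebra_simps)

lemma pairing_cross [simp]: "pairing (cross a b) a = 0" "pairing (cross a b) b = 0"
  by (simp_all add: pairing_def algebra_simps)

lemma pairing_rotate: "pairing (cross b c) a = pairing (cross a b) c"
  by (simp add: pairing_def algebra_simps)

lemma pairing_commute: "pairing a b = pairing b a"
  by (simp add: pairing_def algebra_simps)

lemma cross_simps:
  "cross (c *s a) b = c *s cross a b" "cross a (c *s b) = c *s cross a b" "cross a a = 0"
  "cross a (b + d) = cross a b + cross a d" "cross (b + d) a = cross b a + cross d a"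
  by (simp_all add: vec3_eq_iff algebra_simps)

lemma cross_cross: "cross w (cross a b) = pairing w b *s a - pairing w a *s b"
  by (simp add: vec3_eq_iff pairing_def algebra_simps)

lemma cross_eq_0:
  assumes "a \<noteq> 0" "cross a b = 0"
  shows "\<exists>k. b = k *s a"
proof -
  have eqs: "a$2 * b$3 = a$3 * b$2" "a$3 * b$1 = a$1 * b$3" "a$1 * b$2 = a$2 * b$1"
    using assms(2) by (simp_all add: vec3_eq_iff)
  consider "a$1 \<noteq> 0" | "a$2 \<noteq> 0" | "a$3 \<noteq> 0"
    using assms(1) by (auto simp: vec3_eq_iff)
  then show ?thesis
  proof cases
    case 1
    then show ?thesis
      using eqs by (intro exI[of _ "b$1 / a$1"]) (simp add: vec3_eq_iff field_simps)
  next
    case 2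
    then show ?thesis
      using eqs by (intro exI[of _ "b$2 / a$2"]) (simp add: vec3_eq_iff field_simps)
  next
    case 3
    then show ?thesis
      using eqs by (intro exI[of _ "b$3 / a$3"]) (simp add: vec3_eq_iff field_simps)
  qed
qed

text \<open>The double cross product expands in \<open>a\<close> and \<open>b\<close> with the two
  given pairings as coefficients, so it vanishes and \<open>w\<close> is parallel to
  \<open>cross a b\<close>.\<close>

lemma proportional_cross:
  assumes "pairing w a = 0" "pairing w b = 0" "cross a b \<noteq> 0"
  shows "\<exists>k. w = k *s cross a b"
proof -
  have "cross (cross a b) w = - cross w (cross a b)"
    by (simp add: vec3_eq_iff)
  then have "cross (cross a b) w = 0"
    using assms by (simp add: cross_cross)
  then show ?thesis
    using assms(3) by (intro cross_eq_0)
qed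

section \<open>Points and lines as classes of nonzero vectors\<close>

lemma rep_cp2_nonzero: "rep_cp2 x \<noteq> 0"
  using Quotient3_rep_reflp[OF Quotient3_cp2, of x] by (simp add: proportional_def)

lemma abs_rep_cp2 [simp]: "abs_cp2 (rep_cp2 x) = x"
  using Quotient3_abs_rep[OF Quotient3_cp2] .

lemma proportional_refl: "proportional v v \<longleftrightarrow> v \<noteq> 0"
proof
  assume "v \<noteq> 0"
  moreover have "v = 1 *s v" by simp
  ultimately show "proportional v v"
    unfolding proportional_def by (metis one_neq_zero)
qed (simp add: proportional_def)

lemma abs_cp2_eq_iff:
  assumes "v \<noteq> 0" "w \<noteq> 0"
  shows "abs_cp2 v = abs_cp2 w \<longleftrightarrow> (\<exists>c. c \<noteq> 0 \<and> w = c *s v)"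
  using Quotient3_rel[OF Quotient3_cp2, of v w] assms by (simp add: proportional_refl proportional_def)

lemma abs_cp2_eqI:
  assumes "v \<noteq> 0" "w \<noteq> 0" "w = c *s v"
  shows "abs_cp2 v = abs_cp2 w"
  using assms abs_cp2_eq_iff by (metis vector_smult_lzero)

lemma rep_abs_cp2:
  assumes "v \<noteq> 0"
  obtains c where "c \<noteq> 0" "rep_cp2 (abs_cp2 v) = c *s v"
  using abs_cp2_eq_iff[OF assms rep_cp2_nonzero, of "abs_cp2 v"] by auto

lemma incident_abs:
  assumes "a \<noteq> 0" "v \<noteq> 0"
  shows "abs_cp2 v \<in> line (abs_cp2 a) \<longleftrightarrow> pairing a v = 0"
  using incident.abs_eq[of a v] assms
  by (simp add: line_def pairing_def sum_3 proportional_refl)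

lemma cross_nonzero:
  assumes "v \<noteq> 0" "w \<noteq> 0" "abs_cp2 v \<noteq> abs_cp2 w"
  shows "cross v w \<noteq> 0"
  using assms cross_eq_0[of v w] abs_cp2_eqI by metis

text \<open>For \<open>p = x\<close> the cross product is 0 and the value carries no information;
  the facts about it assume distinct points.\<close>

definition line_through :: "cp2 \<Rightarrow> cp2 \<Rightarrow> cp2" where
  "line_through p x = abs_cp2 (cross (rep_cp2 p) (rep_cp2 x))"

lemma line_through_abs:
  assumes "v \<noteq> 0" "w \<noteq> 0" "abs_cp2 v \<noteq> abs_cp2 w"
  shows "line_through (abs_cp2 v) (abs_cp2 w) = abs_cp2 (cross v w)"
proof -
  obtain c d where c: "c \<noteq> 0" "rep_cp2 (abs_cp2 v) = c *s v"
      and d: "d \<noteq> 0" "rep_cp2 (abs_cp2 w) = d *s w"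
    using rep_abs_cp2 assms by metis
  have "cross (c *s v) (d *s w) = (c * d) *s cross v w"
    by (simp add: cross_simps vec3_eq_iff)
  then show ?thesis
    unfolding line_through_def c d using cross_nonzero[OF assms] c d
    by (intro abs_cp2_eqI[symmetric, where c="c*d"]) (simp_all add: vector_mul_eq_0)
qed

lemma mem_line_through:
  assumes "p \<noteq> x"
  shows "p \<in> line (line_through p x)" "x \<in> line (line_through p x)"
proof -
  have "cross (rep_cp2 p) (rep_cp2 x) \<noteq> 0"
    using assms by (intro cross_nonzero) (simp_all add: rep_cp2_nonzero)
  then show "p \<in> line (line_through p x)" "x \<in> line (line_through p x)"
    using incident_abs[OF _ rep_cp2_nonzero] unfolding line_through_def
      by (metis abs_rep_cp2 pairing_cross)+
qed

lemma eq_line_through: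
  assumes "p \<noteq> x" "p \<in> line a" "x \<in> line a"
  shows "a = line_through p x"
proof -
  have ne: "cross (rep_cp2 p) (rep_cp2 x) \<noteq> 0"
    using assms by (intro cross_nonzero) (simp_all add: rep_cp2_nonzero)
  have "pairing (rep_cp2 a) (rep_cp2 p) = 0" "pairing (rep_cp2 a) (rep_cp2 x) = 0"
    using assms incident_abs[OF rep_cp2_nonzero rep_cp2_nonzero] by (metis abs_rep_cp2)+
  then obtain k where "rep_cp2 a = k *s cross (rep_cp2 p) (rep_cp2 x)"
    using proportional_cross ne by metis
  then show ?thesis
    unfolding line_through_def using abs_cp2_eqI[OF ne rep_cp2_nonzero] by (metis abs_rep_cp2)
qed

lemma lines_meet_once: "p = x" if "a \<noteq> b" "p \<in> line a" "p \<in> line b" "x \<in> line a" "x \<in> line b"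
  using that eq_line_through by metis

section \<open>The quotient topology of the plane\<close>

lemma continuous_on_abs_cp2: "continuous_on (- {0}) abs_cp2"
  by (subst continuous_on_open_vimage) (auto simp: open_cp2_def vimage_def Int_def conj_commute)

lemma continuous_on_abs_cp2_compose:
  "continuous_on T f \<Longrightarrow> (\<And>t. t \<in> T \<Longrightarrow> f t \<noteq> 0) \<Longrightarrow> continuous_on T (\<lambda>t. abs_cp2 (f t))"
  by (rule continuous_on_compose2[OF continuous_on_abs_cp2]) auto

text \<open>Open sets of the plane are those with open preimage in the nonzero vectors, so
  continuity on an open set can be tested there.\<close>

lemma continuous_on_cp2:
  fixes f :: "cp2 \<Rightarrow> 'b::topological_space"
  assumes O: "open O'" and f: "continuous_on {v. v \<noteq> 0 \<and> abs_cp2 v \<in> O'} (\<lambda>v. f (abs_cp2 v))"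
  shows "continuous_on O' f"
  unfolding continuous_on_open_vimage[OF O]
proof (intro allI impI)
  fix B :: "'b set" assume "open B"
  have "open {v. v \<noteq> 0 \<and> abs_cp2 v \<in> O'}"
    using O by (simp add: open_cp2_def)
  then have "open ((\<lambda>v. f (abs_cp2 v)) -` B \<inter> {v. v \<noteq> 0 \<and> abs_cp2 v \<in> O'})"
    using f \<open>open B\<close> continuous_on_open_vimage by blast
  moreover have "(\<lambda>v. f (abs_cp2 v)) -` B \<inter> {v. v \<noteq> 0 \<and> abs_cp2 v \<in> O'} = {v. v \<noteq> 0 \<and>
      abs_cp2 v \<in> f -` B \<inter> O'}"
    by auto
  ultimately show "open (f -` B \<inter> O')"
    by (simp add: open_cp2_def)
qed

lemma continuous_on_pairing [continuous_intros]:
  "continuous_on T f \<Longrightarrow> continuous_on T g \<Longrightarrow> continuous_on T (\<lambda>t. pairing (f t) (g t))"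
  unfolding pairing_def by (intro continuous_intros)

lemma continuous_on_cross [continuous_intros]:
  assumes "continuous_on T f" "continuous_on T g"
  shows "continuous_on T (\<lambda>t. cross (f t) (g t))"
proof -
  have "cross (f t) (g t) = (\<chi> i. if i = 1 then f t$2 * g t$3 - f t$3 * g t$2
      else if i = 2 then f t$3 * g t$1 - f t$1 * g t$3 else f t$1 * g t$2 - f t$2 * g t$1)" for t
    by (simp add: vec3_eq_iff)
  moreover have "continuous_on T (\<lambda>t. if (i::3) = 1 then f t$2 * g t$3 - f t$3 * g t$2
      else if i = 2 then f t$3 * g t$1 - f t$1 * g t$3 else f t$1 * g t$2 - f t$2 * g t$1)" for i
    using assms by (cases "i = 1"; cases "i = 2"; simp; intro continuous_intros)
  ultimately show ?thesis
    by (simp add: continuous_on_vec_lambda)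
qed

lemma exists_pairing_1:
  assumes "a \<noteq> 0"
  shows "\<exists>v. pairing a v = 1"
proof -
  consider "a$1 \<noteq> 0" | "a$2 \<noteq> 0" | "a$3 \<noteq> 0"
    using assms by (auto simp: vec3_eq_iff)
  then show ?thesis
  proof cases
    case 1
    then show ?thesis by (intro exI[of _ "vector [1 / a$1, 0, 0]"]) (simp add: pairing_def)
  next
    case 2
    then show ?thesis by (intro exI[of _ "vector [0, 1 / a$2, 0]"]) (simp add: pairing_def)
  next
    case 3
    then show ?thesis by (intro exI[of _ "vector [0, 0, 1 / a$3]"]) (simp add: pairing_def)
  qed
qed

lemma point_off_line: "\<exists>r. r \<notin> line a"
proof -
  obtain v where v: "pairing (rep_cp2 a) v = 1"
    using exists_pairing_1[OF rep_cp2_nonzero] by blast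
  then have "v \<noteq> 0" by (auto simp: pairing_def)
  with v show ?thesis
    using incident_abs[OF rep_cp2_nonzero, of v a] by (metis abs_rep_cp2 zero_neq_one)
qed

lemma closed_line: "closed (line a)"
proof -
  have "{v. v \<noteq> 0 \<and> abs_cp2 v \<in> - line a} = - {0} \<inter> {v. pairing (rep_cp2 a) v \<noteq> 0}"
    using incident_abs[OF rep_cp2_nonzero, of _ a] by auto
  moreover have "open (- {0} \<inter> {v. pairing (rep_cp2 a) v \<noteq> 0})"
    by (intro open_Int open_Compl closed_singleton open_Collect_neq continuous_intros)
  ultimately show ?thesis
    unfolding closed_def open_cp2_def by simp
qed

text \<open>A point off the line joining \<open>q\<close> and \<open>p\<close> spans with
  \<open>q\<close> a line that misses \<open>p\<close>, and the complement of this line separates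
  them. This is what makes finite sets of centres closed.\<close>

instance cp2 :: t1_space
proof
  fix p q :: cp2 assume "p \<noteq> q"
  then obtain r where r: "r \<noteq> p" "r \<notin> line (line_through q p)"
    using point_off_line mem_line_through by metis
  then have "p \<notin> line (line_through r q)"
    using \<open>p \<noteq> q\<close> mem_line_through eq_line_through by metis
  then show "\<exists>U. open U \<and> p \<in> U \<and> q \<notin> U"
    using closed_line r by (metis ComplD ComplI mem_line_through open_Compl)
qed

lemma continuous_on_line_through: "continuous_on (- {q}) (line_through q)"
proof (rule continuous_on_cp2)
  show "open (- {q})" by (simp add: open_Compl)
  let ?V = "{v. v \<noteq> 0 \<and> abs_cp2 v \<in> - {q}}"
  have ne: "cross (rep_cp2 q) v \<noteq> 0"
      and eq: "line_through q (abs_cp2 v) = abs_cp2 (cross (rep_cp2 q) v)" if "v \<in> ?V" for v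
    using that cross_nonzero[OF rep_cp2_nonzero, of v q] line_through_abs[OF rep_cp2_nonzero, of v
      q] by auto
  have "continuous_on ?V (\<lambda>v. abs_cp2 (cross (rep_cp2 q) v))"
    using ne by (intro continuous_on_abs_cp2_compose continuous_intros) auto
  then show "continuous_on ?V (\<lambda>v. line_through q (abs_cp2 v))"
    by (rule continuous_on_eq) (simp only: eq)
qed

text \<open>Quotient of two linear forms, hence independent of the representative: an affine
  coordinate off the line \<open>b\<close>.\<close>

definition ratio :: "complex^3 \<Rightarrow> complex^3 \<Rightarrow> cp2 \<Rightarrow> complex" where
  "ratio a b x = pairing a (rep_cp2 x) / pairing b (rep_cp2 x)"

lemma ratio_abs: "v \<noteq> 0 \<Longrightarrow> ratio a b (abs_cp2 v) = pairing a v / pairing b v"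
  unfolding ratio_def by (rule rep_abs_cp2[of v]) (auto simp: pairing_simps)

lemma mem_line_abs_rep: "a \<noteq> 0 \<Longrightarrow> x \<in> line (abs_cp2 a) \<longleftrightarrow> pairing a (rep_cp2 x) = 0"
  using incident_abs[OF _ rep_cp2_nonzero, of a x] by simp

lemma continuous_on_ratio:
  assumes "b \<noteq> 0"
  shows "continuous_on (- line (abs_cp2 b)) (ratio a b)"
proof (rule continuous_on_cp2)
  show "open (- line (abs_cp2 b))" using closed_line by (rule open_Compl)
  let ?V = "{v. v \<noteq> 0 \<and> abs_cp2 v \<in> - line (abs_cp2 b)}"
  have "continuous_on ?V (\<lambda>v. pairing a v / pairing b v)"
    using incident_abs[OF assms] by (intro continuous_intros) auto
  then show "continuous_on ?V (\<lambda>v. ratio a b (abs_cp2 v))"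
    by (rule continuous_on_eq) (simp add: ratio_abs)
qed


section \<open>Charts of the blow-up\<close>

lemma mem_blowup_iff:
  "z \<in> blowup S \<longleftrightarrow> snd z \<in> extensional S \<and> (\<forall>p\<in>S. p \<in> line (snd z p) \<and> fst z \<in> line (snd z p))"
  by (cases z) (auto simp: blowup_def PiE_iff)

lemma blowup_snd:
  assumes "z \<in> blowup S" "p \<in> S" "p \<noteq> fst z"
  shows "snd z p = line_through p (fst z)"
  using assms(1,2) by (intro eq_line_through assms(3)) (simp_all add: mem_blowup_iff)

text \<open>For a centre other than \<open>fst z\<close> the line through it and
  \<open>fst z\<close> is forced, so only the direction at a centre equal to \<open>fst z\<close> is
  free.\<close>

lemma blowup_eqI:
  assumes z: "z \<in> blowup S" and z': "z' \<in> blowup S" and fst_eq: "fst z = fst z'"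
    and snd_eq: "fst z \<in> S \<Longrightarrow> snd z (fst z) = snd z' (fst z)"
  shows "z = z'"
proof (rule prod_eqI)
  show "snd z = snd z'"
  proof (rule extensionalityI)
    show "snd z \<in> extensional S" "snd z' \<in> extensional S"
      using z z' by (simp_all add: mem_blowup_iff)
    fix p assume p: "p \<in> S"
    show "snd z p = snd z' p"
    proof (cases "p = fst z")
      case True
      then show ?thesis using snd_eq p by simp
    next
      case False
      then show ?thesis
        using blowup_snd[OF z p] blowup_snd[OF z' p] fst_eq by simp
    qed
  qed
qed (rule fst_eq)

section \<open>Continuous maps into the blow-up and lifts of lines\<close>

lemma continuous_on_line_through_compose:
  "continuous_on T f \<Longrightarrow> (\<And>t. t \<in> T \<Longrightarrow> f t \<noteq> q) \<Longrightarrow> continuous_on T (\<lambda>t. line_through q (f t))"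
  by (rule continuous_on_compose2[OF continuous_on_line_through]) auto

lemma continuous_on_snd_apply:
  fixes f :: "'a::topological_space \<Rightarrow> blowup_point"
  shows "continuous_on T f \<Longrightarrow> continuous_on T (\<lambda>t. snd (f t) p)"
  by (rule continuous_on_product_then_coordinatewise, rule continuous_on_snd)

lemma continuous_on_restrict:
  assumes "\<And>p. p \<in> S \<Longrightarrow> continuous_on T (f p)"
  shows "continuous_on T (\<lambda>t. \<lambda>p\<in>S. f p t)"
proof (intro continuous_on_coordinatewise_then_product)
  show "continuous_on T (\<lambda>t. (\<lambda>p\<in>S. f p t) i)" for i
    using assms by (cases "i \<in> S") simp_all
qed

text \<open>Explicit form of the strict transform, which is defined by a closure: at each centre on
  the line the direction must be the line itself. The agreement is
  \<open>strict_transform_line\<close>.\<close>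

definition strict :: "cp2 set \<Rightarrow> cp2 \<Rightarrow> blowup_point set" where
  "strict S c = {z \<in> blowup S. fst z \<in> line c \<and> (\<forall>p\<in>S. p \<in> line c \<longrightarrow> snd z p = c)}"

text \<open>For \<open>x\<close> on the line \<open>c\<close> this inverts the projection of
  \<open>strict S c\<close> to the line; a centre off the line differs from \<open>x\<close>, so
  \<open>line_through\<close> is meaningful there.\<close>

definition line_lift :: "cp2 set \<Rightarrow> cp2 \<Rightarrow> cp2 \<Rightarrow> blowup_point" where
  "line_lift S c x = (x, \<lambda>p\<in>S. if p \<in> line c then c else line_through p x)"

lemma fst_line_lift [simp]: "fst (line_lift S c x) = x"
  by (simp add: line_lift_def)

lemma line_lift_in_strict: "x \<in> line c \<Longrightarrow> line_lift S c x \<in> strict S c"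
proof -
  assume x: "x \<in> line c"
  have "p \<in> line (line_through p x) \<and> x \<in> line (line_through p x)" if "p \<notin> line c" for p
    using that x mem_line_through[of p x] by auto
  then show ?thesis
    using x unfolding strict_def mem_blowup_iff line_lift_def by simp
qed

lemma strict_eq_line_lift:
  assumes "z \<in> strict S c"
  shows "z = line_lift S c (fst z)"
proof -
  have z: "z \<in> blowup S" "fst z \<in> line c" "\<And>p. p \<in> S \<Longrightarrow> p \<in> line c \<Longrightarrow> snd z p = c"
    using assms unfolding strict_def by blast+
  have "line_lift S c (fst z) \<in> blowup S"
    using line_lift_in_strict[OF z(2), of S] unfolding strict_def by blast
  then show ?thesis
  proof (rule blowup_eqI[OF z(1)])
    assume "fst z \<in> S"
    then show "snd z (fst z) = snd (line_lift S c (fst z)) (fst z)"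
      using z(2,3) by (simp add: line_lift_def)
  qed simp
qed

lemma strict_if_notin:
  assumes "z \<in> blowup S" "fst z \<in> line c" "fst z \<notin> S"
  shows "z \<in> strict S c"
proof -
  have "snd z p = c" if "p \<in> S" "p \<in> line c" for p
    using blowup_snd[OF assms(1) that(1)] eq_line_through[of p "fst z" c] that assms by metis
  then show ?thesis
    using assms unfolding strict_def by simp
qed

lemma exists_line: "\<exists>a. x \<in> line a"
proof -
  have "\<exists>u. cross (rep_cp2 x) u \<noteq> 0"
  proof (rule ccontr)
    assume "\<not> ?thesis"
    then have "cross (rep_cp2 x) (vector [1,0,0]) = 0" "cross (rep_cp2 x) (vector [0,1,0]) = 0"
      by blast+
    then show False
      using rep_cp2_nonzero[of x] by (simp add: vec3_eq_iff)
  qed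
  then show ?thesis
    using incident_abs[OF _ rep_cp2_nonzero, of _ x] by (metis abs_rep_cp2 pairing_cross(1))
qed

text \<open>Over a centre take the line given by the direction there, elsewhere any line through the
  point. Thus charts adapted to a line are available everywhere.\<close>

lemma exists_line_strict:
  assumes "z \<in> blowup S"
  obtains c where "z \<in> strict S c"
proof (cases "fst z \<in> S")
  case True
  let ?c = "snd z (fst z)"
  have c: "fst z \<in> line ?c"
    using assms True unfolding mem_blowup_iff by metis
  have "snd z p = ?c" if "p \<in> S" "p \<in> line ?c" for p
    using blowup_snd[OF assms that(1)] eq_line_through[of p "fst z" ?c] that c by metis
  then have "z \<in> strict S ?c"
    using assms c unfolding strict_def by simp
  then show ?thesis by (rule that)
next
  case False
  obtain a where "fst z \<in> line a"
    using exists_line by metis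
  then have "z \<in> strict S a"
    using strict_if_notin[OF assms _ False] by metis
  then show ?thesis by (rule that)
qed

text \<open>A basis \<open>e0, e1, e2\<close> gives affine coordinates \<open>(x, y)\<close> centred at the point \<open>b\<close> in which the line \<open>c\<close>
  is \<open>y = 0\<close>. The dual basis is \<open>E0, E1, E2\<close> up to the factor \<open>D\<close>.\<close>

locale frame =
  fixes e0 e1 e2 :: "complex^3"
  assumes det: "pairing (cross e1 e2) e0 \<noteq> 0"
begin

definition "D = pairing (cross e1 e2) e0"
definition "E0 = cross e1 e2"
definition "E1 = cross e2 e0"
definition "E2 = cross e0 e1"

lemma D: "D \<noteq> 0"
  using det by (simp add: D_def)

lemma dual [simp]:
  "pairing E0 e0 = D" "pairing E0 e1 = 0" "pairing E0 e2 = 0"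
  "pairing E1 e0 = 0" "pairing E1 e1 = D" "pairing E1 e2 = 0"
  "pairing E2 e0 = 0" "pairing E2 e1 = 0" "pairing E2 e2 = D"
  by (simp_all add: D_def E0_def E1_def E2_def pairing_def algebra_simps)

lemma expand: "D *s v = pairing E0 v *s e0 + pairing E1 v *s e1 + pairing E2 v *s e2"
  by (simp add: vec3_eq_iff pairing_def D_def E0_def E1_def E2_def algebra_simps)

lemma nonzero: "e0 \<noteq> 0" "e1 \<noteq> 0" "e2 \<noteq> 0" "E0 \<noteq> 0" "E1 \<noteq> 0" "E2 \<noteq> 0"
proof -
  have nz: "a \<noteq> 0 \<and> v \<noteq> 0" if "pairing a v = D" for a v
    using that D by (auto simp: pairing_def)
  show "e0 \<noteq> 0" "e1 \<noteq> 0" "e2 \<noteq> 0" "E0 \<noteq> 0" "E1 \<noteq> 0" "E2 \<noteq> 0"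
    using nz[OF dual(1)] nz[OF dual(5)] nz[OF dual(9)] by simp_all
qed

definition "vc x y = e0 + x *s e1 + y *s e2"
definition "pt x y = abs_cp2 (vc x y)"
definition "b = abs_cp2 e0"
definition "c = abs_cp2 E2"

lemma pairing_vc [simp]: "pairing E0 (vc x y) = D" "pairing E1 (vc x y) = x * D"
    "pairing E2 (vc x y) = y * D"
  by (simp_all add: vc_def pairing_simps)

lemma vc_nonzero: "vc x y \<noteq> 0"
proof
  assume "vc x y = 0"
  then show False
    using pairing_vc(1)[of x y] D by (simp add: pairing_def)
qed

lemma ratio_pt [simp]: "ratio E1 E0 (pt x y) = x" "ratio E2 E0 (pt x y) = y"
  using D by (simp_all add: pt_def ratio_abs vc_nonzero)

lemma pt_eq_iff: "pt x y = pt x' y' \<longleftrightarrow> x = x' \<and> y = y'"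
  by (metis ratio_pt)

lemma b_pt: "b = pt 0 0"
  by (simp add: b_def pt_def vc_def)

lemma pt_ratio:
  assumes "p \<notin> line (abs_cp2 E0)"
  shows "p = pt (ratio E1 E0 p) (ratio E2 E0 p)"
proof -
  let ?v = "rep_cp2 p"
  have v: "pairing E0 ?v \<noteq> 0"
    using assms mem_line_abs_rep nonzero(4) by blast
  have "vc (ratio E1 E0 p) (ratio E2 E0 p) = (D / pairing E0 ?v) *s ?v"
  proof -
    have "pairing E0 ?v *s vc (ratio E1 E0 p) (ratio E2 E0 p) = D *s ?v"
      unfolding expand[of ?v] using v by (simp add: vc_def ratio_def vec3_eq_iff algebra_simps)
    then show ?thesis
      using v by (simp add: vec3_eq_iff field_simps)
  qed
  then show ?thesis
    unfolding pt_def using abs_cp2_eqI[OF rep_cp2_nonzero vc_nonzero] by (metis abs_rep_cp2)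
qed

lemma pt_notin: "pt x y \<notin> line (abs_cp2 E0)"
  using incident_abs[OF nonzero(4) vc_nonzero] D by (simp add: pt_def)

lemma pt_in_c: "pt x y \<in> line c \<longleftrightarrow> y = 0"
  using incident_abs[OF nonzero(6) vc_nonzero] D by (simp add: pt_def c_def)

text \<open>The line through \<open>b\<close> of slope \<open>y\<close>: it joins \<open>e0\<close>
  to the direction \<open>e1 + y *s e2\<close>.\<close>

definition "dir y = cross e0 (e1 + y *s e2)"

lemma dir_eq: "dir y = E2 - y *s E1"
  by (simp add: dir_def E2_def E1_def vec3_eq_iff algebra_simps)

lemma pairing_dir: "pairing (dir y) e0 = 0" "pairing (dir y) e1 = - y * D" "pairing (dir y) e2 = D"
  by (simp_all add: dir_eq pairing_simps)

lemma dir_nonzero: "dir y \<noteq> 0"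
proof
  assume "dir y = 0"
  then show False
    using pairing_dir(3)[of y] D by (simp add: pairing_def)
qed

lemma abs_dir_eq_c: "abs_cp2 (dir y) = c \<longleftrightarrow> y = 0"
proof
  assume "abs_cp2 (dir y) = c"
  then obtain k where "k \<noteq> 0" "E2 = k *s dir y"
    unfolding c_def using abs_cp2_eq_iff[OF dir_nonzero nonzero(6)] by auto
  then have "k * (- y * D) = 0"
    by (metis dual(8) pairing_dir(2) pairing_simps(2))
  then show "y = 0"
    using D \<open>k \<noteq> 0\<close> by simp
qed (simp add: dir_eq c_def)

lemma line_through_b_pt:
  assumes "x \<noteq> 0"
  shows "line_through b (pt x (x * y)) = abs_cp2 (dir y)"
proof -
  have "cross e0 (vc x (x * y)) = x *s dir y"
    by (simp add: vc_def dir_def vec3_eq_iff algebra_simps)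
  moreover have "b \<noteq> pt x (x * y)"
    using assms by (simp add: b_pt pt_eq_iff)
  then have "abs_cp2 e0 \<noteq> abs_cp2 (vc x (x * y))"
    by (simp add: b_def pt_def)
  then have "line_through b (pt x (x * y)) = abs_cp2 (cross e0 (vc x (x * y)))"
    unfolding b_def pt_def by (rule line_through_abs[OF nonzero(1) vc_nonzero])
  moreover have "abs_cp2 (dir y) = abs_cp2 (x *s dir y)"
    using assms dir_nonzero by (intro abs_cp2_eqI[OF dir_nonzero _ refl]) (simp add: vector_mul_eq_0)
  ultimately show ?thesis
    by simp
qed

text \<open>If \<open>b\<close> is blown up, the second coordinate is the slope of the direction at \<open>b\<close>. In any case the
  strict transform of \<open>c\<close> is \<open>y = 0\<close>, and the fibre over \<open>b\<close> is \<open>x = 0\<close> or the origin.\<close>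

definition chart :: "cp2 set \<Rightarrow> complex \<times> complex \<Rightarrow> blowup_point" where
  "chart S w = (let p = pt (fst w) (if b \<in> S then fst w * snd w else snd w)
    in (p, \<lambda>q\<in>S. if q = b then abs_cp2 (dir (snd w)) else line_through q p))"

text \<open>The slope is recovered from \<open>dir y\<close>, whose pairings with \<open>e1\<close>
  and \<open>e2\<close> are \<open>- y * D\<close> and \<open>D\<close>; hence the sign.\<close>

definition chart_inv :: "cp2 set \<Rightarrow> blowup_point \<Rightarrow> complex \<times> complex" where
  "chart_inv S z = (ratio E1 E0 (fst z), if b \<in> S then - ratio e1 e2 (snd z b) else ratio E2 E0 (fst z))"

text \<open>Points over the other centres are left out, because the chart does not see the direction
  there.\<close>

definition "chart_domain S = {w. fst (chart S w) \<notin> S - {b}}"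
text \<open>The last condition excludes the direction of infinite slope:
  \<open>line (abs_cp2 e2)\<close> is read in the dual plane, as the pencil of lines through the
  point of \<open>e2\<close>.\<close>

definition "chart_open S = {z. fst z \<notin> line (abs_cp2 E0) \<and> fst z \<notin> S - {b} \<and> (b \<in> S \<longrightarrow>
    snd z b \<notin> line (abs_cp2 e2))}"

lemma fst_chart: "fst (chart S w) = pt (fst w) (if b \<in> S then fst w * snd w else snd w)"
  by (simp add: chart_def Let_def)

lemma snd_chart: "snd (chart S w) = (\<lambda>q\<in>S. if q = b then abs_cp2 (dir (snd w)) else line_through q
    (fst (chart S w)))"
  unfolding chart_def Let_def fst_conv snd_conv by (rule refl)

lemma continuous_on_pt: "continuous_on T f \<Longrightarrow> continuous_on T g \<Longrightarrow> continuous_on T (\<lambda>t. pt (f t) (g t))"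
proof -
  have "continuous_on T (\<lambda>t. h t *s a)" if "continuous_on T h" for h :: "_ \<Rightarrow> complex"
      and a :: "complex^3"
    unfolding vector_scalar_mult_def by (intro continuous_intros that)
  then show "continuous_on T f \<Longrightarrow> continuous_on T g \<Longrightarrow> continuous_on T (\<lambda>t. pt (f t) (g t))"
    unfolding pt_def using vc_nonzero
    by (intro continuous_on_abs_cp2_compose) (auto simp: vc_def intro!: continuous_intros)
qed

lemma continuous_on_dir: "continuous_on T f \<Longrightarrow> continuous_on T (\<lambda>t. abs_cp2 (dir (f t)))"
  using dir_nonzero unfolding dir_def vector_scalar_mult_def
  by (intro continuous_on_abs_cp2_compose) (auto intro!: continuous_intros simp: dir_def
    vector_scalar_mult_def)

lemma continuous_on_fst_chart: "continuous_on T (\<lambda>w. fst (chart S w))"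
  unfolding fst_chart by (cases "b \<in> S") (auto intro!: continuous_on_pt continuous_intros)

lemma continuous_on_chart: "continuous_on (chart_domain S) (chart S)"
proof -
  have "continuous_on (chart_domain S) (\<lambda>w. (fst (chart S w), snd (chart S w)))"
    unfolding snd_chart
  proof (intro continuous_on_Pair continuous_on_fst_chart continuous_on_restrict)
    fix q assume q: "q \<in> S"
    show "continuous_on (chart_domain S) (\<lambda>w. if q = b then abs_cp2 (dir (snd w)) else line_through
        q (fst (chart S w)))"
    proof (cases "q = b")
      case True
      then show ?thesis
        by (simp add: continuous_on_dir continuous_on_snd)
    next
      case False
      then have "continuous_on (chart_domain S) (\<lambda>w. line_through q (fst (chart S w)))"
        using q by (intro continuous_on_line_through_compose continuous_on_fst_chart) (auto simp:
          chart_domain_def)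
      then show ?thesis using False by simp
    qed
  qed
  then show ?thesis by simp
qed

lemma b_in_dir: "b \<in> line (abs_cp2 (dir y))"
  using incident_abs[OF dir_nonzero nonzero(1)] by (simp add: b_def pairing_dir)

lemma pt_in_dir: "pt x (x * y) \<in> line (abs_cp2 (dir y))"
  using incident_abs[OF dir_nonzero vc_nonzero] by (simp add: pt_def vc_def pairing_simps pairing_dir)

lemma chart_in_blowup:
  assumes "w \<in> chart_domain S"
  shows "chart S w \<in> blowup S"
  unfolding mem_blowup_iff
proof (intro conjI ballI)
  show "snd (chart S w) \<in> extensional S"
    by (simp add: snd_chart)
  fix q assume q: "q \<in> S"
  show "q \<in> line (snd (chart S w) q)" "fst (chart S w) \<in> line (snd (chart S w) q)"
  proof -
    show "q \<in> line (snd (chart S w) q)"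
      using q assms b_in_dir mem_line_through(1)[of q "fst (chart S w)"]
      by (auto simp: snd_chart chart_domain_def)
    show "fst (chart S w) \<in> line (snd (chart S w) q)"
    proof (cases "q = b")
      case True
      then show ?thesis using q pt_in_dir by (simp add: snd_chart fst_chart)
    next
      case False
      then show ?thesis
        using q assms mem_line_through(2)[of q "fst (chart S w)"]
        by (auto simp: snd_chart chart_domain_def)
    qed
  qed
qed

lemma chart_in_strict_iff:
  assumes "w \<in> chart_domain S"
  shows "chart S w \<in> strict S c \<longleftrightarrow> snd w = 0"
proof
  assume *: "chart S w \<in> strict S c"
  show "snd w = 0"
  proof (cases "b \<in> S")
    case True
    moreover have "b \<in> line c" using pt_in_c b_pt by simp
    ultimately have "abs_cp2 (dir (snd w)) = c"
      using * unfolding strict_def by (auto simp: snd_chart)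
    then show ?thesis by (simp add: abs_dir_eq_c)
  next
    case False
    then show ?thesis using * pt_in_c unfolding strict_def by (simp add: fst_chart)
  qed
next
  assume w: "snd w = 0"
  have fc: "fst (chart S w) \<in> line c"
    using w by (simp add: fst_chart pt_in_c)
  moreover have "snd (chart S w) p = c" if p: "p \<in> S" "p \<in> line c" for p
  proof (cases "p = b")
    case True
    then show ?thesis using p w abs_dir_eq_c[of 0] by (simp add: snd_chart)
  next
    case False
    then have "p \<noteq> fst (chart S w)" using p assms unfolding chart_domain_def by auto
    then show ?thesis using p False fc eq_line_through[of p "fst (chart S w)" c] by (simp add: snd_chart)
  qed
  ultimately show "chart S w \<in> strict S c"
    using chart_in_blowup[OF assms] unfolding strict_def by blast
qed

lemma fst_chart_eq_b:
  "fst (chart S w) = b \<longleftrightarrow> fst w = 0 \<and> (b \<in> S \<or> snd w = 0)"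
  by (auto simp: fst_chart b_pt pt_eq_iff)

lemma ratio_dir: "ratio e1 e2 (abs_cp2 (dir y)) = - y"
proof -
  have "ratio e1 e2 (abs_cp2 (dir y)) = pairing (dir y) e1 / pairing (dir y) e2"
    unfolding ratio_abs[OF dir_nonzero] by (simp only: pairing_commute)
  then show ?thesis
    using D by (simp add: pairing_dir)
qed

lemma dir_notin: "abs_cp2 (dir y) \<notin> line (abs_cp2 e2)"
  unfolding incident_abs[OF nonzero(3) dir_nonzero] pairing_commute[of e2] using D
      by (simp add: pairing_dir)

lemma chart_in_open: "w \<in> chart_domain S \<Longrightarrow> chart S w \<in> chart_open S"
  using pt_notin dir_notin by (simp add: chart_open_def chart_domain_def snd_chart fst_chart)

lemma chart_inv_chart: "chart_inv S (chart S w) = w"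
  by (simp add: chart_inv_def fst_chart snd_chart ratio_dir)

lemma chart_chart_inv:
  assumes z: "z \<in> blowup S" "z \<in> chart_open S"
  shows "chart S (chart_inv S z) = z" "chart_inv S z \<in> chart_domain S"
proof -
  have fz: "fst z = pt (ratio E1 E0 (fst z)) (ratio E2 E0 (fst z))"
    using z(2) pt_ratio unfolding chart_open_def by blast
  define x y where "x = ratio E1 E0 (fst z)" and "y = ratio E2 E0 (fst z)"
  let ?w = "chart_inv S z"
  have key: "fst (chart S ?w) = fst z \<and> (b \<in> S \<longrightarrow> abs_cp2 (dir (snd ?w)) = snd z b)"
  proof (cases "b \<in> S")
    case False
    then show ?thesis using fz by (simp add: fst_chart chart_inv_def)
  next
    case True
    let ?l = "rep_cp2 (snd z b)"
    have le2: "pairing ?l e2 \<noteq> 0"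
      using z(2) True mem_line_abs_rep[OF nonzero(3), of "snd z b"]
        by (simp add: chart_open_def pairing_commute[of e2])
    have le0: "pairing ?l e0 = 0"
      using z(1) True incident_abs[OF rep_cp2_nonzero nonzero(1), of "snd z b"]
        unfolding mem_blowup_iff b_def by simp
    \<comment> \<open>The point lies on the line given by its direction, which forces its second
      affine coordinate to be \<open>x\<close> times the slope, as in the chart.\<close>
    have "fst z \<in> line (snd z b)"
      using z(1) True unfolding mem_blowup_iff by blast
    moreover have "abs_cp2 (vc x y) \<in> line (abs_cp2 ?l) \<longleftrightarrow> pairing ?l (vc x y) = 0"
      by (rule incident_abs[OF rep_cp2_nonzero vc_nonzero])
    ultimately have "pairing ?l (vc x y) = 0"
      using fz unfolding x_def[symmetric] y_def[symmetric] pt_def by simp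
    then have eq: "x * pairing ?l e1 + y * pairing ?l e2 = 0"
      using le0 by (simp add: vc_def pairing_simps)
    have w: "?w = (x, - (pairing ?l e1 / pairing ?l e2))"
      using True by (simp add: chart_inv_def x_def ratio_def pairing_commute[of e1]
        pairing_commute[of e2])
    have yl: "y * pairing ?l e2 = - (x * pairing ?l e1)"
      using eq by (simp add: eq_neg_iff_add_eq_0 add.commute)
    have "y = (y * pairing ?l e2) / pairing ?l e2"
      using le2 by (rule nonzero_mult_div_cancel_right[symmetric])
    also have "\<dots> = x * (- (pairing ?l e1 / pairing ?l e2))"
      unfolding yl by simp
    finally have "y = x * (- (pairing ?l e1 / pairing ?l e2))" .
    then have "fst (chart S ?w) = fst z"
      using True fz unfolding w fst_chart x_def[symmetric] y_def[symmetric] by simp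
    moreover have "abs_cp2 (dir (snd ?w)) = snd z b"
    proof -
      let ?n = "snd ?w"
      have "pairing ?l (e1 + ?n *s e2) = 0"
        using le2 unfolding w snd_conv pairing_simps by simp
      then obtain k where "?l = k *s dir ?n"
        using proportional_cross[of ?l e0 "e1 + ?n *s e2"] le0 dir_nonzero unfolding dir_def by metis
      then show ?thesis
        using abs_cp2_eqI[OF dir_nonzero rep_cp2_nonzero] by (metis abs_rep_cp2)
    qed
    ultimately show ?thesis by blast
  qed
  then show dom: "?w \<in> chart_domain S"
    using z(2) unfolding chart_domain_def chart_open_def by simp
  show "chart S ?w = z"
  proof (rule blowup_eqI[OF chart_in_blowup[OF dom] z(1)])
    show "fst (chart S ?w) = fst z" using key by blast
    assume "fst (chart S ?w) \<in> S"
    moreover from this dom have "fst (chart S ?w) = b" unfolding chart_domain_def by blast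
    ultimately show "snd (chart S ?w) (fst (chart S ?w)) = snd z (fst (chart S ?w))"
      using key by (simp add: snd_chart)
  qed
qed

lemma open_chart_open:
  assumes "finite S"
  shows "open (chart_open S)"
proof -
  have "chart_open S = fst -` (- line (abs_cp2 E0)) \<inter> fst -` (- (S - {b})) \<inter>
      (if b \<in> S then (\<lambda>z. snd z b) -` (- line (abs_cp2 e2)) else UNIV)"
    unfolding chart_open_def by auto
  moreover have "open ((\<lambda>z::blowup_point. snd z b) -` (- line (abs_cp2 e2)))"
    using continuous_on_snd_apply[OF continuous_on_id, of UNIV b] closed_line
    by (intro open_vimage) (auto simp: open_Compl)
  moreover have "open (- (S - {b}))"
    using assms by (intro open_Compl finite_imp_closed) simp
  ultimately show ?thesis
    by (simp only: open_Int open_vimage_fst open_Compl closed_line if_split open_UNIV simp_thms)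
qed

lemma continuous_on_chart_inv: "continuous_on (chart_open S) (chart_inv S)"
proof -
  have r: "continuous_on (chart_open S) (\<lambda>z. ratio a E0 (fst z))" for a
    by (rule continuous_on_compose2[OF continuous_on_ratio[OF nonzero(4)]])
      (auto intro!: continuous_intros simp: chart_open_def)
  have "continuous_on (chart_open S) (\<lambda>z. ratio e1 e2 (snd z b))" if "b \<in> S"
    by (rule continuous_on_compose2[OF continuous_on_ratio[OF nonzero(3)]
      continuous_on_snd_apply[OF continuous_on_id]])
      (use that in \<open>auto simp: chart_open_def\<close>)
  then show ?thesis
    unfolding chart_inv_def using r by (cases "b \<in> S") (auto intro!: continuous_intros)
qed

lemma open_chart_domain:
  assumes "finite S"
  shows "open (chart_domain S)"
proof -
  have "chart_domain S = (\<lambda>w. fst (chart S w)) -` (- (S - {b}))"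
    unfolding chart_domain_def by auto
  moreover have "open (- (S - {b}))"
    using assms by (intro open_Compl finite_imp_closed) simp
  ultimately show ?thesis
    using open_vimage[OF _ continuous_on_fst_chart] by metis
qed

end

section \<open>Frames adapted to a point and a line\<close>

lemma exists_frame:
  assumes "x \<in> line a"
  obtains e0 e1 e2 where "frame e0 e1 e2" "frame.b e0 = x" "frame.c e0 e1 = a"
proof -
  define e0 w where "e0 = rep_cp2 x" and "w = rep_cp2 a"
  have ab: "abs_cp2 e0 = x" "abs_cp2 w = a"
    by (simp_all add: e0_def w_def)
  obtain u where u: "pairing e0 u = 1"
    using exists_pairing_1[OF rep_cp2_nonzero, of x] unfolding e0_def by blast
  obtain e2 where e2: "pairing w e2 = 1"
    using exists_pairing_1[OF rep_cp2_nonzero, of a] unfolding w_def by blast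
  have "pairing w e0 = 0"
    using assms incident_abs[OF rep_cp2_nonzero rep_cp2_nonzero, of x a] unfolding e0_def w_def by simp
  \<comment> \<open>The vector \<open>cross w u\<close> serves as \<open>e1\<close>: it lies on the
    line \<open>w\<close>, and by the double cross product the normalization
    \<open>pairing e0 u = 1\<close> makes \<open>E2\<close> equal to \<open>w\<close>
    itself.\<close>
  then have E2: "cross e0 (cross w u) = w"
    using u by (simp add: cross_cross pairing_commute[of e0 w])
  have "pairing (cross (cross w u) e2) e0 = pairing (cross e0 (cross w u)) e2"
    by (rule pairing_rotate)
  then interpret frame e0 "cross w u" e2
    using e2 E2 by unfold_locales simp
  show ?thesis
    by (rule that[OF frame_axioms]) (simp_all add: b_def c_def E2_def E2 ab)
qed

lemma exists_frame_through:
  assumes "x \<noteq> y"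
  obtains e0 e1 e2 where "frame e0 e1 e2" "frame.pt e0 e1 e2 0 0 = x" "frame.pt e0 e1 e2 1 0 = y"
    "frame.c e0 e1 = line_through x y"
proof -
  \<comment> \<open>With the difference as \<open>e1\<close>, the points \<open>pt 0 0\<close> and
    \<open>pt 1 0\<close> of the axis are \<open>x\<close> and \<open>y\<close>.\<close>
  define e0 e1 where "e0 = rep_cp2 x" and "e1 = rep_cp2 y - rep_cp2 x"
  have E2: "cross e0 e1 = cross (rep_cp2 x) (rep_cp2 y)"
    unfolding e0_def e1_def by (simp add: vec3_eq_iff algebra_simps)
  have "cross (rep_cp2 x) (rep_cp2 y) \<noteq> 0"
    using assms by (intro cross_nonzero rep_cp2_nonzero) simp
  then obtain e2 where e2: "pairing (cross e0 e1) e2 = 1"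
    using exists_pairing_1 E2 by metis
  have "pairing (cross e1 e2) e0 = pairing (cross e0 e1) e2"
    by (rule pairing_rotate)
  then interpret frame e0 e1 e2
    using e2 by unfold_locales simp
  show ?thesis
    by (rule that[OF frame_axioms]) (simp_all add: pt_def vc_def c_def E2_def E2
      line_through_def[symmetric], simp_all add: e0_def e1_def)
qed

lemma line_symmetric: "x \<in> line a \<longleftrightarrow> a \<in> line x"
  using incident_abs[OF rep_cp2_nonzero rep_cp2_nonzero, of x a] incident_abs[OF rep_cp2_nonzero
    rep_cp2_nonzero, of a x]
  by (simp add: pairing_commute[of "rep_cp2 a"])

lemma infinite_line: "infinite (line a)"
proof -
  obtain x where "x \<in> line a"
    using exists_line line_symmetric by metis
  then obtain e0 e1 e2 where "frame e0 e1 e2" and c: "frame.c e0 e1 = a"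
    by (rule exists_frame)
  then interpret frame e0 e1 e2 by simp
  have "inj (\<lambda>t. pt t 0)"
    by (simp add: inj_def pt_eq_iff)
  then have "infinite (range (\<lambda>t. pt t 0))"
    using infinite_UNIV_char_0 finite_imageD by metis
  moreover have "range (\<lambda>t. pt t 0) \<subseteq> line a"
    using pt_in_c c by auto
  ultimately show ?thesis
    using finite_subset by blast
qed

lemma line_eq_iff: "line a = line a' \<longleftrightarrow> a = a'"
proof
  assume eq: "line a = line a'"
  obtain x where x: "x \<in> line a"
    using infinite_line by (metis finite.emptyI equals0I)
  then have "infinite (line a - {x})"
    using infinite_line by simp
  then obtain y where "y \<in> line a" "y \<noteq> x"
    by (metis DiffE finite.emptyI insertI1 equals0I)
  then show "a = a'"
    using eq x eq_line_through[of x y] by metis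
qed simp

text \<open>A product of two discs rather than a ball, so that the complements of the coordinate
  axes are products as well.\<close>

definition bidisc :: "real \<Rightarrow> (complex \<times> complex) set" where
  "bidisc r = ball 0 r \<times> ball 0 r"

lemma bidisc_props:
  assumes "r > 0"
  shows "convex (bidisc r)" "open (bidisc r)" "(0, 0) \<in> bidisc r"
    "path_connected (bidisc r)" "simply_connected (bidisc r)"
    "path_connected (bidisc r - {w. snd w = 0})" "path_connected (bidisc r - {w. fst w = 0})"
    "path_connected (bidisc r - {(0, 0)})" "simply_connected (bidisc r - {(0, 0)})"
    "bidisc r - {w. snd w = 0} \<noteq> {}" "bidisc r - {w. fst w = 0} \<noteq> {}"
proof -
  show c: "convex (bidisc r)" and o: "open (bidisc r)" and "(0, 0) \<in> bidisc r"
    using assms by (auto simp: bidisc_def convex_Times open_Times)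
  show "path_connected (bidisc r)" "simply_connected (bidisc r)"
    using c by (simp_all add: convex_imp_path_connected convex_imp_simply_connected)
  have p: "path_connected (ball (0::complex) r - {0})" "path_connected (ball (0::complex) r)"
    by (intro path_connected_open_delete convex_connected) (auto simp: convex_imp_path_connected)
  have "bidisc r - {w. snd w = 0} = ball 0 r \<times> (ball 0 r - {0})"
      "bidisc r - {w. fst w = 0} = (ball 0 r - {0}) \<times> ball 0 r"
    by (auto simp: bidisc_def)
  then show "path_connected (bidisc r - {w. snd w = 0})" "path_connected (bidisc r - {w. fst w = 0})"
    using p by (simp_all add: path_connected_Times)
  \<comment> \<open>The real dimension is four; puncturing an open convex set of dimension at least
    three leaves it simply connected.\<close>
  show "simply_connected (bidisc r - {(0, 0)})"
    using c by (rule simply_connected_punctured_convex) (use o assms in \<open>simp_all add: aff_dim_open bidisc_def\<close>)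
  then show "path_connected (bidisc r - {(0, 0)})"
    by (rule simply_connected_imp_path_connected)
  have "(r/2, r/2) \<in> bidisc r" "(complex_of_real (r/2)) \<noteq> 0"
    using assms by (auto simp: bidisc_def)
  then show "bidisc r - {w. snd w = 0} \<noteq> {}" "bidisc r - {w. fst w = 0} \<noteq> {}"
    by fastforce+
qed

lemma open_contains_bidisc:
  assumes "open T" "(0, 0) \<in> T"
  obtains r where "r > 0" "bidisc r \<subseteq> T"
proof -
  obtain A B where AB: "open A" "open B" "0 \<in> A" "0 \<in> B" "A \<times> B \<subseteq> T"
    using open_prod_elim[OF assms] by (metis mem_Sigma_iff)
  obtain r s where "r > 0" "ball 0 r \<subseteq> A" "s > 0" "ball 0 s \<subseteq> B"
    using AB openE by metis
  then have "min r s > 0" "bidisc (min r s) \<subseteq> A \<times> B"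
    by (auto simp: bidisc_def subset_iff)
  with AB(5) have "min r s > 0" "bidisc (min r s) \<subseteq> T"
    by blast+
  then show ?thesis by (rule that)
qed

lemma (in frame) chart_homeomorphism:
  assumes S: "finite S" and N: "open N" "chart S (0, 0) \<in> N"
  obtains r V where "r > 0" "open V" "V \<subseteq> N" "bidisc r \<subseteq> chart_domain S"
    "homeomorphism (bidisc r) (V \<inter> blowup S) (chart S) (chart_inv S)"
proof -
  have b0: "(0, 0) \<in> chart_domain S"
    by (simp add: chart_domain_def fst_chart b_pt)
  have "open (chart_domain S \<inter> chart S -` N)"
    using continuous_on_open_vimage[OF open_chart_domain[OF S]] continuous_on_chart N(1)
      by (metis Int_commute)
  then obtain r where r: "r > 0" "bidisc r \<subseteq> chart_domain S \<inter> chart S -` N"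
    using open_contains_bidisc b0 N(2) by (metis IntI vimage_eq)
  define V where "V = N \<inter> (chart_inv S -` bidisc r \<inter> chart_open S)"
  have "open (chart_inv S -` bidisc r \<inter> chart_open S)"
    using continuous_on_open_vimage[OF open_chart_open[OF S]] continuous_on_chart_inv
      bidisc_props(2)[OF r(1)] by metis
  then have "open V"
    unfolding V_def using N(1) by (rule open_Int[rotated])
  have h: "homeomorphism (bidisc r) (V \<inter> blowup S) (chart S) (chart_inv S)"
  proof (rule homeomorphismI)
    show "continuous_on (bidisc r) (chart S)"
      using continuous_on_chart by (rule continuous_on_subset) (use r in blast)
    show "continuous_on (V \<inter> blowup S) (chart_inv S)"
      using continuous_on_chart_inv by (rule continuous_on_subset) (auto simp: V_def)
    show "chart S ` bidisc r \<subseteq> V \<inter> blowup S"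
      using r(2) chart_in_blowup[of _ S] chart_in_open[of _ S] by (auto simp: V_def chart_inv_chart)
    show "chart_inv S ` (V \<inter> blowup S) \<subseteq> bidisc r"
      by (auto simp: V_def)
    show "chart_inv S (chart S w) = w" for w by (rule chart_inv_chart)
    show "chart S (chart_inv S z) = z" if "z \<in> V \<inter> blowup S" for z
      using that chart_chart_inv(1)[of z S] by (auto simp: V_def)
  qed
  show ?thesis
    using r(2) by (intro that[OF r(1) \<open>open V\<close> _ _ h]) (auto simp: V_def)
qed

lemma blowup_chart:
  assumes S: "finite S" and z: "z \<in> strict S c" and N: "open N" "z \<in> N"
  obtains r V \<phi> \<psi> where "r > 0" "open V" "V \<subseteq> N" "\<phi> (0, 0) = z"
    "homeomorphism (bidisc r) (V \<inter> blowup S) \<phi> \<psi>"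
    "\<And>w. w \<in> bidisc r \<Longrightarrow> \<phi> w \<in> strict S c \<longleftrightarrow> snd w = 0"
    "\<And>w. w \<in> bidisc r \<Longrightarrow> fst (\<phi> w) = fst z \<longleftrightarrow> fst w = 0 \<and> (fst z \<in> S \<or> snd w = 0)"
proof -
  have "fst z \<in> line c" using z by (simp add: strict_def)
  then obtain e0 e1 e2 where fr: "frame e0 e1 e2" and b: "frame.b e0 = fst z" and c: "frame.c e0 e1 = c"
    by (rule exists_frame)
  interpret frame e0 e1 e2 by (rule fr)
  have dom: "(0, 0) \<in> chart_domain S"
    by (simp add: chart_domain_def fst_chart b_pt)
  have "chart S (0, 0) \<in> strict S c"
    using chart_in_strict_iff[OF dom] c by simp
  moreover have "fst (chart S (0, 0)) = fst z"
    unfolding b[symmetric] fst_chart_eq_b by simp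
  \<comment> \<open>Both points lie on \<open>strict S c\<close> over the same point, and the
    projection is injective there.\<close>
  ultimately have z0: "chart S (0, 0) = z"
    using strict_eq_line_lift z by metis
  obtain r V where "r > 0" "open V" "V \<subseteq> N" and dom: "bidisc r \<subseteq> chart_domain S"
    and h: "homeomorphism (bidisc r) (V \<inter> blowup S) (chart S) (chart_inv S)"
    using chart_homeomorphism[OF S N(1)] N(2) z0 by metis
  then show ?thesis
    using z0 dom chart_in_strict_iff[of _ S] fst_chart_eq_b[of S] unfolding b c
    by (intro that[of r V "chart S" "chart_inv S"]) blast+
qed

lemma closed_snd_apply: "closed {z::blowup_point. snd z p = a}"
proof -
  have "closed ((\<lambda>z::blowup_point. snd z p) -` {a})"
    using continuous_on_snd_apply[OF continuous_on_id] by (intro closed_vimage) simp_all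
  then show ?thesis by (simp add: vimage_def)
qed

lemma strict_eq_closed: "\<exists>C. closed C \<and> strict S c = blowup S \<inter> C"
proof (intro exI conjI)
  let ?C = "fst -` line c \<inter> (\<Inter>p\<in>S \<inter> line c. {z::blowup_point. snd z p = c})"
  show "closed ?C"
    by (intro closed_Int closed_vimage_fst closed_line closed_INT ballI closed_snd_apply)
  show "strict S c = blowup S \<inter> ?C"
    by (auto simp: strict_def)
qed

text \<open>\<open>strict S c\<close> is closed in the blow-up. Conversely, in a chart at
  \<open>z\<close> it is the axis y = 0, whose points other than the origin lie over points of the
  line different from \<open>fst z\<close>, arbitrarily close to \<open>z\<close>.\<close>

lemma strict_transform_line:
  assumes "finite S"
  shows "strict_transform S (line c) = strict S c"
proof
  let ?T = "{z \<in> blowup S. fst z \<in> line c - S}"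
  obtain C where C: "closed C" "strict S c = blowup S \<inter> C"
    using strict_eq_closed by blast
  have "?T \<subseteq> C"
    using C(2) strict_if_notin by auto
  then have "closure ?T \<subseteq> C"
    using C(1) by (rule closure_minimal)
  then show "strict_transform S (line c) \<subseteq> strict S c"
    unfolding strict_transform_def C(2) by blast
  show "strict S c \<subseteq> strict_transform S (line c)"
  proof
    fix z assume z: "z \<in> strict S c"
    have "z \<in> closure ?T"
      unfolding closure_iff_nhds_not_empty
    proof (intro allI impI)
      fix A N assume N: "N \<subseteq> A" "open N" "z \<in> N"
      \<comment> \<open>Centres other than \<open>fst z\<close> are kept away, so that the nearby
        point found below lies over no centre.\<close>
      define N' where "N' = N \<inter> fst -` (- (S - {fst z}))"
      have N': "open N'" "z \<in> N'"
        using N assms unfolding N'_def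
          by (auto intro!: open_Int open_vimage_fst open_Compl finite_imp_closed simp del: Compl_Diff_eq)
      obtain r V \<phi> \<psi> where r: "r > 0" and V: "V \<subseteq> N'"
          and h: "homeomorphism (bidisc r) (V \<inter> blowup S) \<phi> \<psi>"
        and st: "\<And>w. w \<in> bidisc r \<Longrightarrow> \<phi> w \<in> strict S c \<longleftrightarrow> snd w = 0"
        and ex: "\<And>w. w \<in> bidisc r \<Longrightarrow> fst (\<phi> w) = fst z \<longleftrightarrow> fst w = 0 \<and> (fst z \<in> S \<or> snd w = 0)"
        using blowup_chart[OF assms z N'] by metis
      define w where "w = (complex_of_real (r / 2), 0::complex)"
      have w: "w \<in> bidisc r" "fst w \<noteq> 0" "snd w = 0"
        using r by (auto simp: w_def bidisc_def)
      have "\<phi> w \<in> V \<inter> blowup S"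
        using h w(1) unfolding homeomorphism_def by blast
      moreover have "fst (\<phi> w) \<in> line c"
        using st[OF w(1)] w(3) by (auto simp: strict_def)
      moreover have "fst (\<phi> w) \<noteq> fst z"
        using ex[OF w(1)] w(2) by blast
      ultimately have "\<phi> w \<in> A \<inter> ?T"
        using V N(1) unfolding N'_def by auto
      then show "?T \<inter> A \<noteq> {}"
        by blast
    qed
    then show "z \<in> strict_transform S (line c)"
      using z unfolding strict_transform_def strict_def by blast
  qed
qed


section \<open>Surfaces of LAC data\<close>

text \<open>A kept strict transform amounts to an absent line, so besides the lines and centres only
  the set \<open>K\<close> of centres with kept exceptional curve is recorded.\<close>

definition surface :: "cp2 set set \<Rightarrow> cp2 set \<Rightarrow> cp2 set \<Rightarrow> blowup_point set" where
  "surface \<A> S K = LAC_surface \<A> S (Inr ` K)"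

lemma mem_surface_iff:
  assumes "finite S" "\<A> \<subseteq> range line"
  shows "z \<in> surface \<A> S K \<longleftrightarrow> z \<in> blowup S \<and> (\<forall>c. line c \<in> \<A> \<longrightarrow> z \<notin> strict S c) \<and> fst z \<notin> S - K"
proof -
  have "z \<in> surface \<A> S K \<longleftrightarrow> z \<in> blowup S \<and> (\<forall>L\<in>\<A>. z \<notin> strict_transform S L) \<and>
      (\<forall>p\<in>S - K. z \<notin> exceptional S p)"
    unfolding surface_def LAC_surface_def by force
  moreover have "(\<forall>L\<in>\<A>. z \<notin> strict_transform S L) \<longleftrightarrow> (\<forall>c. line c \<in> \<A> \<longrightarrow> z \<notin> strict S c)"
    using assms strict_transform_line by (metis imageE subsetD)
  ultimately show ?thesis
    unfolding exceptional_def by auto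
qed

lemma surface_eq_open:
  assumes "finite S" "finite \<A>" "\<A> \<subseteq> range line"
  shows "\<exists>G. open G \<and> surface \<A> S K = blowup S \<inter> G"
proof -
  obtain C where C: "\<And>c. closed (C c) \<and> strict S c = blowup S \<inter> C c"
    using strict_eq_closed by metis
  obtain F where F: "finite F" "\<A> = line ` F"
    using assms(2,3) finite_subset_image by metis
  let ?G = "- (\<Union>c\<in>F. C c) \<inter> fst -` (- (S - K))"
  have "open ?G"
    using assms(1) F(1) C
      by (intro open_Int open_Compl closed_UN open_vimage_fst finite_imp_closed) simp_all
  moreover have "z \<in> surface \<A> S K \<longleftrightarrow> z \<in> blowup S \<inter> ?G" for z
  proof -
    have "line c \<in> \<A> \<longleftrightarrow> c \<in> F" for c
      using F(2) line_eq_iff by auto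
    then show ?thesis
      unfolding mem_surface_iff[OF assms(1,3)] using C by blast
  qed
  ultimately show ?thesis by blast
qed

section \<open>Loops and divisor complements in charts\<close>

lemma loops_vanish_homeomorphic_image:
  fixes D :: "'c::real_normed_vector set"
  assumes h: "homeomorphism D W \<phi> \<psi>" and M: "M \<subseteq> D" "simply_connected M"
    and f: "continuous_on (\<phi> ` M) f" "f ` \<phi> ` M \<subseteq> Y"
  shows "loops_vanish Y f (\<phi> ` M)"
proof (rule loops_vanish_simply_connected[OF M(2), where g = "f \<circ> \<phi>"])
  have \<phi>: "continuous_on M \<phi>"
    using homeomorphism_cont1[OF h] M(1) by (rule continuous_on_subset)
  show "continuous_on M (f \<circ> \<phi>)"
    using \<phi> f(1) by (rule continuous_on_compose)
  show "(f \<circ> \<phi>) ` M \<subseteq> Y"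
    using f(2) by (simp add: image_comp)
  have W: "\<phi> ` M \<subseteq> W"
    using homeomorphism_image1[OF h] M(1) by blast
  have \<psi>: "continuous_on W \<psi>"
    by (rule homeomorphism_cont2[OF h])
  have inv: "\<psi> (\<phi> w) = w" if "w \<in> M" for w
    using homeomorphism_apply1[OF h] M(1) that by blast
  fix p assume p: "path p" "path_image p \<subseteq> \<phi> ` M" "pathfinish p = pathstart p"
  have "path (\<psi> \<circ> p)"
    using p(1) by (rule path_continuous_image) (use \<psi> p(2) W in \<open>auto intro: continuous_on_subset\<close>)
  moreover have "path_image (\<psi> \<circ> p) \<subseteq> M"
    using p(2) inv unfolding path_image_compose by auto
  moreover have "\<forall>t\<in>{0..1}. f (p t) = (f \<circ> \<phi>) ((\<psi> \<circ> p) t)"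
  proof
    fix t :: real assume "t \<in> {0..1}"
    then have "p t \<in> \<phi> ` M" using p(2) unfolding path_image_def by blast
    then show "f (p t) = (f \<circ> \<phi>) ((\<psi> \<circ> p) t)" using inv by auto
  qed
  ultimately show "\<exists>q. path q \<and> path_image q \<subseteq> M \<and> pathfinish q = pathstart q \<and>
      (\<forall>t\<in>{0..1}. f (p t) = (f \<circ> \<phi>) (q t))"
    using p(3) by (intro exI[of _ "\<psi> \<circ> p"]) (simp add: pathstart_compose pathfinish_compose)
qed

lemma homeomorphic_image_Int:
  assumes h: "homeomorphism D W \<phi> \<psi>" and P: "\<And>w. w \<in> D \<Longrightarrow> \<phi> w \<in> U \<longleftrightarrow> w \<notin> B"
  shows "W \<inter> U = \<phi> ` (D - B)"
proof -
  have "W = \<phi> ` D" using homeomorphism_image1[OF h] by simp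
  then show ?thesis using P by auto
qed

lemma path_connected_homeomorphic_image:
  assumes "homeomorphism D W \<phi> \<psi>" "M \<subseteq> D" "path_connected M"
  shows "path_connected (\<phi> ` M)"
  using assms unfolding homeomorphism_def
  by (intro path_connected_continuous_image) (auto intro: continuous_on_subset)

text \<open>In the last alternative the fibre over \<open>fst z\<close> is removed: a curve if
  \<open>fst z\<close> is a centre, otherwise the single point \<open>z\<close>.\<close>

definition divisor_complement ::
    "cp2 set \<Rightarrow> blowup_point set \<Rightarrow> blowup_point set \<Rightarrow> blowup_point \<Rightarrow> blowup_point set \<Rightarrow> bool" where
  "divisor_complement S X U z N \<longleftrightarrow> X \<inter> N \<subseteq> U \<or>
    (\<exists>c. z \<in> strict S c \<and> (\<forall>z'\<in>X \<inter> N. z' \<in> U \<longleftrightarrow> z' \<notin> strict S c)) \<or>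
    (\<forall>z'\<in>X \<inter> N. z' \<in> U \<longleftrightarrow> fst z' \<noteq> fst z)"

text \<open>In a chart the removed set is empty, an axis or the origin. Its real codimension is at
  least two, so the rest of the bidisc stays path-connected.\<close>

lemma tame_pair_blowup:
  assumes S: "finite S" and X: "X = blowup S \<inter> G" "open G" and UX: "U \<subseteq> X"
    and loc: "\<And>z. z \<in> X \<Longrightarrow> \<exists>N. open N \<and> z \<in> N \<and> divisor_complement S X U z N"
  shows "tame_pair X U"
  unfolding tame_pair_def
proof (intro conjI ballI allI impI UX)
  fix z N0 assume z: "z \<in> X" and N0: "open N0" "z \<in> N0"
  obtain N where N: "open N" "z \<in> N" and cases: "X \<inter> N \<subseteq> U \<or>
      (\<exists>c. z \<in> strict S c \<and> (\<forall>z'\<in>X \<inter> N. z' \<in> U \<longleftrightarrow> z' \<notin> strict S c)) \<or>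
      (\<forall>z'\<in>X \<inter> N. z' \<in> U \<longleftrightarrow> fst z' \<noteq> fst z)"
    using loc[OF z] unfolding divisor_complement_def by blast
  \<comment> \<open>One line \<open>c\<close> through \<open>z\<close> is fixed to get a chart: the
    removed line in the second case, an arbitrary one otherwise.\<close>
  have "\<exists>c. z \<in> strict S c \<and> (X \<inter> N \<subseteq> U \<or> (\<forall>z'\<in>X \<inter> N. z' \<in> U \<longleftrightarrow> z' \<notin> strict S c) \<or>
      (\<forall>z'\<in>X \<inter> N. z' \<in> U \<longleftrightarrow> fst z' \<noteq> fst z))"
    using cases exists_line_strict[of z S] z X(1) by blast
  then obtain c where c: "z \<in> strict S c" and cases: "X \<inter> N \<subseteq> U \<or>
      (\<forall>z'\<in>X \<inter> N. z' \<in> U \<longleftrightarrow> z' \<notin> strict S c) \<or> (\<forall>z'\<in>X \<inter> N. z' \<in> U \<longleftrightarrow> fst z' \<noteq> fst z)"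
    by blast
  have NG: "open (N0 \<inter> N \<inter> G)" "z \<in> N0 \<inter> N \<inter> G"
    using N N0 X z by auto
  obtain r V \<phi> \<psi> where r: "r > 0" and V: "open V" "V \<subseteq> N0 \<inter> N \<inter> G" and z0: "\<phi> (0, 0) = z"
    and h: "homeomorphism (bidisc r) (V \<inter> blowup S) \<phi> \<psi>"
    and st: "\<And>w. w \<in> bidisc r \<Longrightarrow> \<phi> w \<in> strict S c \<longleftrightarrow> snd w = 0"
    and ex: "\<And>w. w \<in> bidisc r \<Longrightarrow> fst (\<phi> w) = fst z \<longleftrightarrow> fst w = 0 \<and> (fst z \<in> S \<or> snd w = 0)"
    using blowup_chart[OF S c NG] by metis
  note b = bidisc_props[OF r]
  have VX: "V \<inter> X = V \<inter> blowup S"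
    using V(2) X(1) by blast
  then have im: "V \<inter> X = \<phi> ` bidisc r"
    using homeomorphism_image1[OF h] by simp
  have XN: "\<phi> w \<in> X \<inter> N" if "w \<in> bidisc r" for w
    using im V(2) that by blast
  have VU: "V \<inter> U = (V \<inter> blowup S) \<inter> U"
    using VX UX by blast
  have "path_connected (V \<inter> X)"
    unfolding im by (rule path_connected_homeomorphic_image[OF h order_refl b(4)])
  moreover have "loops_vanish X id (V \<inter> X)"
    unfolding im using im by (intro loops_vanish_homeomorphic_image[OF h order_refl b(5)]) auto
  moreover have "path_connected (V \<inter> U) \<and> V \<inter> U \<noteq> {}"
  proof -
    have *: "path_connected (V \<inter> U) \<and> V \<inter> U \<noteq> {}"
      if B: "path_connected (bidisc r - B)" "bidisc r - B \<noteq> {}"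
        and P: "\<And>w. w \<in> bidisc r \<Longrightarrow> \<phi> w \<in> U \<longleftrightarrow> w \<notin> B" for B
    proof -
      have "V \<inter> U = \<phi> ` (bidisc r - B)"
        unfolding VU using h P by (rule homeomorphic_image_Int)
      then show ?thesis
        using path_connected_homeomorphic_image[OF h _ B(1)] B(2) by auto
    qed
    from cases consider "X \<inter> N \<subseteq> U" | "\<forall>z'\<in>X \<inter> N. z' \<in> U \<longleftrightarrow> z' \<notin> strict S c"
      | "\<forall>z'\<in>X \<inter> N. z' \<in> U \<longleftrightarrow> fst z' \<noteq> fst z" by blast
    then show ?thesis
    proof cases
      case 1
      show ?thesis
        by (rule *[of "{}"]) (use 1 XN b in auto)
    next
      case 2
      show ?thesis
        by (rule *[of "{w. snd w = 0}"]) (use 2 XN st b in auto)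
    next
      case 3
      show ?thesis
      proof (cases "fst z \<in> S")
        case True
        show ?thesis
          by (rule *[of "{w. fst w = 0}"]) (use 3 XN ex b True in auto)
      next
        case False
        have ne: "bidisc r - {(0, 0)} \<noteq> {}"
          using b(10) by auto
        show ?thesis
          by (rule *[of "{(0, 0)}"]) (use 3 XN ex b(8) ne False in auto)
      qed
    qed
  qed
  ultimately show "\<exists>V. open V \<and> z \<in> V \<and> V \<subseteq> N0 \<and> path_connected (V \<inter> X) \<and> loops_vanish X id (V \<inter> X) \<and>
      path_connected (V \<inter> U) \<and> V \<inter> U \<noteq> {}"
    using V im z0 b(3) by (intro exI[of _ V]) auto
qed

section \<open>Connectedness of the surfaces\<close>

definition arrangement_points :: "cp2 set set \<Rightarrow> cp2 \<Rightarrow> cp2 set" where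
  "arrangement_points \<A> c = (\<Union>L\<in>\<A>. L \<inter> line c)"

lemma finite_arrangement_points:
  assumes "finite \<A>" "\<A> \<subseteq> range line" "line c \<notin> \<A>"
  shows "finite (arrangement_points \<A> c)"
  unfolding arrangement_points_def
proof (intro finite_UN_I assms(1))
  fix L assume "L \<in> \<A>"
  then obtain a where a: "L = line a" "a \<noteq> c"
    using assms(2,3) by auto
  show "finite (L \<inter> line c)"
  proof (cases "L \<inter> line c = {}")
    case False
    then obtain x where "x \<in> L \<inter> line c" by blast
    then have "L \<inter> line c \<subseteq> {x}"
      using lines_meet_once[of a c _ x] a by blast
    then show ?thesis by (rule finite_subset) simp
  qed simp
qed

context
  fixes \<A> :: "cp2 set set" and S K :: "cp2 set"
  assumes fin: "finite \<A>" "\<A> \<subseteq> range line" "finite S"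
begin

private lemmas mem = mem_surface_iff[OF fin(3,2)]

lemma line_lift_in_surface:
  assumes "x \<in> line c" "x \<notin> arrangement_points \<A> c" "x \<notin> S - K"
  shows "line_lift S c x \<in> surface \<A> S K"
proof -
  have "line_lift S c x \<in> blowup S"
    using line_lift_in_strict[OF assms(1)] by (auto simp: strict_def)
  moreover have "line_lift S c x \<notin> strict S a" if "line a \<in> \<A>" for a
    using that assms(1,2) by (auto simp: strict_def arrangement_points_def)
  ultimately show ?thesis
    using assms(3) by (simp add: mem)
qed

text \<open>Without its point at infinity the line is parametrized by the complex numbers, and these
  stay path-connected after finitely many are deleted. The frame puts \<open>x\<close> and
  \<open>y\<close> at the parameters 0 and 1.\<close>

lemma path_component_line_lift:
  assumes c: "line c \<notin> \<A>" and x: "x \<in> line c" "line_lift S c x \<in> surface \<A> S K"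
    and y: "y \<in> line c" "line_lift S c y \<in> surface \<A> S K"
  shows "path_component (surface \<A> S K \<inter> strict S c) (line_lift S c x) (line_lift S c y)"
proof (cases "x = y")
  case True
  then show ?thesis
    using x line_lift_in_strict by (simp add: path_component_refl)
next
  case False
  then obtain e0 e1 e2 where fr: "frame e0 e1 e2"
      and e: "frame.pt e0 e1 e2 0 0 = x" "frame.pt e0 e1 e2 1 0 = y"
    "frame.c e0 e1 = line_through x y"
    by (rule exists_frame_through)
  interpret frame e0 e1 e2 by (rule fr)
  have c': "frame.c e0 e1 = c"
    using e(3) eq_line_through[OF False x(1) y(1)] by simp
  have ptc: "pt t 0 \<in> line c" for t
    using pt_in_c c' by simp
  define m where "m t = line_lift S c (pt t 0)" for t
  define F where "F = {t. m t \<notin> surface \<A> S K}"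
  have "F \<subseteq> (\<lambda>t. pt t 0) -` (S \<union> arrangement_points \<A> c)"
    using line_lift_in_surface[OF ptc] unfolding F_def m_def by blast
  moreover have "finite ((\<lambda>t. pt t 0) -` (S \<union> arrangement_points \<A> c))"
    using fin finite_arrangement_points[OF fin(1,2) c]
      by (intro finite_vimageI) (simp_all add: inj_def pt_eq_iff)
  ultimately have "finite F"
    by (rule finite_subset)
  then have "path_connected (UNIV - F)"
    by (intro path_connected_open_diff_countable) (simp_all add: uncountable_infinite
      countable_finite connected_UNIV)
  moreover have "continuous_on (UNIV - F) m"
  proof -
    have "continuous_on T (\<lambda>t. if p \<in> line c then c else line_through p (pt t 0))" for T p
      using ptc by (cases "p \<in> line c") (auto intro!: continuous_on_line_through_compose
        continuous_on_pt continuous_intros)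
    then show ?thesis
      unfolding m_def line_lift_def
          by (intro continuous_on_Pair continuous_on_restrict continuous_on_pt continuous_intros)
  qed
  ultimately have pc: "path_connected (m ` (UNIV - F))"
    by (rule path_connected_continuous_image[rotated])
  have sub: "m ` (UNIV - F) \<subseteq> surface \<A> S K \<inter> strict S c"
    using line_lift_in_strict[OF ptc] unfolding F_def m_def by auto
  have "0 \<in> UNIV - F" "1 \<in> UNIV - F"
    using x(2) y(2) e unfolding F_def m_def by simp_all
  then have "path_component (m ` (UNIV - F)) (m 0) (m 1)"
    using pc unfolding path_connected_component by blast
  then show ?thesis
    using path_component_of_subset[OF sub] e unfolding m_def by simp
qed

text \<open>A point moves along the strict transform of a line through it to a generic point; two
  generic points are joined along their common line. None of these lines is in the arrangement,
  since their strict transforms contain points of the surface.\<close>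

lemma surface_path_connected: "path_connected (surface \<A> S K)"
  unfolding path_connected_component
proof (intro ballI)
  have gen: "\<exists>c b. z \<in> strict S c \<and> line c \<notin> \<A> \<and> b \<in> line c \<and> b \<notin> T \<and> b \<notin> \<Union>\<A> \<and> b \<notin> S"
    if z: "z \<in> surface \<A> S K" and T: "finite T" for z T
  proof -
    obtain c where c: "z \<in> strict S c"
      using exists_line_strict z mem by blast
    then have c': "line c \<notin> \<A>"
      using z mem by blast
    have "finite (T \<union> S \<union> arrangement_points \<A> c)"
      using T fin(3) finite_arrangement_points[OF fin(1,2) c'] by simp
    then obtain b where "b \<in> line c" "b \<notin> T \<union> S \<union> arrangement_points \<A> c"
      using infinite_line[of c] by (meson finite_subset subsetI)
    then show ?thesis
      using c c' by (auto simp: arrangement_points_def)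
  qed
  have to_gen: "path_component (surface \<A> S K) z (line_lift S c b)"
    if z: "z \<in> surface \<A> S K" "z \<in> strict S c" "line c \<notin> \<A>" and b: "b \<in> line c" "b \<notin> \<Union>\<A>" "b \<notin> S"
        for z c b
  proof -
    have "line_lift S c b \<in> surface \<A> S K"
      using b by (intro line_lift_in_surface) (auto simp: arrangement_points_def)
    moreover have "z = line_lift S c (fst z)" "fst z \<in> line c"
      using strict_eq_line_lift[OF z(2)] z(2) by (auto simp: strict_def)
    ultimately have "path_component (surface \<A> S K \<inter> strict S c) z (line_lift S c b)"
      using path_component_line_lift[OF z(3), of "fst z" b] z(1) b(1) by simp
    then show ?thesis
      using path_component_of_subset[of "surface \<A> S K \<inter> strict S c"] by blast
  qed
  fix z1 z2 assume z1: "z1 \<in> surface \<A> S K" and z2: "z2 \<in> surface \<A> S K"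
  obtain c1 b1 where 1: "z1 \<in> strict S c1" "line c1 \<notin> \<A>" "b1 \<in> line c1" "b1 \<notin> \<Union>\<A>" "b1 \<notin> S"
    using gen[OF z1, of "{}"] by blast
  obtain c2 b2 where 2: "z2 \<in> strict S c2" "line c2 \<notin> \<A>" "b2 \<in> line c2" "b2 \<notin> {b1}" "b2 \<notin> \<Union>\<A>" "b2 \<notin> S"
    using gen[OF z2, of "{b1}"] by blast
  let ?c = "line_through b1 b2"
  have bc: "b1 \<in> line ?c" "b2 \<in> line ?c"
    using mem_line_through[of b1 b2] 2(4) by auto
  have c: "line ?c \<notin> \<A>"
    using bc(1) 1(4) by blast
  \<comment> \<open>Over a point that is no centre the lift does not depend on the line, so the
    three paths fit together.\<close>
  have eq: "line_lift S a b = line_lift S a' b" if "b \<notin> S" "b \<in> line a" "b \<in> line a'" for a a' b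
    using that line_lift_in_strict[of b a S] line_lift_in_strict[of b a' S] unfolding strict_def
    by (intro blowup_eqI[of _ S]) auto
  have "line_lift S ?c b1 \<in> surface \<A> S K"
    using bc(1) 1(4,5) by (intro line_lift_in_surface) (auto simp: arrangement_points_def)
  moreover have "line_lift S ?c b1 \<in> strict S ?c"
    using bc(1) by (rule line_lift_in_strict)
  ultimately have "path_component (surface \<A> S K) (line_lift S ?c b1) (line_lift S ?c b2)"
    using c bc(2) 2(5,6) by (rule to_gen)
  moreover have "path_component (surface \<A> S K) z1 (line_lift S ?c b1)"
    using to_gen[OF z1 1] eq[OF 1(5,3) bc(1)] by simp
  moreover have "path_component (surface \<A> S K) z2 (line_lift S ?c b2)"
    using to_gen[OF z2 2(1,2,3,5,6)] eq[OF 2(6,3) bc(2)] by simp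
  ultimately show "path_component (surface \<A> S K) z1 z2"
    using path_component_sym path_component_trans by metis
qed

lemma exists_generic_point: "\<exists>b. b \<notin> \<Union>\<A> \<and> b \<notin> S"
proof -
  have "finite {a. line a \<in> \<A>}"
    using finite_vimageI[OF fin(1), of line] line_eq_iff by (simp add: inj_def vimage_def)
  then obtain c where "line c \<notin> \<A>"
    using infinite_line by (metis (mono_tags) finite_subset mem_Collect_eq subsetI)
  moreover from this have "finite (S \<union> arrangement_points \<A> c)"
    using fin finite_arrangement_points by simp
  ultimately show ?thesis
    using infinite_line[of c] finite_subset[of "line c" "S \<union> arrangement_points \<A> c"]
    by (auto simp: arrangement_points_def)
qed

lemma exists_point_off_centers: "\<exists>z\<in>surface \<A> S K. fst z \<notin> S"
proof -
  obtain b where b: "b \<notin> \<Union>\<A>" "b \<notin> S"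
    using exists_generic_point by blast
  obtain a where a: "b \<in> line a"
    using exists_line by blast
  have "line_lift S a b \<in> surface \<A> S K"
    using a b by (intro line_lift_in_surface) (auto simp: arrangement_points_def)
  then show ?thesis using b by force
qed

end

lemma loops_vanish_compose:
  assumes "loops_vanish Y f W'" "continuous_on W h" "h ` W \<subseteq> W'"
  shows "loops_vanish Y (f \<circ> h) W"
  unfolding loops_vanish_def
proof (intro allI impI)
  fix p assume p: "path p" "path_image p \<subseteq> W" "pathfinish p = pathstart p"
  have "path (h \<circ> p)"
    using p(1) by (rule path_continuous_image) (rule continuous_on_subset[OF assms(2) p(2)])
  moreover have "path_image (h \<circ> p) \<subseteq> W'"
    using p(2) assms(3) unfolding path_image_compose by blast
  moreover have "pathfinish (h \<circ> p) = pathstart (h \<circ> p)"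
    using p(3) by (simp add: pathfinish_compose pathstart_compose)
  ultimately have "\<exists>a. homotopic_loops Y (f \<circ> (h \<circ> p)) (\<lambda>_. a)"
    using assms(1) unfolding loops_vanish_def by blast
  then show "\<exists>a. homotopic_loops Y (f \<circ> h \<circ> p) (\<lambda>_. a)"
    by (simp only: comp_assoc)
qed

lemma exists_vanishing_neighborhood:
  assumes S: "finite S" and z: "z \<in> blowup S" and N: "open N" "z \<in> N"
    and f: "continuous_on (N \<inter> blowup S) f" "f ` (N \<inter> blowup S) \<subseteq> Y"
  shows "\<exists>V. open V \<and> z \<in> V \<and> V \<subseteq> N \<and> loops_vanish Y f (V \<inter> blowup S)"
proof -
  obtain c where c: "z \<in> strict S c"
    using exists_line_strict[OF z] by blast
  obtain r V \<phi> \<psi> where r: "r > 0" and V: "open V" "V \<subseteq> N" and z0: "\<phi> (0, 0) = z"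
    and h: "homeomorphism (bidisc r) (V \<inter> blowup S) \<phi> \<psi>"
    using blowup_chart[OF S c N] by metis
  have im: "V \<inter> blowup S = \<phi> ` bidisc r"
    using homeomorphism_image1[OF h] by simp
  have "loops_vanish Y f (\<phi> ` bidisc r)"
    using f V(2) im
    by (intro loops_vanish_homeomorphic_image[OF h order_refl bidisc_props(5)[OF r]])
      (auto intro: continuous_on_subset simp flip: im)
  moreover have "z \<in> V"
    using im z0 bidisc_props(3)[OF r] by auto
  ultimately show ?thesis
    using V im by (intro exI[of _ V]) simp
qed


section \<open>Removing a point from the centre of the blow-up\<close>

text \<open>Forgets the directions outside \<open>S\<close>, which is the set of centres after the
  removal.\<close>

definition blow_down :: "cp2 set \<Rightarrow> blowup_point \<Rightarrow> blowup_point" where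
  "blow_down S z = (fst z, \<lambda>q\<in>S. snd z q)"

text \<open>Here \<open>S\<close> contains \<open>p\<close>. Over \<open>p\<close> itself the value
  is meaningless: this is where the comparison map breaks down.\<close>

definition blow_up_at :: "cp2 set \<Rightarrow> cp2 \<Rightarrow> blowup_point \<Rightarrow> blowup_point" where
  "blow_up_at S p z = (fst z, \<lambda>q\<in>S. if q = p then line_through p (fst z) else snd z q)"

lemma fst_blow [simp]: "fst (blow_down S z) = fst z" "fst (blow_up_at S p z) = fst z"
  by (simp_all add: blow_down_def blow_up_at_def)

lemma continuous_on_blow_down: "continuous_on T (blow_down S)"
  unfolding blow_down_def
  by (intro continuous_on_Pair continuous_on_fst continuous_on_id continuous_on_restrict
    continuous_on_snd_apply)

lemma continuous_on_blow_up_at: "continuous_on {z. fst z \<noteq> p} (blow_up_at S p)"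
  unfolding blow_up_at_def
proof (intro continuous_on_Pair continuous_on_fst continuous_on_id continuous_on_restrict)
  fix q
  show "continuous_on {z. fst z \<noteq> p} (\<lambda>z. if q = p then line_through p (fst z) else snd z q)"
    by (cases "q = p")
      (auto intro!: continuous_on_line_through_compose continuous_on_fst continuous_on_snd_apply
          continuous_on_id)
qed

lemma blow_down_in_blowup: "z \<in> blowup S \<Longrightarrow> blow_down (S - {p}) z \<in> blowup (S - {p})"
  by (simp add: mem_blowup_iff blow_down_def)

lemma blow_up_at_in_blowup: "z \<in> blowup (S - {p}) \<Longrightarrow> fst z \<noteq> p \<Longrightarrow> blow_up_at S p z \<in> blowup S"
  using mem_line_through[of p "fst z"] by (auto simp: mem_blowup_iff blow_up_at_def)

lemma blow_up_down:
  assumes "z \<in> blowup S" "fst z \<noteq> p"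
  shows "blow_up_at S p (blow_down (S - {p}) z) = z"
  using assms
  by (intro blowup_eqI[of _ S] blow_up_at_in_blowup blow_down_in_blowup)
    (auto simp: blow_up_at_def blow_down_def)

lemma blow_down_up:
  assumes "z \<in> blowup (S - {p})" "fst z \<noteq> p"
  shows "blow_down (S - {p}) (blow_up_at S p z) = z"
  using assms
  by (intro blowup_eqI[of _ "S - {p}"] blow_down_in_blowup blow_up_at_in_blowup)
    (auto simp: blow_up_at_def blow_down_def)

lemma blow_down_strict: "z \<in> strict S c \<Longrightarrow> blow_down (S - {p}) z \<in> strict (S - {p}) c"
  using blow_down_in_blowup by (auto simp: strict_def blow_down_def)

lemma blow_down_strict_iff:
  assumes "z \<in> blowup S" "fst z \<noteq> p"
  shows "blow_down (S - {p}) z \<in> strict (S - {p}) c \<longleftrightarrow> z \<in> strict S c"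
proof
  assume *: "blow_down (S - {p}) z \<in> strict (S - {p}) c"
  then have zc: "fst z \<in> line c" by (simp add: strict_def)
  have "snd z q = c" if q: "q \<in> S" "q \<in> line c" for q
  proof (cases "q = p")
    case True
    then show ?thesis
      using blowup_snd[OF assms(1) q(1)] eq_line_through[of q "fst z" c] zc q(2) assms(2) by metis
  next
    case False
    then show ?thesis using * q by (auto simp: strict_def blow_down_def)
  qed
  then show "z \<in> strict S c"
    using assms(1) zc by (simp add: strict_def)
qed (rule blow_down_strict)

text \<open>Common setting for the three kinds of removal. \<open>\<A>'\<close> may be smaller than
  \<open>\<A>\<close>, so that a line can go together with the point; \<open>U'\<close> then also
  omits the strict transforms of the deleted lines and matches \<open>U\<close> under the
  blow-down.\<close>

locale point_removal =
  fixes \<A> \<A>' :: "cp2 set set" and S K :: "cp2 set" and p :: cp2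
  assumes fin: "finite \<A>" "\<A> \<subseteq> range line" "finite S" and sub: "\<A>' \<subseteq> \<A>" and p: "p \<in> S"
begin

abbreviation "S' \<equiv> S - {p}"
definition "X = surface \<A> S K"
definition "Y = surface \<A>' S' (K - {p})"
definition "U = {z \<in> X. fst z \<noteq> p}"
definition "U' = {z \<in> Y. fst z \<noteq> p \<and> (\<forall>a. line a \<in> \<A> - \<A>' \<longrightarrow> z \<notin> strict S' a)}"

abbreviation "vanish_X V \<equiv> loops_vanish X (blow_up_at S p) (V \<inter> U')"
abbreviation "vanish_Y V \<equiv> loops_vanish Y (blow_down S') (V \<inter> U)"

lemma fin': "finite \<A>'" "\<A>' \<subseteq> range line" "finite S'"
  using fin sub finite_subset by auto

lemmas mem_X = mem_surface_iff[OF fin(3,2), of _ K, folded X_def]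
lemmas mem_Y = mem_surface_iff[OF fin'(3,2), of _ "K - {p}", folded Y_def]

lemma blow_down_in_U'_iff:
  assumes "z \<in> blowup S" "fst z \<noteq> p"
  shows "blow_down S' z \<in> U' \<longleftrightarrow> z \<in> U"
  using assms sub by (auto simp: U_def U'_def mem_X mem_Y blow_down_in_blowup blow_down_strict_iff)

lemma U_blowup: "z \<in> U \<Longrightarrow> z \<in> blowup S \<and> fst z \<noteq> p"
  by (simp add: U_def mem_X)

lemma U'_blowup: "z \<in> U' \<Longrightarrow> z \<in> blowup S' \<and> fst z \<noteq> p"
  by (simp add: U'_def mem_Y)

lemma homeomorphism_U: "homeomorphism U U' (blow_down S') (blow_up_at S p)"
proof (rule homeomorphismI)
  show "continuous_on U (blow_down S')"
    by (rule continuous_on_blow_down)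
  show cg: "continuous_on U' (blow_up_at S p)"
    by (rule continuous_on_subset[OF continuous_on_blow_up_at]) (use U'_blowup in blast)
  show "blow_down S' ` U \<subseteq> U'"
    using blow_down_in_U'_iff U_blowup by blast
  show "blow_up_at S p ` U' \<subseteq> U"
  proof (rule image_subsetI)
    fix z assume z: "z \<in> U'"
    then have "blow_up_at S p z \<in> blowup S" "blow_down S' (blow_up_at S p z) = z"
      using U'_blowup blow_up_at_in_blowup blow_down_up by auto
    then show "blow_up_at S p z \<in> U"
      using blow_down_in_U'_iff[of "blow_up_at S p z"] z U'_blowup by simp
  qed
qed (use U_blowup U'_blowup blow_up_down blow_down_up in auto)

lemma open_X: "\<exists>G. open G \<and> X = blowup S \<inter> G"
  unfolding X_def using fin by (intro surface_eq_open)

lemma open_Y: "\<exists>G. open G \<and> Y = blowup S' \<inter> G"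
  unfolding Y_def using fin' by (intro surface_eq_open)

lemma open_fst_neq: "open {z::blowup_point. fst z \<noteq> p}"
proof -
  have "open (fst -` (- {p}) :: blowup_point set)"
    by (intro open_vimage_fst open_Compl closed_singleton)
  then show ?thesis by (simp add: vimage_def Compl_eq)
qed

lemma open_U: "\<exists>G. open G \<and> U = blowup S \<inter> G"
proof -
  obtain G where "open G" "X = blowup S \<inter> G"
    using open_X by blast
  then show ?thesis
    using open_fst_neq by (intro exI[of _ "G \<inter> {z. fst z \<noteq> p}"]) (auto simp: U_def)
qed

lemma open_U': "\<exists>G. open G \<and> U' = blowup S' \<inter> G"
proof -
  obtain G where G: "open G" "surface \<A> S' (K - {p}) = blowup S' \<inter> G"
    using surface_eq_open[OF fin'(3) fin(1,2)] by blast
  \<comment> \<open>\<open>U'\<close> is the surface of the full arrangement \<open>\<A>\<close>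
    without the fibre over \<open>p\<close>, so its openness in the blow-up follows from that of
    surfaces.\<close>
  have "z \<in> U' \<longleftrightarrow> z \<in> surface \<A> S' (K - {p}) \<and> fst z \<noteq> p" for z
    using sub unfolding U'_def mem_Y mem_surface_iff[OF fin'(3) fin(2)] by auto
  then show ?thesis
    using open_fst_neq G by (intro exI[of _ "G \<inter> {z. fst z \<noteq> p}"]) auto
qed

lemma tame_X: "tame_pair X U"
proof -
  obtain G where G: "open G" "X = blowup S \<inter> G"
    using open_X by blast
  show ?thesis
  proof (rule tame_pair_blowup[OF fin(3) G(2,1)])
    show "U \<subseteq> X" by (auto simp: U_def)
    fix z assume "z \<in> X"
    show "\<exists>N. open N \<and> z \<in> N \<and> divisor_complement S X U z N"
    proof (cases "fst z = p")
      case True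
      then have "divisor_complement S X U z UNIV"
        by (simp add: divisor_complement_def U_def)
      then show ?thesis by blast
    next
      case False
      have "divisor_complement S X U z {z. fst z \<noteq> p}"
        by (auto simp: divisor_complement_def U_def)
      then show ?thesis using False open_fst_neq by blast
    qed
  qed
qed

lemma U_nonempty: "U \<noteq> {}"
  using exists_point_off_centers[OF fin, of K] p unfolding U_def X_def by blast

text \<open>At points of \<open>U\<close> and \<open>U'\<close> the comparison map is defined on a
  whole neighbourhood with a simply connected chart. This leaves the added loci: the fibre over
  \<open>p\<close> in \<open>X\<close> and the complement of \<open>U'\<close> in
  \<open>Y\<close>.\<close>

lemma isomorphic_if:
  assumes tame_Y: "tame_pair Y U'"
    and X: "\<And>z. z \<in> X \<Longrightarrow> fst z = p \<Longrightarrow> \<exists>V. open V \<and> z \<in> V \<and> vanish_Y V"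
    and Y: "\<And>z. z \<in> Y \<Longrightarrow> z \<notin> U' \<Longrightarrow> \<exists>V. open V \<and> z \<in> V \<and> vanish_X V"
  shows "isomorphic_fundamental_groups X Y"
proof (rule isomorphic_fundamental_groupsI[OF tame_X _ tame_Y _ homeomorphism_U U_nonempty])
  show "path_connected X"
    unfolding X_def by (rule surface_path_connected[OF fin])
  show "path_connected Y"
    unfolding Y_def by (rule surface_path_connected[OF fin'])
  have UY: "blow_down S' ` U \<subseteq> Y" and UX: "blow_up_at S p ` U' \<subseteq> X"
    using homeomorphism_image1[OF homeomorphism_U] homeomorphism_image2[OF homeomorphism_U]
    by (auto simp: U_def U'_def)
  show "\<exists>V. open V \<and> z \<in> V \<and> vanish_Y V" if z: "z \<in> X" for z
  proof (cases "fst z = p")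
    case False
    then have zU: "z \<in> U" using z by (simp add: U_def)
    obtain G where G: "open G" "U = blowup S \<inter> G"
      using open_U by blast
    have "z \<in> blowup S" "z \<in> G" using zU G(2) by auto
    moreover have "G \<inter> blowup S = U" using G(2) by blast
    ultimately obtain V where "open V" "z \<in> V" "loops_vanish Y (blow_down S') (V \<inter> blowup S)"
      using exists_vanishing_neighborhood[OF fin(3) _ G(1), of z "blow_down S'" Y]
        continuous_on_blow_down UY by metis
    then show ?thesis
      using loops_vanish_subset[of Y "blow_down S'" "V \<inter> blowup S" "V \<inter> U"] G(2) by blast
  qed (use X z in blast)
  show "\<exists>V. open V \<and> z \<in> V \<and> vanish_X V" if z: "z \<in> Y" for z
  proof (cases "z \<in> U'")
    case True
    obtain G where G: "open G" "U' = blowup S' \<inter> G"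
      using open_U' by blast
    have "z \<in> blowup S'" "z \<in> G" using True G(2) by auto
    moreover have "G \<inter> blowup S' = U'" using G(2) by blast
    moreover have "continuous_on U' (blow_up_at S p)"
      by (rule homeomorphism_cont2[OF homeomorphism_U])
    ultimately obtain V where "open V" "z \<in> V" "loops_vanish X (blow_up_at S p) (V \<inter> blowup S')"
      using exists_vanishing_neighborhood[OF fin'(3) _ G(1), of z "blow_up_at S p" X] UX by metis
    then show ?thesis
      using loops_vanish_subset[of X "blow_up_at S p" "V \<inter> blowup S'" "V \<inter> U'"] G(2) by blast
  qed (use Y z in blast)
qed

text \<open>Blowing down is continuous also over \<open>p\<close>, and as no remaining line contains
  \<open>p\<close> the image of \<open>z\<close> is a point of \<open>Y\<close>, with a simply
  connected chart. Loops in \<open>U\<close> near \<open>z\<close> therefore die in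
  \<open>Y\<close>.\<close>

lemma vanish_over_p:
  assumes pA: "p \<notin> \<Union>\<A>'" and z: "z \<in> X" "fst z = p"
  shows "\<exists>V. open V \<and> z \<in> V \<and> vanish_Y V"
proof -
  let ?z = "blow_down S' z"
  have zb: "?z \<in> blowup S'"
    using z(1) mem_X blow_down_in_blowup by blast
  moreover have "?z \<notin> strict S' a" if "line a \<in> \<A>'" for a
    using pA that z(2) by (auto simp: strict_def)
  ultimately have zY: "?z \<in> Y"
    using z(2) by (simp add: mem_Y)
  obtain G where G: "open G" "Y = blowup S' \<inter> G"
    using open_Y by blast
  have "continuous_on (G \<inter> blowup S') id" "id ` (G \<inter> blowup S') \<subseteq> Y" "?z \<in> G"
    using G(2) zY by auto
  then obtain V where V: "open V" "?z \<in> V" "loops_vanish Y id (V \<inter> blowup S')"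
    using exists_vanishing_neighborhood[OF fin'(3) zb G(1), of id Y] by blast
  have "open (blow_down S' -` V)"
    using V(1) continuous_on_blow_down by (rule open_vimage)
  moreover have "loops_vanish Y (id \<circ> blow_down S') (blow_down S' -` V \<inter> U)"
    using V(3) continuous_on_blow_down
    by (rule loops_vanish_compose) (use U_blowup blow_down_in_blowup in blast)
  ultimately show ?thesis
    using V(2) by (intro exI[of _ "blow_down S' -` V"]) simp
qed

end

text \<open>Both cases of \<open>K\<close> are covered: in place of the point, \<open>X\<close> has
  a sphere over \<open>p\<close> or nothing at all. The loops near \<open>p\<close> in
  \<open>Y\<close> live in a punctured bidisc, which is simply connected.\<close>

lemma isomorphic_remove_free_point:
  assumes fin: "finite \<A>" "\<A> \<subseteq> range line" "finite S" and pS: "p \<in> S" "p \<notin> \<Union>\<A>"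
  shows "isomorphic_fundamental_groups (surface \<A> S K) (surface \<A> (S - {p}) (K - {p}))"
proof -
  interpret point_removal \<A> \<A> S K p
    using fin pS by unfold_locales simp_all
  have U': "z \<in> U' \<longleftrightarrow> z \<in> Y \<and> fst z \<noteq> p" for z
    by (simp add: U'_def)
  obtain G where G: "open G" "Y = blowup S' \<inter> G"
    using open_Y by blast
  have "isomorphic_fundamental_groups X Y"
  proof (rule isomorphic_if)
    show "tame_pair Y U'"
    proof (rule tame_pair_blowup[OF fin'(3) G(2,1)])
      show "U' \<subseteq> Y" by (auto simp: U')
      fix z assume "z \<in> Y"
      show "\<exists>N. open N \<and> z \<in> N \<and> divisor_complement S' Y U' z N"
      proof (cases "fst z = p")
        case True
        then have "divisor_complement S' Y U' z UNIV"
          by (simp add: divisor_complement_def U')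
        then show ?thesis by blast
      next
        case False
        have "divisor_complement S' Y U' z {z. fst z \<noteq> p}"
          by (auto simp: divisor_complement_def U')
        then show ?thesis using False open_fst_neq by blast
      qed
    qed
    show "\<exists>V. open V \<and> z \<in> V \<and> vanish_Y V" if "z \<in> X" "fst z = p" for z
      using vanish_over_p[OF pS(2) that] .
    fix z assume z: "z \<in> Y" "z \<notin> U'"
    then have zp: "fst z = p" and zb: "z \<in> blowup S'" and zG: "z \<in> G"
      using U' G(2) by auto
    obtain c where c: "z \<in> strict S' c"
      using exists_line_strict[OF zb] by blast
    obtain r V \<phi> \<psi> where r: "r > 0" and V: "open V" "V \<subseteq> G" and z0: "\<phi> (0, 0) = z"
      and h: "homeomorphism (bidisc r) (V \<inter> blowup S') \<phi> \<psi>"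
      and ex: "\<And>w. w \<in> bidisc r \<Longrightarrow> fst (\<phi> w) = fst z \<longleftrightarrow> fst w = 0 \<and> (fst z \<in> S' \<or> snd w = 0)"
      using blowup_chart[OF fin'(3) c G(1) zG] by metis
    have VY: "V \<inter> blowup S' \<subseteq> Y" using V(2) G(2) by blast
    have "\<phi> w \<in> U' \<longleftrightarrow> w \<notin> {(0, 0)}" if "w \<in> bidisc r" for w
      using ex[OF that] zp homeomorphism_image1[OF h] VY that U'[of "\<phi> w"] by (cases w) auto
    then have "V \<inter> blowup S' \<inter> U' = \<phi> ` (bidisc r - {(0, 0)})"
      by (rule homeomorphic_image_Int[OF h])
    then have im: "V \<inter> U' = \<phi> ` (bidisc r - {(0, 0)})"
      using U'_blowup by blast
    have "loops_vanish X (blow_up_at S p) (\<phi> ` (bidisc r - {(0, 0)}))"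
    proof (rule loops_vanish_homeomorphic_image[OF h _ bidisc_props(9)[OF r]])
      show "continuous_on (\<phi> ` (bidisc r - {(0, 0)})) (blow_up_at S p)"
        unfolding im[symmetric] using homeomorphism_cont2[OF homeomorphism_U]
            by (rule continuous_on_subset) simp
      show "blow_up_at S p ` \<phi> ` (bidisc r - {(0, 0)}) \<subseteq> X"
        unfolding im[symmetric] using homeomorphism_image2[OF homeomorphism_U] by (auto simp: U_def)
    qed auto
    moreover have "z \<in> V"
      using z0 homeomorphism_image1[OF h] bidisc_props(3)[OF r] by auto
    ultimately show "\<exists>V. open V \<and> z \<in> V \<and> vanish_X V"
      using V(1) unfolding im[symmetric] by blast
  qed
  then show ?thesis
    unfolding X_def Y_def .
qed

text \<open>Neither surface has points over \<open>p\<close>: upstairs the exceptional curve is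
  removed, downstairs a removed line passes through \<open>p\<close>. So \<open>U'\<close> is all of
  \<open>Y\<close>, and both vanishing conditions are vacuous.\<close>

lemma isomorphic_remove_deleted_point:
  assumes fin: "finite \<A>" "\<A> \<subseteq> range line" "finite S" and pS: "p \<in> S" "p \<notin> K" "p \<in> \<Union>\<A>"
  shows "isomorphic_fundamental_groups (surface \<A> S K) (surface \<A> (S - {p}) (K - {p}))"
proof -
  interpret point_removal \<A> \<A> S K p
    using fin pS by unfold_locales simp_all
  obtain a where a: "line a \<in> \<A>" "p \<in> line a"
    using pS(3) fin(2) by auto
  have neq: "fst z \<noteq> p" if "z \<in> Y" for z
    using that a strict_if_notin[of z S' a] by (auto simp: mem_Y)
  then have U': "U' = Y"
    by (auto simp: U'_def)
  obtain G where G: "open G" "Y = blowup S' \<inter> G"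
    using open_Y by blast
  have "isomorphic_fundamental_groups X Y"
  proof (rule isomorphic_if)
    show "tame_pair Y U'"
      unfolding U' by (rule tame_pair_blowup[OF fin'(3) G(2,1)]) (auto simp: divisor_complement_def)
  qed (use pS mem_X U' in auto)
  then show ?thesis
    unfolding X_def Y_def .
qed


section \<open>Points on exactly one line\<close>

text \<open>The linear contraction towards \<open>(a, 0)\<close> multiplies the second coordinate by
  positive factors, so the loop never meets the axis.\<close>

lemma homotopic_loops_contract:
  assumes "r > 0" and w: "path w" "path_image w \<subseteq> bidisc r - {w. snd w = 0}" "pathfinish w = pathstart w"
    and a: "(a, 0) \<in> bidisc r" and T: "open T" "(a, 0) \<in> T"
  obtains w' where "homotopic_loops (bidisc r - {w. snd w = 0}) w w'" "path_image w' \<subseteq> T"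
proof -
  let ?a = "(a, 0::complex)"
  obtain \<epsilon> where \<epsilon>: "\<epsilon> > 0" "ball ?a \<epsilon> \<subseteq> T"
    using T openE by blast
  have "bounded (path_image w)"
    using w(1) compact_path_image compact_imp_bounded by blast
  then obtain R where "R > 0" "path_image w \<subseteq> ball ?a R"
    using bounded_subset_ballD by metis
  then have R: "R > 0" "\<And>x. x \<in> path_image w \<Longrightarrow> norm (x - ?a) \<le> R"
    by (auto simp: subset_iff dist_norm norm_minus_commute less_imp_le)
  \<comment> \<open>The factor 1/2 makes \<open>\<delta> * R\<close> strictly less than
    \<open>\<epsilon>\<close>; the minimum with 1 keeps a convex combination.\<close>
  define \<delta> where "\<delta> = min 1 (\<epsilon> / (2 * R))"
  have \<delta>: "0 < \<delta>" "\<delta> \<le> 1" "\<delta> * R < \<epsilon>"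
  proof -
    show "0 < \<delta>" "\<delta> \<le> 1" using \<epsilon> R by (simp_all add: \<delta>_def)
    have "\<delta> * R \<le> \<epsilon> / (2 * R) * R"
      using R by (intro mult_right_mono) (simp_all add: \<delta>_def)
    also have "\<dots> < \<epsilon>" using R \<epsilon> by simp
    finally show "\<delta> * R < \<epsilon>" .
  qed
  define w' where "w' t = (1 - \<delta>) *\<^sub>R ?a + \<delta> *\<^sub>R w t" for t
  have wt: "w t \<in> bidisc r" "snd (w t) \<noteq> 0" "norm (w t - ?a) \<le> R" if "t \<in> {0..1}" for t
  proof -
    have "w t \<in> path_image w" using that by (simp add: path_image_def)
    then show "w t \<in> bidisc r" "snd (w t) \<noteq> 0" "norm (w t - ?a) \<le> R"
      using w(2) R(2) by blast+
  qed
  have seg: "closed_segment (w t) (w' t) \<subseteq> bidisc r - {w. snd w = 0}" if t: "t \<in> {0..1}" for t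
  proof
    fix x assume "x \<in> closed_segment (w t) (w' t)"
    then obtain u where u: "0 \<le> u" "u \<le> 1" "x = (1 - u) *\<^sub>R w t + u *\<^sub>R w' t"
      unfolding closed_segment_def by blast
    \<comment> \<open>Intermediate points are again contractions, with factor
      \<open>1 - u * (1 - \<delta>)\<close>, which stays positive.\<close>
    then have x: "x = (1 - (u * (1 - \<delta>))) *\<^sub>R w t + (u * (1 - \<delta>)) *\<^sub>R ?a"
      unfolding w'_def by (simp add: algebra_simps)
    have v: "0 \<le> u * (1 - \<delta>)" "u * (1 - \<delta>) < 1"
    proof -
      show "0 \<le> u * (1 - \<delta>)" using u \<delta> by simp
      have "u * (1 - \<delta>) \<le> 1 * (1 - \<delta>)" using u \<delta> by (intro mult_right_mono) simp_all
      then show "u * (1 - \<delta>) < 1" using \<delta> by simp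
    qed
    have "x \<in> bidisc r"
      unfolding x using v by (intro convexD[OF bidisc_props(1)[OF \<open>r > 0\<close>] wt(1)[OF t] a]) simp_all
    moreover have "snd x \<noteq> 0"
      unfolding x using v wt(2)[OF t] by simp
    ultimately show "x \<in> bidisc r - {w. snd w = 0}" by simp
  qed
  have w': "path w'" "pathfinish w' = pathstart w'"
    using w(1,3) unfolding w'_def path_def pathfinish_def pathstart_def
      by (auto intro!: continuous_intros)
  have "homotopic_loops (bidisc r - {w. snd w = 0}) w w'"
    using w(1,3) w' seg by (intro homotopic_loops_linear) auto
  moreover have "path_image w' \<subseteq> T"
  proof -
    have "w' t \<in> T" if t: "t \<in> {0..1}" for t
    proof -
      have "?a - w' t = \<delta> *\<^sub>R (?a - w t)"
        unfolding w'_def by (simp add: algebra_simps)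
      then have "dist ?a (w' t) = \<delta> * norm (w t - ?a)"
        using \<delta> by (simp add: dist_norm norm_minus_commute)
      also have "\<dots> \<le> \<delta> * R"
        using \<delta> wt(3)[OF t] by (intro mult_left_mono) simp_all
      finally show ?thesis
        using \<delta>(3) \<epsilon>(2) by auto
    qed
    then show ?thesis unfolding path_image_def by blast
  qed
  ultimately show ?thesis by (rule that)
qed

text \<open>Inside a chart, a loop around the divisor \<open>y = 0\<close> can be shrunk towards any point of the
  divisor.\<close>

lemma loops_vanish_transport:
  assumes r: "r > 0" and h: "homeomorphism (bidisc r) W \<phi> \<psi>"
      and W: "W \<inter> U = \<phi> ` (bidisc r - {w. snd w = 0})"
    and f: "continuous_on U f" "f ` U \<subseteq> X"
    and a: "(a, 0) \<in> bidisc r" "open G" "\<phi> (a, 0) \<in> G" and G: "loops_vanish X f (G \<inter> U)"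
  shows "loops_vanish X f (W \<inter> U)"
  unfolding loops_vanish_def
proof (intro allI impI)
  let ?M = "bidisc r - {w. snd w = 0}"
  fix p assume p: "path p" "path_image p \<subseteq> W \<inter> U" "pathfinish p = pathstart p"
  have pM: "path_image p \<subseteq> \<phi> ` ?M" using p(2) W by simp
  have "continuous_on (path_image p) \<psi>"
    using homeomorphism_cont2[OF h] by (rule continuous_on_subset) (use p(2) in blast)
  then have 1: "path (\<psi> \<circ> p)" "pathfinish (\<psi> \<circ> p) = pathstart (\<psi> \<circ> p)"
    using p by (simp_all add: path_continuous_image pathfinish_compose pathstart_compose)
  have 2: "path_image (\<psi> \<circ> p) \<subseteq> ?M"
    unfolding path_image_compose using pM homeomorphism_apply1[OF h] by fastforce
  obtain A where A: "open A" "A \<inter> bidisc r = \<phi> -` G \<inter> bidisc r"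
    using homeomorphism_cont1[OF h] a(2) unfolding continuous_on_open_invariant by metis
  have aA: "(a, 0) \<in> A" using A(2) a by blast
  obtain w' where hom: "homotopic_loops ?M (\<psi> \<circ> p) w'" and w'A: "path_image w' \<subseteq> A"
    by (rule homotopic_loops_contract[OF r 1(1) 2 1(2) a(1) A(1) aA])
  have \<phi>M: "continuous_on ?M \<phi>"
    using homeomorphism_cont1[OF h] by (rule continuous_on_subset) blast
  have \<phi>U: "\<phi> ` ?M \<subseteq> U" using W by blast
  have f\<phi>: "continuous_on ?M (f \<circ> \<phi>)" "(f \<circ> \<phi>) \<in> ?M \<rightarrow> X"
  proof -
    show "continuous_on ?M (f \<circ> \<phi>)"
      using \<phi>M continuous_on_subset[OF f(1) \<phi>U] by (rule continuous_on_compose)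
    show "(f \<circ> \<phi>) \<in> ?M \<rightarrow> X"
      unfolding comp_def using f(2) \<phi>U by (intro funcsetI) blast
  qed
  have h1: "homotopic_loops X (f \<circ> \<phi> \<circ> (\<psi> \<circ> p)) (f \<circ> \<phi> \<circ> w')"
    using hom f\<phi> by (rule homotopic_loops_continuous_image)
  have h2: "homotopic_loops X (f \<circ> p) (f \<circ> \<phi> \<circ> (\<psi> \<circ> p))"
  proof (rule homotopic_loops_sym, rule homotopic_loops_eq)
    show "path (f \<circ> \<phi> \<circ> (\<psi> \<circ> p))" using homotopic_loops_imp_path[OF h1] by blast
    show "path_image (f \<circ> \<phi> \<circ> (\<psi> \<circ> p)) \<subseteq> X" using homotopic_loops_imp_subset[OF h1] by blast
    show "pathfinish (f \<circ> \<phi> \<circ> (\<psi> \<circ> p)) = pathstart (f \<circ> \<phi> \<circ> (\<psi> \<circ> p))"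
      using homotopic_loops_imp_loop[OF h1] by blast
    fix t :: real assume "t \<in> {0..1}"
    then have "p t \<in> W" using p(2) unfolding path_image_def by blast
    then show "(f \<circ> \<phi> \<circ> (\<psi> \<circ> p)) t = (f \<circ> p) t"
      using homeomorphism_apply2[OF h] by simp
  qed
  have w'M: "path_image w' \<subseteq> ?M" and w'p: "path w'" and w'l: "pathfinish w' = pathstart w'"
    using homotopic_loops_imp_subset[OF hom] homotopic_loops_imp_path[OF hom]
      homotopic_loops_imp_loop[OF hom] by auto
  have "path (\<phi> \<circ> w')"
    using w'p by (rule path_continuous_image) (rule continuous_on_subset[OF \<phi>M w'M])
  moreover have "path_image (\<phi> \<circ> w') \<subseteq> G \<inter> U"
    unfolding path_image_compose using w'M w'A A(2) \<phi>U by blast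
  moreover have "pathfinish (\<phi> \<circ> w') = pathstart (\<phi> \<circ> w')"
    using w'l by (simp add: pathfinish_compose pathstart_compose)
  ultimately obtain y where "homotopic_loops X (f \<circ> (\<phi> \<circ> w')) (\<lambda>_. y)"
    using G unfolding loops_vanish_def by blast
  then have "homotopic_loops X (f \<circ> p) (\<lambda>_. y)"
    using h1 h2 homotopic_loops_trans unfolding comp_assoc by metis
  then show "\<exists>y. homotopic_loops X (f \<circ> p) (\<lambda>_. y)" by blast
qed

locale simple_point_removal = point_removal \<A> "\<A> - {line a}" S K p
  for \<A> S K p a +
  assumes pK: "p \<in> K" and pa: "{M \<in> \<A>. p \<in> M} = {line a}"
begin

lemma p_in_a: "p \<in> line a" "line a \<in> \<A>"
  using pa by auto

lemma p_notin: "p \<notin> \<Union>(\<A> - {line a})"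
  using pa by auto

text \<open>Since \<open>p\<close> is no longer a centre and lies on \<open>a\<close>, the points of
  \<open>Y\<close> over \<open>p\<close> are on the strict transform of \<open>a\<close>; this
  absorbs the condition on \<open>p\<close>.\<close>

lemma U'_iff: "z \<in> U' \<longleftrightarrow> z \<in> Y \<and> z \<notin> strict S' a"
proof -
  have "line a' \<in> \<A> - (\<A> - {line a}) \<longleftrightarrow> a' = a" for a'
    using p_in_a(2) line_eq_iff by auto
  then have "z \<in> U' \<longleftrightarrow> z \<in> Y \<and> fst z \<noteq> p \<and> z \<notin> strict S' a"
    unfolding U'_def by auto
  moreover have "z \<in> strict S' a" if "z \<in> Y" "fst z = p"
    using that p_in_a(1) by (intro strict_if_notin) (simp_all add: mem_Y)
  ultimately show ?thesis by blast
qed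

lemma tame_Y: "tame_pair Y U'"
proof -
  obtain G where G: "open G" "Y = blowup S' \<inter> G"
    using open_Y by blast
  obtain C where C: "closed C" "strict S' a = blowup S' \<inter> C"
    using strict_eq_closed by blast
  show ?thesis
  proof (rule tame_pair_blowup[OF fin'(3) G(2,1)])
    show "U' \<subseteq> Y" by (auto simp: U'_iff)
    fix z assume z: "z \<in> Y"
    show "\<exists>N. open N \<and> z \<in> N \<and> divisor_complement S' Y U' z N"
    proof (cases "z \<in> strict S' a")
      case True
      then have "divisor_complement S' Y U' z UNIV"
        unfolding divisor_complement_def U'_iff by blast
      then show ?thesis by blast
    next
      case False
      then have "z \<in> - C" "divisor_complement S' Y U' z (- C)"
        using z C(2) G(2) by (auto simp: divisor_complement_def U'_iff)
      then show ?thesis using C(1) by (meson open_Compl)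
    qed
  qed
qed

lemma blow_up_at_U': "continuous_on U' (blow_up_at S p)" "blow_up_at S p ` U' \<subseteq> X"
  using homeomorphism_cont2[OF homeomorphism_U] homeomorphism_image2[OF homeomorphism_U]
  by (auto simp: U_def)

text \<open>Vanishing is locally constant along the strict transform, because all loops in the chart
  domain \<open>V\<close> shrink towards any one of its points on the divisor.\<close>

lemma vanish_transport:
  assumes z: "z \<in> Y \<inter> strict S' a"
  shows "\<exists>V. open V \<and> z \<in> V \<and> (\<forall>z'\<in>V \<inter> Y \<inter> strict S' a. \<forall>G. open G \<longrightarrow> z' \<in> G \<longrightarrow>
    vanish_X G \<longrightarrow> vanish_X V)"
proof -
  obtain G where G: "open G" "Y = blowup S' \<inter> G"
    using open_Y by blast
  have zs: "z \<in> strict S' a" and zG: "z \<in> G" using z G(2) by auto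
  obtain r V \<phi> \<psi> where r: "r > 0" and V: "open V" "V \<subseteq> G" and z0: "\<phi> (0, 0) = z"
    and h: "homeomorphism (bidisc r) (V \<inter> blowup S') \<phi> \<psi>"
    and st: "\<And>w. w \<in> bidisc r \<Longrightarrow> \<phi> w \<in> strict S' a \<longleftrightarrow> snd w = 0"
    using blowup_chart[OF fin'(3) zs G(1) zG] by metis
  have im: "V \<inter> blowup S' = \<phi> ` bidisc r"
    using homeomorphism_image1[OF h] by simp
  have "\<phi> w \<in> U' \<longleftrightarrow> w \<notin> {w. snd w = 0}" if "w \<in> bidisc r" for w
    using st[OF that] that im V(2) G(2) by (auto simp: U'_iff)
  then have W: "V \<inter> blowup S' \<inter> U' = \<phi> ` (bidisc r - {w. snd w = 0})"
    by (rule homeomorphic_image_Int[OF h])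
  have VU: "V \<inter> U' = V \<inter> blowup S' \<inter> U'"
    using U'_blowup by blast
  have "vanish_X V"
    if z': "z' \<in> V \<inter> Y \<inter> strict S' a" and G': "open G'" "z' \<in> G'" "vanish_X G'" for z' G'
  proof -
    have "z' \<in> \<phi> ` bidisc r"
      using z' G(2) unfolding im[symmetric] by blast
    then obtain w where w: "w \<in> bidisc r" "z' = \<phi> w" by blast
    moreover from this have "snd w = 0" using st z' by blast
    ultimately have "(fst w, 0) \<in> bidisc r" "\<phi> (fst w, 0) \<in> G'"
      using G'(2) by (metis prod.collapse)+
    then show ?thesis
      unfolding VU using G' by (intro loops_vanish_transport[OF r h W blow_up_at_U'])
  qed
  moreover have "z \<in> V"
    using z0 im bidisc_props(3)[OF r] by auto
  ultimately show ?thesis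
    using V(1) by (intro exI[of _ V]) blast
qed

text \<open>In coordinates (x, y) at \<open>p\<close> with \<open>a\<close> given by y = 0, a loop
  off \<open>a\<close> has the blow-up coordinates (y, x/y). These make sense also at y = 0, on the
  exceptional curve, and there is room to contract the loop; this part of the curve belongs to
  \<open>X\<close> because \<open>p \<in> K\<close> and \<open>a\<close> is the only line at
  \<open>p\<close>.\<close>

lemma vanish_at_p: "\<exists>V. open V \<and> line_lift S' a p \<in> V \<and> vanish_X V"
proof -
  obtain e0 e1 e2 where fr: "frame e0 e1 e2" and b: "frame.b e0 = p" and c: "frame.c e0 e1 = a"
    using exists_frame[OF p_in_a(1)] by blast
  interpret frame e0 e1 e2 by (rule fr)
  have dom: "(0, 0) \<in> chart_domain S'"
    by (simp add: chart_domain_def fst_chart b_pt)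
  have "chart S' (0, 0) \<in> strict S' a"
    using chart_in_strict_iff[OF dom] c by simp
  moreover have "fst (chart S' (0, 0)) = p"
    using fst_chart_eq_b[of S' "(0, 0)"] b by simp
  ultimately have z0: "chart S' (0, 0) = line_lift S' a p"
    using strict_eq_line_lift by metis
  have zY: "line_lift S' a p \<in> Y"
    unfolding Y_def using p_in_a(1) p_notin
    by (intro line_lift_in_surface[OF fin']) (auto simp: arrangement_points_def)
  obtain G where G: "open G" "Y = blowup S' \<inter> G"
    using open_Y by blast
  then have "chart S' (0, 0) \<in> G" using zY z0 by simp
  then obtain r V where r: "r > 0" and V: "open V" "V \<subseteq> G" and dom: "bidisc r \<subseteq> chart_domain S'"
    and h: "homeomorphism (bidisc r) (V \<inter> blowup S') (chart S') (chart_inv S')"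
    using chart_homeomorphism[OF fin'(3) G(1)] by metis
  have im: "V \<inter> blowup S' = chart S' ` bidisc r"
    using homeomorphism_image1[OF h] by simp
  have chU: "chart S' w \<in> U' \<longleftrightarrow> w \<notin> {w. snd w = 0}" if "w \<in> bidisc r" for w
    using chart_in_strict_iff[of w S'] dom that im V(2) G(2) c by (auto simp: U'_iff)
  have "V \<inter> blowup S' \<inter> U' = chart S' ` (bidisc r - {w. snd w = 0})"
    using chU by (rule homeomorphic_image_Int[OF h])
  then have VU: "V \<inter> U' = chart S' ` (bidisc r - {w. snd w = 0})"
    using U'_blowup by blast
  \<comment> \<open>In the chart of the swapped basis the strict transform of \<open>a\<close> is at infinity; the loops around \<open>a\<close> near \<open>p\<close>
    lift to a star-shaped domain of this chart.\<close>
  interpret swap: frame e0 e2 e1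
  proof
    have "pairing (cross e2 e1) e0 = - pairing (cross e1 e2) e0"
      by (simp add: pairing_def algebra_simps)
    then show "pairing (cross e2 e1) e0 \<noteq> 0"
      using det by simp
  qed
  have swap_pt: "swap.pt y x = pt x y" for x y
    by (simp add: swap.pt_def swap.vc_def pt_def vc_def add_ac)
  have "c \<in> line (abs_cp2 e1)"
    using incident_abs[OF nonzero(2,6)] by (simp add: c_def pairing_commute[of e1])
  then have swap_dir: "abs_cp2 (swap.dir m) \<noteq> a" for m
    using swap.dir_notin[of m] c by auto
  \<comment> \<open>The preimage of the bidisc under the map from (y, m) to (m y, y); it contains a
    piece y = 0 of the exceptional curve.\<close>
  define M where "M = {w. (fst w * snd w, fst w) \<in> bidisc r}"
  have "pt x y \<notin> S - {p}" if "(x, y) \<in> bidisc r" for x y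
    using dom that b by (auto simp: chart_domain_def fst_chart)
  then have M: "M \<subseteq> swap.chart_domain S"
    using p b by (auto simp: M_def swap.chart_domain_def swap.fst_chart swap_pt)
  have agree: "swap.chart S w = blow_up_at S p (chart S' (fst w * snd w, fst w))" if "fst w \<noteq> 0" for w
    using swap.line_through_b_pt[OF that, of "snd w"] b p
    by (simp add: blow_up_at_def prod_eq_iff swap.fst_chart swap.snd_chart fst_chart snd_chart
      swap_pt fun_eq_iff)
  have coX: "swap.chart S w \<in> X" if w: "w \<in> M" for w
  proof (cases "fst w = 0")
    case False
    then have "chart S' (fst w * snd w, fst w) \<in> U'"
      using w chU unfolding M_def by simp
    then show ?thesis
      using agree[OF False] blow_up_at_U'(2) by auto
  next
    case True
    have f: "fst (swap.chart S w) = p"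
      using swap.fst_chart_eq_b[of S w] True b p by simp
    \<comment> \<open>Of the lines only \<open>a\<close> passes through \<open>p\<close>, and its
      direction at \<open>p\<close> is the one missing from the swapped chart.\<close>
    have "swap.chart S w \<notin> strict S a'" if "line a' \<in> \<A>" for a'
    proof (cases "a' = a")
      case True
      have "snd (swap.chart S w) p \<noteq> a"
        using b p swap_dir by (simp add: swap.snd_chart)
      then show ?thesis
        unfolding True strict_def using p p_in_a(1) by blast
    next
      case False
      then show ?thesis
        using p_notin that f line_eq_iff by (auto simp: strict_def)
    qed
    then show ?thesis
      using f pK M w swap.chart_in_blowup[of w S] by (auto simp: mem_X)
  qed
  have "vanish_X V"
  proof (rule loops_vanish_simply_connected[of M "swap.chart S"])
    \<comment> \<open>\<open>M\<close> is not convex, but scaling by \<open>u\<close> multiplies its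
      two bounded quantities by \<open>u * u\<close> and \<open>u\<close>, so segments to the origin
      stay inside.\<close>
    have "starlike M"
      unfolding starlike_def
    proof (intro bexI[of _ "(0, 0)"] ballI)
      show "(0, 0) \<in> M" using bidisc_props(3)[OF r] by (simp add: M_def)
      fix w assume w: "w \<in> M"
      show "closed_segment (0, 0) w \<subseteq> M"
      proof
        fix x assume "x \<in> closed_segment (0, 0) w"
        then obtain u where u: "0 \<le> u" "u \<le> 1" "x = u *\<^sub>R w"
          unfolding closed_segment_def by (auto simp: zero_prod_def[symmetric])
        have n: "norm (fst w * snd w) < r" "norm (fst w) < r"
          using w by (simp_all add: M_def bidisc_def)
        have "norm (fst x * snd x) = (u * u) * norm (fst w * snd w)" "norm (fst x) = u * norm (fst w)"
          using u by (simp_all add: norm_mult)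
        moreover have "(u * u) * norm (fst w * snd w) \<le> norm (fst w * snd w)"
            "u * norm (fst w) \<le> norm (fst w)"
          using u by (auto intro!: mult_left_le_one_le mult_le_one)
        ultimately show "x \<in> M"
          using n by (simp add: M_def bidisc_def)
      qed
    qed
    then show "simply_connected M"
      by (rule starlike_imp_simply_connected)
    show "continuous_on M (swap.chart S)"
      using swap.continuous_on_chart M by (rule continuous_on_subset)
    show "swap.chart S ` M \<subseteq> X"
      using coX by blast
    fix q assume q: "path q" "path_image q \<subseteq> V \<inter> U'" "pathfinish q = pathstart q"
    define w where "w = chart_inv S' \<circ> q"
    have "continuous_on (path_image q) (chart_inv S')"
      using homeomorphism_cont2[OF h] by (rule continuous_on_subset) (use q(2) U'_blowup in blast)
    then have w: "path w" "pathfinish w = pathstart w"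
      using q unfolding w_def
        by (simp_all add: path_continuous_image pathfinish_compose pathstart_compose)
    have wt: "w t \<in> bidisc r" "snd (w t) \<noteq> 0" "chart S' (w t) = q t" if "t \<in> {0..1}" for t
    proof -
      have "q t \<in> chart S' ` (bidisc r - {w. snd w = 0})"
        using q(2) that unfolding VU path_image_def by blast
      then show "w t \<in> bidisc r" "snd (w t) \<noteq> 0" "chart S' (w t) = q t"
        by (auto simp: w_def chart_inv_chart)
    qed
    \<comment> \<open>The blow-up coordinates of the loop; the division is safe because the loop
      avoids y = 0.\<close>
    define v where "v t = (snd (w t), fst (w t) / snd (w t))" for t
    have v: "fst (v t) * snd (v t) = fst (w t)" "fst (v t) = snd (w t)" if "t \<in> {0..1}" for t
      using wt(2)[OF that] by (simp_all add: v_def)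
    have "continuous_on {0..1} w" using w(1) by (simp add: path_def)
    then have "path v"
      unfolding path_def v_def using wt(2) by (intro continuous_intros) auto
    moreover have "path_image v \<subseteq> M"
      using v wt(1) unfolding path_image_def M_def by (auto simp: image_subset_iff)
    moreover have "pathfinish v = pathstart v"
      using w(2) unfolding v_def pathfinish_def pathstart_def by simp
    moreover have "blow_up_at S p (q t) = swap.chart S (v t)" if "t \<in> {0..1}" for t
      using agree[of "v t"] v[OF that] wt(2,3)[OF that] by simp
    ultimately show "\<exists>v. path v \<and> path_image v \<subseteq> M \<and> pathfinish v = pathstart v \<and>
        (\<forall>t\<in>{0..1}. blow_up_at S p (q t) = swap.chart S (v t))"
      by blast
  qed
  moreover have "chart S' (0, 0) \<in> V"
    using im bidisc_props(3)[OF r] by blast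
  ultimately show ?thesis
    using V(1) unfolding z0 by blast
qed

text \<open>As \<open>p\<close> lies on no other line, its lift is a point of \<open>Y\<close>, and
  it is joined to \<open>z\<close> within the strict transform of \<open>a\<close> in
  \<open>Y\<close>. Vanishing spreads along such a path.\<close>

lemma vanish_on_strict:
  assumes z: "z \<in> Y \<inter> strict S' a"
  shows "\<exists>V. open V \<and> z \<in> V \<and> vanish_X V"
proof -
  have "line a \<notin> \<A> - {line a}" by simp
  moreover have z_lift: "z = line_lift S' a (fst z)" "fst z \<in> line a"
    using strict_eq_line_lift[of z S' a] z by (auto simp: strict_def)
  moreover have "line_lift S' a p \<in> surface (\<A> - {line a}) S' (K - {p})"
    using p_in_a(1) p_notin by (intro line_lift_in_surface[OF fin']) (auto simp: arrangement_points_def)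
  ultimately have "path_component (Y \<inter> strict S' a) (line_lift S' a p) (line_lift S' a (fst z))"
    unfolding Y_def using z p_in_a(1)
    by (intro path_component_line_lift[OF fin']) (simp_all add: Y_def)
  then obtain \<gamma> where \<gamma>: "path \<gamma>" "path_image \<gamma> \<subseteq> Y \<inter> strict S' a" "pathstart \<gamma> = line_lift S' a p"
      "pathfinish \<gamma> = z"
    unfolding path_component_def using z_lift(1) by metis
  define P where "P y \<longleftrightarrow> (\<exists>V. open V \<and> y \<in> V \<and> vanish_X V)" for y
  have step: "\<exists>T. openin (top_of_set (path_image \<gamma>)) T \<and> y \<in> T \<and> (\<forall>x\<in>T. \<forall>x'\<in>T. P x \<longrightarrow> P x')"
    if y: "y \<in> path_image \<gamma>" for y
  proof -
    have "y \<in> Y \<inter> strict S' a" using y \<gamma>(2) by blast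
    from vanish_transport[OF this] obtain V where V: "open V" "y \<in> V" and
      trans: "\<And>z' G. z' \<in> V \<inter> Y \<inter> strict S' a \<Longrightarrow> open G \<Longrightarrow> z' \<in> G \<Longrightarrow>
        vanish_X G \<Longrightarrow> vanish_X V"
      by blast
    have "P x'" if x: "x \<in> path_image \<gamma> \<inter> V" and x': "x' \<in> path_image \<gamma> \<inter> V" and "P x" for x x'
    proof -
      obtain G where G: "open G" "x \<in> G" "vanish_X G"
        using \<open>P x\<close> unfolding P_def by blast
      have "x \<in> V \<inter> Y \<inter> strict S' a" using x \<gamma>(2) by blast
      then have "vanish_X V"
        using G by (rule trans)
      then show ?thesis
        unfolding P_def using V(1) x' by blast
    qed
    moreover have "openin (top_of_set (path_image \<gamma>)) (path_image \<gamma> \<inter> V)"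
      using V(1) by (rule openin_open_Int)
    ultimately show ?thesis
      using y V(2) by (intro exI[of _ "path_image \<gamma> \<inter> V"]) blast
  qed
  have ends: "line_lift S' a p \<in> path_image \<gamma>" "z \<in> path_image \<gamma>"
    using pathstart_in_path_image[of \<gamma>] pathfinish_in_path_image[of \<gamma>] \<gamma>(3,4) by simp_all
  have base: "P (line_lift S' a p)"
    unfolding P_def by (rule vanish_at_p)
  have "P z"
    using step by (rule connected_induction_simple[where P = P, OF connected_path_image[OF \<gamma>(1)]
      ends base])
  then show ?thesis
    unfolding P_def .
qed

lemma isomorphic_X_Y: "isomorphic_fundamental_groups X Y"
proof (rule isomorphic_if[OF tame_Y])
  show "\<exists>V. open V \<and> z \<in> V \<and> vanish_Y V" if "z \<in> X" "fst z = p" for z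
    using p_notin that by (rule vanish_over_p)
  show "\<exists>V. open V \<and> z \<in> V \<and> vanish_X V" if "z \<in> Y" "z \<notin> U'" for z
    using that by (intro vanish_on_strict) (simp add: U'_iff)
qed

end

lemma isomorphic_remove_simple_point:
  assumes fin: "finite \<A>" "\<A> \<subseteq> range line" "finite S" and pS: "p \<in> S" "p \<in> K" "{M \<in> \<A>. p \<in> M} = {L}"
  shows "isomorphic_fundamental_groups (surface \<A> S K) (surface (\<A> - {L}) (S - {p}) (K - {p}))"
proof -
  obtain a where a: "L = line a"
    using pS(3) fin(2) by blast
  interpret simple_point_removal \<A> S K p a
    using fin pS a by unfold_locales auto
  show ?thesis
    using isomorphic_X_Y unfolding X_def Y_def a .
qed

section \<open>Composing the equivalences\<close>

lemma isomorphic_fundamental_groups_trans: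
  assumes "isomorphic_fundamental_groups X Y" "isomorphic_fundamental_groups Y Z"
  shows "isomorphic_fundamental_groups X Z"
proof -
  \<comment> \<open>Isomorphism is demanded for all base points, and nonemptiness supplies one in
    the middle space.\<close>
  obtain y where "y \<in> Y"
    using assms(1) unfolding isomorphic_fundamental_groups_def by blast
  then show ?thesis
    using assms iso_trans unfolding isomorphic_fundamental_groups_def by blast
qed

lemma isomorphic_surface_refl:
  assumes "finite \<A>" "\<A> \<subseteq> range line" "finite S"
  shows "isomorphic_fundamental_groups (surface \<A> S K) (surface \<A> S K)"
  using exists_point_off_centers[OF assms, of K]
    fundamental_group_basepoint[OF surface_path_connected[OF assms]]
  unfolding isomorphic_fundamental_groups_def by blast

text \<open>The last condition on \<open>R\<close> says that each of its points is off all lines or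
  has its exceptional curve removed: the two kinds of points that the procedure discards.\<close>

lemma isomorphic_remove_points:
  assumes fin: "finite \<A>" "\<A> \<subseteq> range line" "finite S" and R: "finite R" "R \<subseteq> S" "R \<inter> K \<inter> \<Union>\<A> = {}"
  shows "isomorphic_fundamental_groups (surface \<A> S K) (surface \<A> (S - R) (K - R))"
  using R
proof (induction R rule: finite_induct)
  case empty
  then show ?case using isomorphic_surface_refl[OF fin] by simp
next
  case (insert p R)
  have IH: "isomorphic_fundamental_groups (surface \<A> S K) (surface \<A> (S - R) (K - R))"
    using insert by blast
  have p: "p \<in> S - R" "p \<notin> K - R \<or> p \<notin> \<Union>\<A>" and fin': "finite (S - R)"
    using insert fin(3) by auto
  have "isomorphic_fundamental_groups (surface \<A> (S - R) (K - R)) (surface \<A> (S - R - {p}) (K - R -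
      {p}))"
  proof (cases "p \<in> \<Union>\<A>")
    case True
    then show ?thesis
      using p by (intro isomorphic_remove_deleted_point[OF fin(1,2) fin']) blast+
  next
    case False
    then show ?thesis
      using p by (intro isomorphic_remove_free_point[OF fin(1,2) fin'])
  qed
  with IH have "isomorphic_fundamental_groups (surface \<A> S K) (surface \<A> (S - R - {p}) (K - R - {p}))"
    by (rule isomorphic_fundamental_groups_trans)
  moreover have "S - insert p R = S - R - {p}" "K - insert p R = K - R - {p}"
    by blast+
  ultimately show ?case by simp
qed

lemma isomorphic_discard_free:
  assumes "finite \<A>" "\<A> \<subseteq> range line" "finite S"
  shows "isomorphic_fundamental_groups (surface \<A> S S) (surface \<A> (discard_free \<A> S) (discard_free \<A> S))"
proof -
  have "discard_free \<A> S = S - (S - \<Union>\<A>)"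
    by (auto simp: discard_free_def)
  then show ?thesis
    using isomorphic_remove_points[OF assms, of "S - \<Union>\<A>" S] assms(3) by auto
qed


section \<open>The reduction procedure\<close>

text \<open>Deleting a line has the same effect on the surface as keeping its strict transform, so
  this reduction is an equality of sets.\<close>

lemma LAC_surface_initial:
  "LAC_surface \<A> S I = surface (initial_lines \<A> I) S {p \<in> S. Inr p \<in> I}"
proof -
  have "(\<A> <+> S) - I = (initial_lines \<A> I <+> S) - Inr ` {p \<in> S. Inr p \<in> I}"
    by (auto simp: initial_lines_def)
  then show ?thesis
    by (simp add: LAC_surface_def surface_def)
qed

lemma isomorphic_initial:
  assumes "finite \<A>" "\<A> \<subseteq> range line" "finite S"
  shows "isomorphic_fundamental_groups (LAC_surface \<A> S I)
    (surface (initial_lines \<A> I) (initial_points \<A> S I) (initial_points \<A> S I))"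
proof -
  \<comment> \<open>Both initial discards are done at once: \<open>?R\<close> consists of the points
    off all lines and those whose exceptional curve is removed.\<close>
  let ?K = "{p \<in> S. Inr p \<in> I}" and ?R = "S - initial_points \<A> S I"
  have "S - ?R = initial_points \<A> S I" "?K - ?R = initial_points \<A> S I"
      "?R \<inter> ?K \<inter> \<Union>(initial_lines \<A> I) = {}"
    by (auto simp: initial_points_def discard_free_def)
  moreover have "finite (initial_lines \<A> I)" "initial_lines \<A> I \<subseteq> range line"
    using assms by (auto simp: initial_lines_def)
  ultimately show ?thesis
    using isomorphic_remove_points[of "initial_lines \<A> I" S ?R ?K] assms(3)
      by (simp add: LAC_surface_initial)
qed

text \<open>The last condition is the one that matters at the end: with no point on exactly one line
  left, it yields two lines through each remaining point.\<close>

definition reduction_state :: "cp2 set set \<times> cp2 set \<Rightarrow> bool" where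
  "reduction_state D \<longleftrightarrow> finite (fst D) \<and> fst D \<subseteq> range line \<and> finite (snd D) \<and> snd D \<subseteq> \<Union>(fst D)"

text \<open>\<open>p\<close> lies on no line once \<open>L\<close> is deleted, so discarding removes
  it anyway. The result of a step thus depends on \<open>L\<close> and not on the point
  chosen.\<close>

lemma discard_free_remove:
  assumes "{M \<in> \<A>. p \<in> M} = {L}"
  shows "discard_free (\<A> - {L}) (S - {p}) = discard_free (\<A> - {L}) S"
  using assms by (auto simp: discard_free_def)

lemma reduction_stepI:
  assumes "p \<in> S" "{M \<in> \<A>. p \<in> M} = {L}"
  shows "reduction_step (\<A>, S) (\<A> - {L}, discard_free (\<A> - {L}) S)"
  using reduction_step.intros[OF assms] unfolding discard_free_remove[OF assms(2)] .

lemma reduction_step_iff: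
  "reduction_step (\<A>, S) D \<longleftrightarrow>
    (\<exists>p\<in>S. \<exists>L. {M \<in> \<A>. p \<in> M} = {L} \<and> D = (\<A> - {L}, discard_free (\<A> - {L}) S))"
proof
  assume "reduction_step (\<A>, S) D"
  then show "\<exists>p\<in>S. \<exists>L. {M \<in> \<A>. p \<in> M} = {L} \<and> D = (\<A> - {L}, discard_free (\<A> - {L}) S)"
  proof cases
    case (1 p L)
    then show ?thesis
      using discard_free_remove[OF 1(3)] by blast
  qed
qed (blast intro: reduction_stepI)

lemma reduction_step_state:
  assumes "reduction_step D E" "reduction_state D"
  shows "reduction_state E"
  using assms(1)
proof cases
  case (1 p S \<A> L)
  then show ?thesis
    using assms(2) by (auto simp: reduction_state_def discard_free_def)
qed

lemma reduction_step_isomorphic: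
  assumes "reduction_step D E" "reduction_state D"
  shows "isomorphic_fundamental_groups (surface (fst D) (snd D) (snd D)) (surface (fst E) (snd E)
      (snd E))"
  using assms(1)
proof cases
  case (1 p S \<A> L)
  have fin: "finite \<A>" "\<A> \<subseteq> range line" "finite S"
    using assms(2) 1 by (simp_all add: reduction_state_def)
  have "isomorphic_fundamental_groups (surface \<A> S S) (surface (\<A> - {L}) (S - {p}) (S - {p}))"
    using 1 by (intro isomorphic_remove_simple_point[OF fin])
  moreover have "isomorphic_fundamental_groups (surface (\<A> - {L}) (S - {p}) (S - {p}))
      (surface (\<A> - {L}) (discard_free (\<A> - {L}) (S - {p})) (discard_free (\<A> - {L}) (S - {p})))"
    using fin by (intro isomorphic_discard_free) auto
  ultimately show ?thesis
    using 1 isomorphic_fundamental_groups_trans by simp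
qed

lemma reduction_steps_isomorphic:
  assumes "reduction_step\<^sup>*\<^sup>* D E" "reduction_state D"
  shows "reduction_state E \<and>
    isomorphic_fundamental_groups (surface (fst D) (snd D) (snd D)) (surface (fst E) (snd E) (snd E))"
  using assms
proof (induction rule: rtranclp_induct)
  case base
  then show ?case
    by (auto simp: reduction_state_def intro: isomorphic_surface_refl)
next
  case (step E F)
  then have E: "reduction_state E"
    and iso: "isomorphic_fundamental_groups (surface (fst D) (snd D) (snd D)) (surface (fst E) (snd
        E) (snd E))"
    by blast+
  show ?case
    using reduction_step_state[OF step.hyps(2) E]
      isomorphic_fundamental_groups_trans[OF iso reduction_step_isomorphic[OF step.hyps(2) E]] ..
qed

text \<open>After \<open>L\<close> is deleted, \<open>q\<close> still lies on \<open>M\<close> and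
  on no other line, and conversely for \<open>p\<close> and \<open>L\<close>. So both steps can be
  completed to the same state.\<close>

lemma reduction_step_confluent: "confluentp reduction_step"
proof (rule strong_confluentp_imp_confluentp, rule strong_confluentpI)
  fix D E F assume E: "reduction_step D E" and F: "reduction_step D F"
  obtain \<A> S where D: "D = (\<A>, S)" by (cases D)
  obtain p L where p: "p \<in> S" "{M \<in> \<A>. p \<in> M} = {L}" "E = (\<A> - {L}, discard_free (\<A> - {L}) S)"
    using E unfolding D reduction_step_iff by blast
  obtain q M where q: "q \<in> S" "{L \<in> \<A>. q \<in> L} = {M}" "F = (\<A> - {M}, discard_free (\<A> - {M}) S)"
    using F unfolding D reduction_step_iff by blast
  show "\<exists>u. reduction_step\<^sup>*\<^sup>* E u \<and> reduction_step\<^sup>=\<^sup>= F u"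
  proof (cases "L = M")
    case True
    \<comment> \<open>Two points on the same line give the same result.\<close>
    then show ?thesis using p(3) q(3) by blast
  next
    case False
    let ?u = "(\<A> - {L} - {M}, discard_free (\<A> - {L} - {M}) S)"
    have pq: "q \<in> discard_free (\<A> - {L}) S" "{L' \<in> \<A> - {L}. q \<in> L'} = {M}"
      "p \<in> discard_free (\<A> - {M}) S" "{M' \<in> \<A> - {M}. p \<in> M'} = {L}"
      using p q False by (auto simp: discard_free_def)
    have "reduction_step E (\<A> - {L} - {M}, discard_free (\<A> - {L} - {M}) (discard_free (\<A> - {L}) S))"
      "reduction_step F (\<A> - {M} - {L}, discard_free (\<A> - {M} - {L}) (discard_free (\<A> - {M}) S))"
      unfolding p(3) q(3) using reduction_stepI[OF pq(1,2)] reduction_stepI[OF pq(3,4)] .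
    moreover have "discard_free (\<A> - {L} - {M}) (discard_free (\<A> - {L}) S) = discard_free (\<A> - {L} -
        {M}) S"
      "discard_free (\<A> - {M} - {L}) (discard_free (\<A> - {M}) S) = discard_free (\<A> - {L} - {M}) S"
      "\<A> - {M} - {L} = \<A> - {L} - {M}"
      by (auto simp: discard_free_def)
    ultimately have E: "reduction_step E ?u" and F: "reduction_step F ?u"
      by (simp_all only:)
    show ?thesis
      using r_into_rtranclp[of reduction_step, OF E] F by blast
  qed
qed

text \<open>Every step deletes a line, so the number of lines is a termination measure.\<close>

lemma exists_reduction_normal_form:
  assumes "finite \<A>"
  shows "\<exists>D. reduction_step\<^sup>*\<^sup>* (\<A>, S) D \<and> (\<nexists>E. reduction_step D E)"
  using assms
proof (induction "card \<A>" arbitrary: \<A> S rule: less_induct)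
  case less
  show ?case
  proof (cases "\<exists>E. reduction_step (\<A>, S) E")
    case True
    then obtain L T where L: "L \<in> \<A>" and step: "reduction_step (\<A>, S) (\<A> - {L}, T)"
      unfolding reduction_step_iff by blast
    have "card (\<A> - {L}) < card \<A>"
      using less.prems L by (rule card_Diff1_less)
    moreover have "finite (\<A> - {L})"
      using less.prems by simp
    ultimately obtain D where "reduction_step\<^sup>*\<^sup>* (\<A> - {L}, T) D" "\<nexists>E. reduction_step D E"
      using less.hyps by blast
    then show ?thesis
      using converse_rtranclp_into_rtranclp[of reduction_step, OF step] by blast
  qed blast
qed

lemma reduction_normal_form_unique:
  assumes "reduction_step\<^sup>*\<^sup>* C D" "\<nexists>D'. reduction_step D D'" "reduction_step\<^sup>*\<^sup>* C E"
      "\<nexists>E'. reduction_step E E'"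
  shows "D = E"
proof -
  obtain F where "reduction_step\<^sup>*\<^sup>* D F" "reduction_step\<^sup>*\<^sup>* E F"
    using confluentpD[OF reduction_step_confluent assms(1,3)] by blast
  then show ?thesis
    using assms(2,4) converse_rtranclpE by metis
qed

theorem theorem4p1:
  fixes \<A> :: "cp2 set set" and S :: "cp2 set" and I :: "divisor_index set"
  assumes "LAC_datum \<A> S I"
  shows "\<exists>\<A>' P.
    (\<forall>\<B> Q. reduces_to \<A> S I \<B> Q \<longleftrightarrow> \<B> = \<A>' \<and> Q = P) \<and>
    reduced_LAC_datum \<A>' P (Inr ` P) \<and>
    LAC_equivalent \<A> S I \<A>' P (Inr ` P)"
proof -
  let ?C = "(initial_lines \<A> I, initial_points \<A> S I)"
  have fin: "finite \<A>" "\<A> \<subseteq> range line" "finite S"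
    using assms by (simp_all add: LAC_datum_def)
  have C: "reduction_state ?C"
    using fin by (auto simp: reduction_state_def initial_lines_def initial_points_def discard_free_def)
  then have "finite (initial_lines \<A> I)"
    by (simp add: reduction_state_def)
  from exists_reduction_normal_form[OF this] obtain \<A>' P where
    steps: "reduction_step\<^sup>*\<^sup>* ?C (\<A>', P)" and normal: "\<nexists>D. reduction_step (\<A>', P) D"
    by (metis surj_pair)
  \<comment> \<open>This is canonicity: whatever choices a run makes, confluence leaves only one
    final state.\<close>
  have "reduces_to \<A> S I \<B> Q \<longleftrightarrow> \<B> = \<A>' \<and> Q = P" for \<B> Q
    using steps normal reduction_normal_form_unique[of ?C "(\<B>, Q)" "(\<A>', P)"]
      unfolding reduces_to_def by blast
  moreover have state: "reduction_state (\<A>', P)"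
    and iso: "isomorphic_fundamental_groups (surface (initial_lines \<A> I) (initial_points \<A> S I)
        (initial_points \<A> S I))
      (surface \<A>' P P)"
    using reduction_steps_isomorphic[OF steps C] by simp_all
  moreover have "reduced_LAC_datum \<A>' P (Inr ` P)"
  proof -
    \<comment> \<open>The invariant gives a line through \<open>p\<close>; if it were the only one,
      a further step would be possible.\<close>
    have "p \<in> Sing \<A>'" if p: "p \<in> P" for p
    proof -
      obtain L where L: "L \<in> \<A>'" "p \<in> L"
        using state p by (auto simp: reduction_state_def)
      have "{M \<in> \<A>'. p \<in> M} \<noteq> {L}"
        using normal p unfolding reduction_step_iff by blast
      then obtain M where "M \<in> \<A>'" "p \<in> M" "M \<noteq> L"
        using L by blast
      then show ?thesis
        using L by (auto simp: Sing_def)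
    qed
    then show ?thesis
      using state by (auto simp: reduced_LAC_datum_def LAC_datum_def reduction_state_def)
  qed
  moreover have "LAC_equivalent \<A> S I \<A>' P (Inr ` P)"
    unfolding LAC_equivalent_def surface_def[symmetric]
    using isomorphic_initial[OF fin] iso by (rule isomorphic_fundamental_groups_trans)
  ultimately show ?thesis by blast
qed

end
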